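(* Let $A=t_1t_0^\vee+(t_1t_0^\vee)^{-1}$, $B=t_1^\vee t_1+(t_1^\vee t_1)^{-1}$, $C=t_0t_1+(t_0t_1)^{-1}$ in $\mathfrak H$, and let $c_0=k_0+k_0^{-1}$, $\tilde c_1=q^{-1}k_1+qk_1^{-1}$, $c_0^\vee=k_0^\vee+k_0^{\vee-1}$, $c_1^\vee=k_1^\vee+k_1^{\vee-1}$. Then the center $Z(\mathfrak H)$ is the commutative $\mathbb F$-algebra generated by $T_{\bar d}(A)$, $T_{\bar d}(B)$, $T_{\bar d}(C)$ subject to the single relation $$ q^{\bar d}\phi_{\bar d}^{(0)}(c_0^\vee,c_1^\vee,c_0;\tilde c_1)\,T_{\bar d}(A) +q^{\bar d}\phi_{\bar d}^{(1)}(c_0^\vee,c_1^\vee,c_0;\tilde c_1)\,T_{\bar d}(B) +q^{\bar d}\phi_{\bar d}^{(2)}(c_0^\vee,c_1^\vee,c_0;\tilde c_1)\,T_{\bar d}(C) $$ $$ =q^{\bar d}T_{\bar d}(A)T_{\bar d}(B)T_{\bar d}(C)+T_{\bar d}(A)^2+T_{\bar d}(B)^2+T_{\bar d}(C)^2+\psi_{\bar d}(c_0^\vee,c_1^\vee,c_0;\tilde c_1)-2 . $$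
   Context: $\mathbb F$ is an arbitrary field and $q\in\mathbb F$ is a primitive $d$-th root of unity ($d\ge 1$ an integer). Put $\bar d=d$ if $d$ is odd and $\bar d=d/2$ if $d$ is even. Fix nonzero scalars $k_0,k_1,k_0^\vee,k_1^\vee\in\mathbb F$. The double affine Hecke algebra of type $(C_1^\vee,C_1)$ is the associative unital $\mathbb F$-algebra $\mathfrak H$ generated by $t_0,t_1,t_0^\vee,t_1^\vee$ subject to $(t_0-k_0)(t_0-k_0^{-1})=0$, $(t_1-k_1)(t_1-k_1^{-1})=0$, $(t_0^\vee-k_0^\vee)(t_0^\vee-k_0^{\vee-1})=0$, $(t_1^\vee-k_1^\vee)(t_1^\vee-k_1^{\vee-1})=0$, $t_0^\vee t_0t_1^\vee t_1=q^{-1}$. (Hence all four generators are invertible.) $T_n(X)$ are the normalized Chebyshev polynomials of the first kind: $T_0(X)=2$, $T_1(X)=X$, $T_{n+1}(X)=XT_n(X)-T_{n-1}(X)$ for $n\ge1$. For $n\ge 0$ and $i\in\mathbb Z/3\mathbb Z$ (indices of $X_j$ read mod 3) put $\phi_n^{(i)}(X_0,X_1,X_2;X)=T_n(X)T_n(X_i)+T_n(X_{i+1})T_n(X_{i+2})$ and $\psi_n(X_0,X_1,X_2;X)=T_{2n}(X)+T_n(X_0)^2+T_n(X_1)^2+T_n(X_2)^2+T_n(X)T_n(X_0)T_n(X_1)T_n(X_2)$. *)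

theory Defs
  imports
    "HOL-Library.Poly_Mapping"
    "HOL-Algebra.Algebraic_Closure_Type"
begin

text \<open>The free associative algebra and the polynomial algebra are monoid algebras, with the convolution product of \<^theory>\<open>HOL-Library.Poly_Mapping\<close>:
  over the free monoid and over the free commutative monoid (exponent vectors), respectively. The free monoid is wrapped in its own type
  because its operation has to be written additively to serve as an index type there.\<close>

datatype 'g word = Word "'g list"

instantiation word :: (type) monoid_add
begin

definition zero_word :: "'g word" where
  "zero_word = Word []"

fun plus_word :: "'g word \<Rightarrow> 'g word \<Rightarrow> 'g word" where
  "plus_word (Word u) (Word v) = Word (u @ v)"

instance
proof
  fix a b c :: "'g word"
  show "a + b + c = a + (b + c)" by (cases a; cases b; cases c) simp
  show "0 + a = a" by (cases a) (simp add: zero_word_def)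
  show "a + 0 = a" by (cases a) (simp add: zero_word_def)
qed

end

type_synonym ('g, 'a) free_alg = "'g word \<Rightarrow>\<^sub>0 'a"
type_synonym ('v, 'a) poly_alg = "('v \<Rightarrow>\<^sub>0 nat) \<Rightarrow>\<^sub>0 'a"

text \<open>The scalar \<open>c\<close> as an element of either algebra: \<open>c\<close> times the neutral monomial.\<close>

definition Const :: "'a \<Rightarrow> ('m::zero \<Rightarrow>\<^sub>0 'a::zero)" where
  "Const c = Poly_Mapping.single 0 c"

definition free_gen :: "'g \<Rightarrow> ('g, 'a::ring_1) free_alg" where
  "free_gen g = Poly_Mapping.single (Word [g]) 1"

definition poly_var :: "'v \<Rightarrow> ('v, 'a::comm_ring_1) poly_alg" where
  "poly_var v = Poly_Mapping.single (Poly_Mapping.single v 1) 1"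

text \<open>Generators of the double affine Hecke algebra of type \<open>(C\<^sub>1\<^sup>\<or>, C\<^sub>1)\<close>. A suffix \<open>v\<close> stands for the superscript \<open>\<or>\<close>.\<close>

datatype gen = G0 | G1 | G0v | G1v

definition daha_relators ::
  "'a::field \<Rightarrow> 'a \<Rightarrow> 'a \<Rightarrow> 'a \<Rightarrow> 'a \<Rightarrow> (gen, 'a) free_alg set" where
  "daha_relators q k0 k1 k0v k1v =
    {(free_gen G0 - Const k0) * (free_gen G0 - Const (inverse k0)),
     (free_gen G1 - Const k1) * (free_gen G1 - Const (inverse k1)),
     (free_gen G0v - Const k0v) * (free_gen G0v - Const (inverse k0v)),
     (free_gen G1v - Const k1v) * (free_gen G1v - Const (inverse k1v)),
     free_gen G0v * free_gen G0 * free_gen G1v * free_gen G1 - Const (inverse q)}"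

text \<open>\<^const>\<open>genideal\<close> is the two-sided ideal generated by a set.\<close>

definition daha_ideal ::
  "'a::field \<Rightarrow> 'a \<Rightarrow> 'a \<Rightarrow> 'a \<Rightarrow> 'a \<Rightarrow> (gen, 'a) free_alg set" where
  "daha_ideal q k0 k1 k0v k1v = Idl\<^bsub>ring_of_type_algebra\<^esub> (daha_relators q k0 k1 k0v k1v)"

definition daha ::
  "'a::field \<Rightarrow> 'a \<Rightarrow> 'a \<Rightarrow> 'a \<Rightarrow> 'a \<Rightarrow> (gen, 'a) free_alg set ring" where
  "daha q k0 k1 k0v k1v = ring_of_type_algebra Quot daha_ideal q k0 k1 k0v k1v"

definition daha_class ::
  "'a::field \<Rightarrow> 'a \<Rightarrow> 'a \<Rightarrow> 'a \<Rightarrow> 'a \<Rightarrow> (gen, 'a) free_alg \<Rightarrow> (gen, 'a) free_alg set" where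
  "daha_class q k0 k1 k0v k1v x = daha_ideal q k0 k1 k0v k1v +>\<^bsub>ring_of_type_algebra\<^esub> x"

definition ring_center :: "('r, 'm) ring_scheme \<Rightarrow> 'r set" where
  "ring_center R = {z \<in> carrier R. \<forall>x\<in>carrier R. z \<otimes>\<^bsub>R\<^esub> x = x \<otimes>\<^bsub>R\<^esub> z}"

text \<open>Chebyshev polynomials of the first kind, normalized so that \<open>x + 1/x\<close> is sent to
  \<open>x ^ n + 1 / x ^ n\<close>; first on a commutative ring type, then on a ring given as a record.\<close>

fun cheb :: "nat \<Rightarrow> 'a::comm_ring_1 \<Rightarrow> 'a" where
  "cheb 0 x = 2"
| "cheb (Suc 0) x = x"
| "cheb (Suc (Suc n)) x = x * cheb (Suc n) x - cheb n x"

fun cheb_in :: "('r, 'm) ring_scheme \<Rightarrow> nat \<Rightarrow> 'r \<Rightarrow> 'r" where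
  "cheb_in R 0 x = \<one>\<^bsub>R\<^esub> \<oplus>\<^bsub>R\<^esub> \<one>\<^bsub>R\<^esub>"
| "cheb_in R (Suc 0) x = x"
| "cheb_in R (Suc (Suc n)) x = x \<otimes>\<^bsub>R\<^esub> cheb_in R (Suc n) x \<ominus>\<^bsub>R\<^esub> cheb_in R n x"

definition phi :: "nat \<Rightarrow> nat \<Rightarrow> 'a \<Rightarrow> 'a \<Rightarrow> 'a \<Rightarrow> 'a \<Rightarrow> 'a::comm_ring_1" where
  "phi n i x0 x1 x2 x =
    (let Y = (\<lambda>j. [x0, x1, x2] ! (j mod 3))
     in cheb n x * cheb n (Y i) + cheb n (Y (i + 1)) * cheb n (Y (i + 2)))"

definition psi :: "nat \<Rightarrow> 'a \<Rightarrow> 'a \<Rightarrow> 'a \<Rightarrow> 'a \<Rightarrow> 'a::comm_ring_1" where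
  "psi n x0 x1 x2 x =
    cheb (2 * n) x + (cheb n x0)\<^sup>2 + (cheb n x1)\<^sup>2 + (cheb n x2)\<^sup>2
    + cheb n x * cheb n x0 * cheb n x1 * cheb n x2"

definition primitive_root_of_unity :: "nat \<Rightarrow> 'a::field \<Rightarrow> bool" where
  "primitive_root_of_unity d q \<longleftrightarrow> q ^ d = 1 \<and> (\<forall>m. 0 < m \<and> m < d \<longrightarrow> q ^ m \<noteq> 1)"

definition dbar :: "nat \<Rightarrow> nat" where
  "dbar d = (if odd d then d else d div 2)"

datatype var3 = VA | VB | VC

text \<open>The left-hand side minus the right-hand side of the relation.\<close>

definition center_relator ::
  "'a::field \<Rightarrow> nat \<Rightarrow> 'a \<Rightarrow> 'a \<Rightarrow> 'a \<Rightarrow> 'a \<Rightarrow> (var3, 'a) poly_alg" where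
  "center_relator q n x0 x1 x2 x =
    (let a = poly_var VA; b = poly_var VB; c = poly_var VC in
       (Const (q ^ n * phi n 0 x0 x1 x2 x) * a
        + Const (q ^ n * phi n 1 x0 x1 x2 x) * b
        + Const (q ^ n * phi n 2 x0 x1 x2 x) * c)
     - (Const (q ^ n) * a * b * c + a\<^sup>2 + b\<^sup>2 + c\<^sup>2 + Const (psi n x0 x1 x2 x - 2)))"

text \<open>\<open>presented_by R \<iota> S x rels\<close>: the subset \<open>S\<close> of the algebra \<open>R\<close>, whose scalars are embedded by
  \<open>\<iota>\<close>, is a subring, and as an algebra it is the commutative algebra with generators \<open>x v\<close> and defining
  relators \<open>rels\<close>, that is, \<open>v \<mapsto> x v\<close> induces an algebra isomorphism from the
  quotient of the polynomial algebra by the ideal generated by \<open>rels\<close> onto \<open>S\<close>.\<close>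

definition presented_by ::
  "('r, 'm) ring_scheme \<Rightarrow> ('a::field \<Rightarrow> 'r) \<Rightarrow> 'r set \<Rightarrow> ('v \<Rightarrow> 'r) \<Rightarrow> ('v, 'a) poly_alg set \<Rightarrow> bool"
  where
  "presented_by R \<iota> S x rels \<longleftrightarrow>
    subring S R \<and>
    (let P = (ring_of_type_algebra :: ('v, 'a) poly_alg ring); J = Idl\<^bsub>P\<^esub> rels
     in \<exists>h \<in> ring_iso (P Quot J) (R\<lparr>carrier := S\<rparr>).
          (\<forall>c. h (J +>\<^bsub>P\<^esub> Const c) = \<iota> c) \<and> (\<forall>v. h (J +>\<^bsub>P\<^esub> poly_var v) = x v))"

end

theory Submission
  imports Defs "HOL-Library.Function_Algebras" "HOL-Computational_Algebra.Polynomial"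
begin

text \<open>
The algebra acts on its left regular representation, which is induced from \<open>\<langle>t\<^sub>0, t\<^sub>1\<rangle>\<close>: vectors are
functions from \<open>\<int>\<close>, indexing the alternating words in \<open>t\<^sub>0\<close> and \<open>t\<^sub>1\<close>, to the Laurent polynomials in
\<open>X = t\<^sub>1\<^sup>\<or> t\<^sub>1\<close>. The word \<open>1\<close> is separating, so the representation is faithful. All functions are admitted,
not only the finitely supported ones, in order to have simultaneous eigenvectors of \<open>t\<^sub>0, t\<^sub>1\<close> and of
\<open>t\<^sub>0\<^sup>\<or>, t\<^sub>1\<close>.

Write \<open>a, b, c\<close> for the images of \<open>A, B, C\<close> under the \<open>n\<close>-th Chebyshev polynomial and \<open>Z = X\<^sup>n\<close>, so \<open>b = Z + Z\<^sup>-\<^sup>1\<close>. The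
leading coordinate of a central element has word length \<open>2nr\<close> and lies in \<open>F[b] + Z\<^sup>-\<^sup>1 F[b]\<close>; comparison with
\<open>c\<^sup>r\<close> and \<open>a c\<^sup>r\<^sup>-\<^sup>1\<close> shows that the center is \<open>F[b, c] \<oplus> a F[b, c]\<close>. It remains to write \<open>a\<^sup>2\<close> in this form.
With \<open>P\<close> and \<open>Q\<close> the \<open>n\<close>-th powers of \<open>S\<^sub>0 S\<^sub>1\<close> and \<open>S\<^sub>1 S\<^sub>0\<close>, where \<open>S\<^sub>i\<close> are the intertwiners, and
\<open>D = \<plusminus>(Z - Z\<^sup>-\<^sup>1)\<^sup>2\<close>, one has \<open>D c = P + Q + v\<close> and \<open>D a = -q\<^sup>n (Z\<^sup>-\<^sup>1 P + Z Q) + v'\<close> with Laurent polynomials \<open>v, v', P Q\<close>,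
which are read off from the eigenvectors. Eliminating \<open>P\<close> and \<open>Q\<close> gives the relation.
\<close>

text \<open>The difficulty lies in the free terms \<open>v\<close>, \<open>v'\<close> and the
  product \<open>P Q\<close>: n-th powers of operators cannot be expanded directly. That the free
  terms are Laurent polynomials is an argument on lengths: no word shorter than 2n moves past X
  without changing it, so whatever commutes with X and is shorter than 2n is a multiplication. Their
  values come from eigenvectors with coordinate 1 at the empty word. There \<open>c\<close> (or
  \<open>a\<close>) acts by a scalar and \<open>S0\<close>, \<open>S1\<close> by Laurent
  polynomials, so \<open>P\<close> and \<open>Q\<close> act by products over the orbit of X under X
  -> q^2 X. As q^2 has exact order n, the orbit product of 1 - rho X collapses to 1 - rho^n Z, and
  coordinate 0 of the operator identity gives the unknown term. Eigenvectors of t0, t1 serve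
  \<open>c\<close>, those of t0v, t1 serve \<open>a\<close>. \<open>D\<close> is the leading
  coordinate of \<open>P\<close>; elimination yields the relation times D^2, and D^2 cancels because
  coordinates lie in a domain. Nothing depends on the characteristic: the signs q^n, (-1)^n and
  q^(n(n-1)) are carried as \<open>\<eta>\<close>, \<open>sg\<close> and
  \<open>\<tau>\<close>.\<close>

section \<open>Evaluation homomorphisms of monoid algebras\<close>

lemma poly_mapping_sum_single:
  "p = (\<Sum>k\<in>Poly_Mapping.keys p. Poly_Mapping.single k (Poly_Mapping.lookup p k))"
  for p :: "'m \<Rightarrow>\<^sub>0 'a::comm_monoid_add"
proof (rule poly_mapping_eqI)
  fix k
  show "Poly_Mapping.lookup p k =
      Poly_Mapping.lookup (\<Sum>k\<in>Poly_Mapping.keys p. Poly_Mapping.single k (Poly_Mapping.lookup p k)) k"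
    by (simp only: lookup_sum lookup_single when_def sum.delta[OF finite_keys])
      (simp add: in_keys_iff)
qed

lemma poly_mapping_induct_single [case_names zero add]:
  fixes p :: "'m \<Rightarrow>\<^sub>0 'a::comm_monoid_add"
  assumes "P 0" and "\<And>m c p. P p \<Longrightarrow> P (Poly_Mapping.single m c + p)"
  shows "P p"
proof -
  have "P (\<Sum>k\<in>K. Poly_Mapping.single k (Poly_Mapping.lookup p k))" if "finite K" for K
    using that by induction (auto intro: assms)
  then show ?thesis
    by (metis finite_keys poly_mapping_sum_single)
qed

locale scalar_hom =
  fixes sc :: "'a::field \<Rightarrow> 'r::ring_1"
  assumes sc_add: "sc (x + y) = sc x + sc y"
    and sc_mult: "sc (x * y) = sc x * sc y"
    and sc_one: "sc 1 = 1"
begin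

lemma sc_zero: "sc 0 = 0"
  using sc_add[of 0 0] by simp

lemma sc_minus: "sc (- x) = - sc x"
  using sc_add[of x "- x"] by (simp add: sc_zero minus_unique)

lemma sc_diff: "sc (x - y) = sc x - sc y"
  using sc_add[of x "- y"] by (simp add: sc_minus)

lemma sc_power: "sc (x ^ n) = sc x ^ n"
  by (induction n) (simp_all add: sc_one sc_mult)

definition lin :: "('k \<Rightarrow> 'r) \<Rightarrow> ('k \<Rightarrow>\<^sub>0 'a) \<Rightarrow> 'r" where
  "lin B u = (\<Sum>k\<in>Poly_Mapping.keys u. sc (Poly_Mapping.lookup u k) * B k)"

lemma lin_superset:
  assumes "finite K" "Poly_Mapping.keys u \<subseteq> K"
  shows "lin B u = (\<Sum>k\<in>K. sc (Poly_Mapping.lookup u k) * B k)"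
  unfolding lin_def
  by (rule sum.mono_neutral_left) (use assms in \<open>auto simp: in_keys_iff sc_zero\<close>)

lemma lin_add: "lin B (u + u') = lin B u + lin B u'"
proof -
  let ?K = "Poly_Mapping.keys u \<union> Poly_Mapping.keys u'"
  have "Poly_Mapping.keys (u + u') \<subseteq> ?K"
    by (rule keys_add)
  then show ?thesis
    by (simp add: lin_superset[where K = ?K] lookup_add sc_add distrib_right sum.distrib)
qed

lemma lin_zero: "lin B 0 = 0"
  by (simp add: lin_def)

lemma lin_single: "lin B (Poly_Mapping.single k c) = sc c * B k"
  by (auto simp: lin_def sc_zero lookup_single)

lemma lin_uminus: "lin B (- u) = - lin B u"
  using lin_add[of B u "- u"] by (simp add: lin_zero minus_unique)

lemma lin_diff: "lin B (u - u') = lin B u - lin B u'"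
  using lin_add[of B u "- u'"] by (simp add: lin_uminus)

end

text \<open>Scalars are asked to commute only with the values of \<open>\<mu>\<close>. They need not
  be central in the target, which for the representation is a ring of merely additive maps.\<close>

locale monoid_alg_eval = scalar_hom sc
  for sc :: "'a::field \<Rightarrow> 'r::ring_1" +
  fixes \<mu> :: "'m::monoid_add \<Rightarrow> 'r"
  assumes mu_zero: "\<mu> 0 = 1" and mu_add: "\<mu> (m + m') = \<mu> m * \<mu> m'"
    and mu_comm: "\<mu> m * sc x = sc x * \<mu> m"
begin

definition ev :: "('m \<Rightarrow>\<^sub>0 'a) \<Rightarrow> 'r" where
  "ev = lin \<mu>"

lemmas ev_add = lin_add[of \<mu>, folded ev_def]
  and ev_diff = lin_diff[of \<mu>, folded ev_def]
  and ev_uminus = lin_uminus[of \<mu>, folded ev_def]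
  and ev_zero = lin_zero[of \<mu>, folded ev_def]
  and ev_single = lin_single[of \<mu>, folded ev_def]

lemma ev_mult: "ev (p * p') = ev p * ev p'"
proof (induction p rule: poly_mapping_induct_single)
  case zero
  then show ?case by (simp add: ev_zero)
next
  case (add m c p)
  have "ev (Poly_Mapping.single m c * p') = ev (Poly_Mapping.single m c) * ev p'"
  proof (induction p' rule: poly_mapping_induct_single)
    case zero
    then show ?case by (simp add: ev_zero)
  next
    case (add m' c' p')
    have "sc (c * c') * \<mu> (m + m') = (sc c * \<mu> m) * (sc c' * \<mu> m')"
      by (simp add: sc_mult mu_add mult.assoc) (metis mu_comm mult.assoc)
    then show ?case
      by (simp add: add distrib_left ev_add mult_single ev_single)
  qed
  then show ?case
    by (simp add: distrib_right ev_add add)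
qed

lemma ev_Const: "ev (Const c) = sc c"
  by (simp add: Const_def ev_single mu_zero)

lemma ev_one: "ev 1 = 1"
  using ev_single[of 0 1] by (simp add: mu_zero sc_one)

lemma ev_power: "ev (p ^ n) = ev p ^ n"
  by (induction n) (simp_all add: ev_one ev_mult)

end

lemma Const_add: "Const (x + y) = (Const x + Const y :: 'm::monoid_add \<Rightarrow>\<^sub>0 'a::ring_1)"
  and Const_mult: "Const (x * y) = (Const x * Const y :: 'm \<Rightarrow>\<^sub>0 'a)"
  and Const_one: "Const 1 = 1"
  and Const_zero: "Const 0 = 0"
  and Const_uminus: "Const (- x) = - Const x"
  and Const_diff: "Const (x - y) = Const x - Const y"
  by (simp_all add: Const_def single_add mult_single single_uminus single_diff)

lemma Const_commute: "Const x * z = z * Const x" for z :: "'m::monoid_add \<Rightarrow>\<^sub>0 'a::field"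
  by (induction z rule: poly_mapping_induct_single)
    (simp_all add: Const_def distrib_left distrib_right mult_single mult.commute)

lemma scalar_hom_Const: "scalar_hom (Const :: 'a::field \<Rightarrow> 'm::monoid_add \<Rightarrow>\<^sub>0 'a)"
  by unfold_locales (simp_all add: Const_add Const_mult Const_one)

section \<open>Endomorphism rings\<close>

text \<open>Additivity is all that is imposed, since the operators are not linear over Laurent
  polynomials and scalars act as operators themselves. The class \<open>zero_neq_one\<close> on
  vectors supplies a vector that separates the maps 0 and 1.\<close>

typedef (overloaded) 'v endo =
  "{f :: 'v::{ab_group_add,zero_neq_one} \<Rightarrow> 'v. \<forall>x y. f (x + y) = f x + f y}"
  morphisms app Abs_endo
  by (rule exI[of _ "\<lambda>x. x"]) simp

setup_lifting type_definition_endo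

lemma app_add: "app f (x + y) = app f x + app f y"
  by transfer simp

lemma app_zero [simp]: "app f 0 = 0"
  using app_add[of f 0 0] by simp

lemma endo_eqI: "(\<And>x. app f x = app g x) \<Longrightarrow> f = g"
  by transfer auto

instantiation endo :: ("{ab_group_add,zero_neq_one}") ring_1
begin

lift_definition zero_endo :: "'a endo" is "\<lambda>_. 0" by simp
lift_definition one_endo :: "'a endo" is "\<lambda>x. x" by simp
lift_definition plus_endo :: "'a endo \<Rightarrow> 'a endo \<Rightarrow> 'a endo" is "\<lambda>f g x. f x + g x"
  by (simp add: algebra_simps)
lift_definition minus_endo :: "'a endo \<Rightarrow> 'a endo \<Rightarrow> 'a endo" is "\<lambda>f g x. f x - g x"
  by (simp add: algebra_simps)
lift_definition uminus_endo :: "'a endo \<Rightarrow> 'a endo" is "\<lambda>f x. - f x"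
  by simp
lift_definition times_endo :: "'a endo \<Rightarrow> 'a endo \<Rightarrow> 'a endo" is "\<lambda>f g x. f (g x)"
  by simp

lemmas app_rep_eqs = zero_endo.rep_eq one_endo.rep_eq plus_endo.rep_eq minus_endo.rep_eq
  uminus_endo.rep_eq times_endo.rep_eq

instance
proof
  fix f g h :: "'a endo"
  show "(0::'a endo) \<noteq> 1"
  proof
    assume "(0::'a endo) = 1"
    then have "app (0::'a endo) 1 = app 1 1" by simp
    then show False by (simp add: app_rep_eqs)
  qed
qed (rule endo_eqI, simp add: app_rep_eqs app_add add_ac)+

end

lemma app_simps [simp]:
  "app 0 v = 0" "app 1 v = v" "app (f + g) v = app f v + app g v"
  "app (f - g) v = app f v - app g v" "app (- f) v = - app f v"
  "app (f * g) v = app f (app g v)"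
  by (simp_all add: app_rep_eqs)

lemma app_sum: "app (sum f A) v = (\<Sum>x\<in>A. app (f x) v)"
  by (induction A rule: infinite_finite_induct) simp_all

section \<open>Chebyshev polynomials and roots of unity\<close>

text \<open>\<open>cheb\<close> is confined to commutative types; operators need this copy.\<close>

fun ncheb :: "nat \<Rightarrow> 'r::ring_1 \<Rightarrow> 'r" where
  "ncheb 0 x = 2"
| "ncheb (Suc 0) x = x"
| "ncheb (Suc (Suc n)) x = x * ncheb (Suc n) x - ncheb n x"

lemma ncheb_inverse:
  fixes x y :: "'r::ring_1"
  assumes "x * y = 1" "y * x = 1"
  shows "ncheb n (x + y) = x ^ n + y ^ n"
proof (induction n rule: induct_nat_012)
  case (ge2 n)
  have "y * x ^ Suc n = x ^ n" "x * y ^ Suc n = y ^ n"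
    by (simp_all add: assms flip: mult.assoc)
  then show ?case
    using ge2 by (simp add: algebra_simps)
qed simp_all

lemma cheb_eq_ncheb: "cheb n x = ncheb n x"
  by (induction n rule: induct_nat_012) simp_all

lemma cheb_inverse:
  assumes "x * y = 1"
  shows "cheb n (x + y) = x ^ n + y ^ n"
  using assms by (simp add: cheb_eq_ncheb ncheb_inverse mult.commute)

lemma ncheb_commute:
  fixes x z :: "'r::ring_1"
  assumes "x * z = z * x"
  shows "ncheb n x * z = z * ncheb n x"
proof (induction n rule: induct_nat_012)
  case 0
  then show ?case by (simp add: mult_2 mult_2_right)
next
  case (ge2 n)
  have "x * ncheb (Suc n) x * z = z * (x * ncheb (Suc n) x)"
    using ge2 assms by (metis mult.assoc)
  with ge2 show ?case
    by (simp add: left_diff_distrib right_diff_distrib)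
qed (simp_all add: assms)

lemma mult_inverses:
  fixes a b c d :: "'r::monoid_mult"
  assumes "a * b = 1" "c * d = 1"
  shows "(c * a) * (b * d) = 1"
proof -
  have "(c * a) * (b * d) = c * (a * b) * d"
    by (simp only: mult.assoc)
  with assms show ?thesis by simp
qed

text \<open>Both sides equal u v u + v'. On the left, write u (u v) as u (u + u') v - v and u v' u'
  as u (v + v') u' - u v u', and move the traces.\<close>

lemma trace_commute:
  fixes u v u' v' :: "'r::ring_1"
  assumes u: "u * u' = 1" "u' * u = 1" and v: "v * v' = 1" "v' * v = 1"
    and comm: "(u + u') * v = v * (u + u')" "(v + v') * u = u * (v + v')"
  shows "u * (u * v + v' * u') = (u * v + v' * u') * u"
proof -
  have "u * (u * v + v' * u') = u * (u * v) + u * (v + v') * u' - u * v * u'"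
    by (simp add: algebra_simps)
  also have "u * (v + v') * u' = v + v'"
    by (simp add: comm(2)[symmetric] mult.assoc u)
  also have "u * (u * v) = u * ((u + u') * v) - v"
    by (simp add: algebra_simps u flip: mult.assoc)
  also have "u * ((u + u') * v) = u * v * u + u * v * u'"
    unfolding comm(1) by (simp add: algebra_simps)
  finally show ?thesis
    by (simp add: algebra_simps u)
qed

text \<open>The bracket is a Chebyshev polynomial in \<open>u * v + v' * u'\<close>, so it commutes
  with everything that this trace commutes with. The claim on \<open>v\<close> is the first claim
  for the pair \<open>v'\<close>, \<open>u'\<close>, whose product is the inverse of
  \<open>u * v\<close>.\<close>

lemma power_trace_commute:
  fixes u v u' v' :: "'r::ring_1"
  assumes u: "u * u' = 1" "u' * u = 1" and v: "v * v' = 1" "v' * v = 1"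
    and comm: "(u + u') * v = v * (u + u')" "(v + v') * u = u * (v + v')"
  shows "u * ((u * v) ^ n + (v' * u') ^ n) = ((u * v) ^ n + (v' * u') ^ n) * u"
    and "v * ((u * v) ^ n + (v' * u') ^ n) = ((u * v) ^ n + (v' * u') ^ n) * v"
proof -
  have inv: "u * v * (v' * u') = 1" "v' * u' * (u * v) = 1"
    using u v by (simp_all add: mult_inverses)
  have comm': "(v' + v) * u' = u' * (v' + v)" "(u' + u) * v' = v' * (u' + u)"
  proof -
    have "u' * ((v + v') * u) * u' = u' * (u * (v + v')) * u'"
      by (simp only: comm)
    then show "(v' + v) * u' = u' * (v' + v)"
      by (metis add.commute mult.assoc mult_1_left mult_1_right u)
    have "v' * ((u + u') * v) * v' = v' * (v * (u + u')) * v'"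
      by (simp only: comm)
    then show "(u' + u) * v' = v' * (u' + u)"
      by (metis add.commute mult.assoc mult_1_left mult_1_right v)
  qed
  have "u * ncheb n (u * v + v' * u') = ncheb n (u * v + v' * u') * u"
    by (rule ncheb_commute[symmetric]) (rule trace_commute[OF u v comm, symmetric])
  then show "u * ((u * v) ^ n + (v' * u') ^ n) = ((u * v) ^ n + (v' * u') ^ n) * u"
    by (simp add: ncheb_inverse inv)
  have "ncheb n (v' * u' + u * v) * v' = v' * ncheb n (v' * u' + u * v)"
    by (rule ncheb_commute) (rule trace_commute[OF v(2,1) u(2,1) comm', symmetric])
  then have "((u * v) ^ n + (v' * u') ^ n) * v' = v' * ((u * v) ^ n + (v' * u') ^ n)"
    by (simp add: ncheb_inverse inv add.commute)
  then show "v * ((u * v) ^ n + (v' * u') ^ n) = ((u * v) ^ n + (v' * u') ^ n) * v"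
    by (metis mult.assoc mult_1_left mult_1_right v)
qed

text \<open>The difference of the two sides, as a polynomial of degree at most \<open>n\<close> in the variable,
  vanishes at \<open>0\<close> and at the \<open>n\<close> powers of \<open>\<zeta>\<close>.\<close>

lemma prod_one_minus_root_power_poly:
  fixes \<zeta> :: "'a::field"
  assumes "\<zeta> ^ n = 1" "\<And>m. 0 < m \<Longrightarrow> m < n \<Longrightarrow> \<zeta> ^ m \<noteq> 1" "n > 0"
  shows "(\<Prod>i<n. [:1, - (\<zeta> ^ i):]) = 1 - monom 1 n"
proof (rule ccontr)
  let ?p = "(\<Prod>i<n. [:1, - (\<zeta> ^ i):]) - (1 - monom 1 n)"
  assume "\<not> ?thesis"
  then have nz: "?p \<noteq> 0" by simp
  have z: "\<zeta> \<noteq> 0" using assms(1,3) by (auto simp: power_0_left)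
  have "degree (\<Prod>i<n. [:1, - (\<zeta> ^ i):]) \<le> (\<Sum>i<n. degree [:1, - (\<zeta> ^ i):])"
    using degree_prod_sum_le[of "{..<n}" "\<lambda>i. [:1, - (\<zeta> ^ i):]"] unfolding o_def by blast
  also have "\<dots> \<le> (\<Sum>i<n. 1)" by (rule sum_mono) simp
  finally have "degree (\<Prod>i<n. [:1, - (\<zeta> ^ i):]) \<le> n" by simp
  moreover have "degree (1 - monom 1 n :: 'a poly) \<le> n"
    by (intro degree_diff_le) (simp_all add: degree_monom_le)
  ultimately have deg: "degree ?p \<le> n"
    by (rule degree_diff_le)
  have inj: "inj_on (\<lambda>i. inverse \<zeta> ^ i) {..<n}"
  proof (rule linorder_inj_onI)
    fix i j assume "i < j" "i \<in> {..<n}" "j \<in> {..<n}"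
    then have "\<zeta> ^ (j - i) \<noteq> 1" by (intro assms(2)) auto
    moreover have "\<zeta> ^ j = \<zeta> ^ i * \<zeta> ^ (j - i)"
      using \<open>i < j\<close> by (simp flip: power_add)
    ultimately show "inverse \<zeta> ^ i \<noteq> inverse \<zeta> ^ j"
      using z by (auto simp: power_inverse)
  qed auto
  let ?R = "insert 0 ((\<lambda>i. inverse \<zeta> ^ i) ` {..<n})"
  have "poly ?p x = 0" if x: "x \<in> ?R" for x
  proof (cases "x = 0")
    case True
    then show ?thesis using assms(3) by (simp add: poly_prod poly_monom power_0_left)
  next
    case False
    then obtain i where i: "i < n" "x = inverse \<zeta> ^ i" using x by auto
    have "x ^ n = inverse ((\<zeta> ^ n) ^ i)"
      by (simp add: i power_inverse flip: power_mult) (simp add: mult.commute)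
    then have "x ^ n = 1"
      by (simp add: assms(1))
    moreover have "(\<Prod>i<n. 1 - x * \<zeta> ^ i) = 0"
      using i z by (intro prod_zero) (auto simp: field_simps intro!: bexI[of _ i])
    ultimately show ?thesis by (simp add: poly_prod poly_monom algebra_simps)
  qed
  then have "?R \<subseteq> {x. poly ?p x = 0}" by auto
  then have "card ?R \<le> card {x. poly ?p x = 0}"
    by (rule card_mono[OF poly_roots_finite[OF nz]])
  also have "\<dots> \<le> degree ?p" by (rule card_poly_roots_bound[OF nz])
  finally have "card ?R \<le> n" using deg by simp
  moreover have "card ?R = Suc n"
    using z by (subst card_insert_disjoint) (auto simp: card_image[OF inj])
  ultimately show False by simp
qed

text \<open>Roots are counted over the field, but the identity is wanted for elements of a monoid
  algebra: coefficients are mapped by \<open>Const\<close>, then \<open>w\<close> is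
  substituted.\<close>

lemma poly_map_poly_Const_prod:
  fixes w :: "'m::comm_monoid_add \<Rightarrow>\<^sub>0 'a::field"
  shows "poly (map_poly Const (\<Prod>i<m. [:1, - (\<zeta> ^ i):])) w = (\<Prod>i<m. 1 - Const (\<zeta> ^ i) * w)"
proof (induction m)
  case 0
  then show ?case by (simp add: Const_one)
next
  case (Suc m)
  define p where "p = (\<Prod>i<m. [:1, - (\<zeta> ^ i):])"
  have step: "map_poly Const ([:1, - a:] * p) = [:1, - Const a:] * (map_poly Const p :: ('m \<Rightarrow>\<^sub>0 'a) poly)" for a
    by (rule poly_eqI)
      (simp add: coeff_map_poly Const_zero Const_add Const_diff Const_uminus Const_mult coeff_pCons split: nat.split)
  have "poly (map_poly Const ([:1, - (\<zeta> ^ m):] * p)) w = (1 - Const (\<zeta> ^ m) * w) * poly (map_poly Const p) w"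
    unfolding step by (simp add: algebra_simps)
  then show ?case
    using Suc by (simp add: p_def mult.commute del: mult_pCons_left mult_pCons_right)
qed

lemma prod_one_minus_root_power:
  fixes w :: "'m::comm_monoid_add \<Rightarrow>\<^sub>0 'a::field"
  assumes "\<zeta> ^ n = 1" "\<And>m. 0 < m \<Longrightarrow> m < n \<Longrightarrow> \<zeta> ^ m \<noteq> 1" "n > 0"
  shows "(\<Prod>i<n. 1 - Const (\<zeta> ^ i) * w) = 1 - w ^ n"
proof -
  have "map_poly Const (1 - monom 1 n) = (1 - monom 1 n :: ('m \<Rightarrow>\<^sub>0 'a) poly)"
    by (rule poly_eqI) (simp add: coeff_map_poly Const_zero Const_diff Const_one)
  then have "poly (map_poly Const (\<Prod>i<n. [:1, - (\<zeta> ^ i):])) w = 1 - w ^ n"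
    by (subst prod_one_minus_root_power_poly[OF assms]) (simp_all add: poly_monom)
  then show ?thesis
    by (simp only: poly_map_poly_Const_prod)
qed

section \<open>Laurent polynomials and reflections\<close>

type_synonym 'a lau = "int \<Rightarrow>\<^sub>0 'a"

definition Xp :: "int \<Rightarrow> 'a::field lau" where
  "Xp m = Poly_Mapping.single m 1"

lemma Xp_zero [simp]: "Xp 0 = 1"
  by (simp add: Xp_def)

lemma Xp_add: "Xp (m + n) = Xp m * Xp n"
  by (simp add: Xp_def mult_single)

lemma Xp_minus_add: "Xp (- m - n) = Xp (- m) * Xp (- n)"
  using Xp_add[of "- m" "- n"] by simp

lemma Xp_cancel [simp]: "Xp m * Xp (- m) = 1" "Xp (- m) * Xp m = 1"
  by (simp_all flip: Xp_add)

lemma Xp_power: "Xp m ^ k = Xp (m * int k)"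
  by (induction k) (simp_all add: distrib_left Xp_add)

lemma single_eq_Const_Xp: "Poly_Mapping.single m c = Const c * Xp m"
  by (simp add: Const_def Xp_def mult_single)

lemma lookup_Const_mult: "Poly_Mapping.lookup (Const c * f) m = c * Poly_Mapping.lookup f m"
  for f :: "'m::monoid_add \<Rightarrow>\<^sub>0 'a::field"
  by (induction f rule: poly_mapping_induct_single)
    (simp_all add: Const_def distrib_left lookup_add mult_single lookup_single when_def)

lemma lookup_Xp: "Poly_Mapping.lookup (Xp m :: 'a::field lau) k = (if m = k then 1 else 0)"
  by (simp add: Xp_def lookup_single when_def)

lemma lau_induct [case_names zero add]:
  fixes f :: "'a::field lau"
  assumes "P 0" "\<And>m c f. P f \<Longrightarrow> P (Const c * Xp m + f)"
  shows "P f"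
  by (induction f rule: poly_mapping_induct_single) (simp_all add: assms single_eq_Const_Xp)

lemma Const_inverse: "(c :: 'a::field) \<noteq> 0 \<Longrightarrow> Const c * Const (inverse c) = 1"
  by (simp add: Const_one flip: Const_mult)

text \<open>X goes to r / X, and under \<open>scl\<close> to r X. For r = 1 and r = q^-2 these are
  the reflections attached to t1 and t0; composing the two gives \<open>scl\<close> with q^2 or its
  inverse.\<close>

definition rfl :: "'a::field \<Rightarrow> 'a lau \<Rightarrow> 'a lau" where
  "rfl r = monoid_alg_eval.ev Const (\<lambda>m. Const (r powi m) * Xp (- m))"

definition scl :: "'a::field \<Rightarrow> 'a lau \<Rightarrow> 'a lau" where
  "scl r = monoid_alg_eval.ev Const (\<lambda>m. Const (r powi m) * Xp m)"

context
  fixes r :: "'a::field"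
  assumes r: "r \<noteq> 0"
begin

interpretation R: monoid_alg_eval Const "\<lambda>m. Const (r powi m) * Xp (- m) :: 'a lau"
  rewrites "monoid_alg_eval.ev Const (\<lambda>m. Const (r powi m) * Xp (- m)) = rfl r"
  by (intro monoid_alg_eval.intro monoid_alg_eval_axioms.intro scalar_hom_Const)
    (simp_all add: rfl_def Const_one power_int_add r Const_mult Xp_minus_add ac_simps)

interpretation S: monoid_alg_eval Const "\<lambda>m. Const (r powi m) * Xp m :: 'a lau"
  rewrites "monoid_alg_eval.ev Const (\<lambda>m. Const (r powi m) * Xp m) = scl r"
  by (intro monoid_alg_eval.intro monoid_alg_eval_axioms.intro scalar_hom_Const)
    (simp_all add: scl_def Const_one power_int_add r Const_mult Xp_add ac_simps)

lemmas rfl_simps = R.ev_add R.ev_diff R.ev_uminus R.ev_mult R.ev_one R.ev_zero R.ev_Const R.ev_power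
lemmas scl_simps = S.ev_add S.ev_diff S.ev_uminus S.ev_mult S.ev_one S.ev_zero S.ev_Const S.ev_power

lemma rfl_Xp: "rfl r (Xp m) = Const (r powi m) * Xp (- m)"
  using R.ev_single[of m 1] by (simp add: Const_one flip: Xp_def)

lemma scl_Xp: "scl r (Xp m) = Const (r powi m) * Xp m"
  using S.ev_single[of m 1] by (simp add: Const_one flip: Xp_def)

lemma rfl_rfl [simp]: "rfl r (rfl r f) = f"
proof (induction f rule: lau_induct)
  case (add m c f)
  have "Const (r powi m) * (Const (r powi - m) * Xp m) = (Xp m :: 'a lau)"
    using r by (simp add: Const_one power_int_minus flip: Const_mult mult.assoc)
  with add show ?case
    by (simp add: rfl_simps rfl_Xp)
qed (simp add: rfl_simps)

lemma lookup_scl: "Poly_Mapping.lookup (scl r f) m = r powi m * Poly_Mapping.lookup f m"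
  by (induction f rule: lau_induct)
    (simp_all add: scl_simps scl_Xp lookup_add lookup_Const_mult lookup_Xp distrib_left)

definition "root_diff = (Xp 1 - Const r * Xp (- 1) :: 'a lau)"

lemma root_diff_nonzero: "root_diff \<noteq> 0"
proof
  assume "root_diff = 0"
  then have "Poly_Mapping.lookup root_diff 1 = 0" by simp
  then show False
    by (simp add: root_diff_def lookup_minus lookup_Const_mult lookup_Xp)
qed

lemma rfl_root_diff: "rfl r root_diff = - root_diff"
  using r by (simp add: root_diff_def rfl_simps rfl_Xp Const_inverse flip: mult.assoc)

text \<open>By the twisted Leibniz rule divisibility passes to products, so X and 1 / X
  suffice.\<close>

lemma root_diff_dvd: "root_diff dvd f - rfl r f"
proof -
  have mult: "root_diff dvd f * g - rfl r (f * g)"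
    if "root_diff dvd f - rfl r f" "root_diff dvd g - rfl r g" for f g
  proof -
    have "f * g - rfl r (f * g) = (f - rfl r f) * g + rfl r f * (g - rfl r g)"
      by (simp add: rfl_simps algebra_simps)
    with that show ?thesis by simp
  qed
  have 1: "root_diff dvd Xp 1 - rfl r (Xp 1)"
    by (simp add: rfl_Xp root_diff_def)
  have "Xp (- 1) - rfl r (Xp (- 1)) = - Const (inverse r) * root_diff"
    using r by (simp add: rfl_Xp root_diff_def right_diff_distrib power_int_minus Const_one
      flip: mult.assoc Const_mult)
  then have 2: "root_diff dvd Xp (- 1) - rfl r (Xp (- 1))"
    by simp
  have 3: "root_diff dvd Xp m - rfl r (Xp m)" for m
  proof (induction m rule: int_induct[where k = 0])
    case base
    then show ?case by (simp add: rfl_simps)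
  next
    case (step1 i)
    then show ?case using mult[OF _ 1] by (simp add: Xp_add)
  next
    case (step2 i)
    then show ?case using mult[OF _ 2] by (metis Xp_add add_uminus_conv_diff)
  qed
  show ?thesis
  proof (induction f rule: lau_induct)
    case (add m c f)
    have "Const c * Xp m + f - rfl r (Const c * Xp m + f) =
        Const c * (Xp m - rfl r (Xp m)) + (f - rfl r f)"
      by (simp add: rfl_simps algebra_simps)
    with add 3 show ?case by (metis dvd_add dvd_mult)
  qed (simp add: rfl_simps)
qed

text \<open>The divided difference (f - s f) / (X - r / X) of Demazure type. The quotient exists by
  \<open>root_diff_dvd\<close> and is unique because Laurent polynomials form a domain.\<close>

definition dem :: "'a lau \<Rightarrow> 'a lau" where
  "dem f = (SOME g. f - rfl r f = root_diff * g)"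

lemma root_diff_dem: "root_diff * dem f = f - rfl r f"
  using someI_ex[OF root_diff_dvd[unfolded dvd_def]] by (simp add: dem_def)

lemma dem_unique: "root_diff * g = f - rfl r f \<Longrightarrow> dem f = g"
  using root_diff_dem[of f] root_diff_nonzero by (metis mult_left_cancel)

lemma dem_add: "dem (f + g) = dem f + dem g"
  by (rule dem_unique) (simp add: distrib_left root_diff_dem rfl_simps)

lemma dem_diff: "dem (f - g) = dem f - dem g"
  by (rule dem_unique) (simp add: right_diff_distrib root_diff_dem rfl_simps)

lemma dem_mult: "dem (f * g) = dem f * g + rfl r f * dem g"
proof (rule dem_unique)
  have "root_diff * (dem f * g + rfl r f * dem g) = (root_diff * dem f) * g + rfl r f * (root_diff * dem g)"
    by (simp add: algebra_simps)
  then show "root_diff * (dem f * g + rfl r f * dem g) = f * g - rfl r (f * g)"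
    by (simp add: root_diff_dem rfl_simps algebra_simps)
qed

lemma dem_rfl: "dem (rfl r f) = - dem f"
  by (rule dem_unique) (simp add: root_diff_dem)

lemma dem_Const: "dem (Const c) = 0"
  and dem_zero: "dem 0 = 0"
  and dem_one: "dem 1 = 0"
  by (rule dem_unique; simp add: rfl_simps)+

lemma dem_Xp: "dem (Xp 1) = 1" "dem (Xp (- 1)) = - Const (inverse r)"
proof -
  show "dem (Xp 1) = 1"
    by (rule dem_unique) (simp add: rfl_Xp root_diff_def)
  show "dem (Xp (- 1)) = - Const (inverse r)"
    by (rule dem_unique)
      (use r in \<open>simp add: rfl_Xp root_diff_def left_diff_distrib Const_one mult.assoc power_int_minus
        mult.left_commute[of "Const r"] mult.commute[of "Xp _"] flip: Const_mult\<close>)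
qed

lemma rfl_dem: "rfl r (dem f) = dem f"
proof -
  have "- root_diff * rfl r (dem f) = rfl r (root_diff * dem f)"
    by (simp add: rfl_simps rfl_root_diff)
  also have "\<dots> = - root_diff * dem f"
    by (simp add: root_diff_dem rfl_simps)
  finally show ?thesis
    using root_diff_nonzero by (metis mult_left_cancel neg_equal_0_iff_equal)
qed

end

section \<open>The operators of the regular representation\<close>

type_synonym 'a vec = "int \<Rightarrow> 'a lau"

definition lmul :: "'a::field lau \<Rightarrow> 'a vec endo" where
  "lmul f = Abs_endo (\<lambda>v j. f * v j)"

lemma app_lmul: "app (lmul f) v j = f * v j"
  unfolding lmul_def by (subst Abs_endo_inverse) (simp_all add: fun_eq_iff distrib_left)

lemma vec_endo_eqI: "(\<And>v j. app f v j = app g v j) \<Longrightarrow> f = g"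
  by (rule endo_eqI) (rule ext)

lemma lmul_add: "lmul (f + g) = lmul f + lmul g"
  and lmul_diff: "lmul (f - g) = lmul f - lmul g"
  and lmul_uminus: "lmul (- f) = - lmul f"
  and lmul_mult: "lmul (f * g) = lmul f * lmul g"
  and lmul_one: "lmul 1 = 1"
  and lmul_zero: "lmul 0 = 0"
  by (rule vec_endo_eqI; simp add: app_lmul algebra_simps)+

lemma lmul_power: "lmul (f ^ n) = lmul f ^ n"
  by (induction n) (simp_all add: lmul_one lmul_mult)

lemma lmul_commute: "lmul f * lmul g = lmul g * lmul f"
  by (simp add: mult.commute flip: lmul_mult)

lemma lmul_lmul: "lmul f * (lmul g * h) = lmul (f * g) * h"
  by (simp add: lmul_mult mult.assoc)

lemma lmul_Xp_cancel: "lmul (Xp (- m)) * lmul (Xp m) = 1" "lmul (Xp m) * lmul (Xp (- m)) = 1"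
  by (simp_all add: lmul_one flip: lmul_mult)

text \<open>The index \<open>j\<close> stands for an alternating word in two letters. If \<open>up j\<close>, the letter represented here
  prolongs the word \<open>j\<close> to \<open>p j\<close>; otherwise \<open>j\<close> begins with this letter, and \<open>p j\<close> is the rest of the word.\<close>

locale reflection_op =
  fixes r c :: "'a::field" and \<gamma> :: "'a lau" and p :: "int \<Rightarrow> int" and up :: "int \<Rightarrow> bool"
  assumes r: "r \<noteq> 0" and dem_gamma: "dem r \<gamma> = Const c"
    and p_p [simp]: "p (p j) = j" and up_p [simp]: "up (p j) \<longleftrightarrow> \<not> up j"
begin

abbreviation "s \<equiv> rfl r"

text \<open>Left multiplication by t on a sum of f_j w_j, where t f = s(f) t + gamma dem(f) and t^2
  = c t - 1. If \<open>up j\<close>, then t w_j is the word at \<open>p j\<close>; otherwise t w_j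
  is c w_j minus that word. Collecting the terms at w_j gives the two cases.\<close>

definition T :: "'a vec endo" where
  "T = Abs_endo (\<lambda>v j. if up j then \<gamma> * dem r (v j) - s (v (p j))
                      else s (v (p j)) + Const c * s (v j) + \<gamma> * dem r (v j))"

lemma app_T:
  "app T v j = (if up j then \<gamma> * dem r (v j) - s (v (p j))
                else s (v (p j)) + Const c * s (v j) + \<gamma> * dem r (v j))"
  unfolding T_def
  by (subst Abs_endo_inverse) (simp_all add: fun_eq_iff dem_add[OF r] rfl_simps[OF r] algebra_simps)

lemma T_lmul: "T * lmul f = lmul (s f) * T + lmul (\<gamma> * dem r f)"
  by (rule vec_endo_eqI) (simp add: app_T app_lmul rfl_simps[OF r] dem_mult[OF r] algebra_simps)

lemma rd_gamma: "root_diff r * Const c = \<gamma> - s \<gamma>"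
  using root_diff_dem[OF r, of \<gamma>] by (simp add: dem_gamma)

text \<open>The condition dem(gamma) = c means gamma - s(gamma) = c (X - r / X). It turns (gamma -
  s(gamma)) dem(f) into c (f - s f), which absorbs what the composition leaves over.\<close>

lemma T_quadratic: "T * T = lmul (Const c) * T - 1"
proof (rule vec_endo_eqI)
  fix v j
  have dd: "dem r (dem r f) = 0" for f
    by (rule dem_unique[OF r]) (simp add: rfl_dem[OF r])
  have g: "\<gamma> * dem r f = s \<gamma> * dem r f + Const c * f - Const c * s f" for f
  proof -
    have "(\<gamma> - s \<gamma>) * dem r f = Const c * (root_diff r * dem r f)"
      by (simp flip: rd_gamma)
    then show ?thesis
      by (simp add: root_diff_dem[OF r] algebra_simps)
  qed
  show "app (T * T) v j = app (lmul (Const c) * T - 1) v j"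
    using g[of "v j"] g[of "v (p j)"]
    by (simp add: app_T app_lmul dem_diff[OF r] dem_add[OF r] dem_mult[OF r] dem_rfl[OF r] dd rfl_simps[OF r]
        dem_Const[OF r] rfl_rfl[OF r] rfl_dem[OF r] dem_gamma algebra_simps)
qed

lemma T_Const: "T * lmul (Const a) = lmul (Const a) * T"
  by (simp add: T_lmul rfl_simps[OF r] dem_Const[OF r] lmul_zero)

lemma T_inverse: "T * (lmul (Const c) - T) = 1" "(lmul (Const c) - T) * T = 1"
  by (simp_all add: algebra_simps T_quadratic T_Const)

text \<open>The intertwiner: multiplication by X - r / X clears the denominator of
  \<open>dem\<close>, and subtracting gamma then removes the inhomogeneous term of
  \<open>T_lmul\<close>.\<close>

definition S :: "'a vec endo" where
  "S = lmul (root_diff r) * T - lmul \<gamma>"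

lemma S_lmul: "S * lmul f = lmul (s f) * S"
proof -
  have e: "root_diff r * (\<gamma> * dem r f) = \<gamma> * f - s f * \<gamma>"
    using root_diff_dem[OF r, of f] by (metis mult.left_commute mult.commute right_diff_distrib)
  have "S * lmul f = lmul (root_diff r) * (T * lmul f) - lmul \<gamma> * lmul f"
    by (simp add: S_def left_diff_distrib mult.assoc)
  also have "\<dots> = lmul (root_diff r * s f) * T + (lmul (root_diff r * (\<gamma> * dem r f)) - lmul (\<gamma> * f))"
    by (simp only: T_lmul distrib_left lmul_lmul lmul_mult[symmetric] add_diff_eq)
  also have "\<dots> = lmul (s f * root_diff r) * T - lmul (s f * \<gamma>)"
    by (simp add: e lmul_diff mult.commute)
  finally show ?thesis
    by (simp add: S_def right_diff_distrib lmul_lmul lmul_mult)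
qed

lemma S_S: "S * S = lmul (root_diff r * root_diff r + \<gamma> * s \<gamma>)"
proof -
  let ?d = "root_diff r"
  have "S * S = S * (lmul ?d * T - lmul \<gamma>)"
    by (simp add: S_def)
  also have "\<dots> = S * lmul ?d * T - S * lmul \<gamma>"
    by (simp add: right_diff_distrib mult.assoc)
  also have "\<dots> = lmul (s ?d) * (lmul ?d * (T * T) - lmul \<gamma> * T) - lmul (s \<gamma>) * (lmul ?d * T - lmul \<gamma>)"
    by (simp only: S_lmul) (simp add: S_def algebra_simps)
  also have "\<dots> = lmul (?d * (\<gamma> - s \<gamma>) - ?d * (?d * Const c)) * T + lmul (?d * ?d + s \<gamma> * \<gamma>)"
    by (simp add: T_quadratic rfl_root_diff[OF r] right_diff_distrib lmul_lmul)
      (simp add: algebra_simps lmul_add lmul_diff lmul_uminus flip: lmul_mult)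
  finally show ?thesis
    unfolding rd_gamma by (simp add: lmul_zero mult.commute[of "s \<gamma>"])
qed

text \<open>The solution of an eigenvector equation is determined by half of its coordinates.\<close>

lemma half_coordinates:
  assumes "\<And>j. up j \<Longrightarrow> w j = 0" and "\<And>j. up j \<Longrightarrow> app (T + lmul h) (app (lmul g) w) j = 0" and "g \<noteq> 0"
  shows "w = 0"
proof
  fix j
  show "w j = 0 j"
  proof (cases "up j")
    case False
    then have "app (T + lmul h) (app (lmul g) w) (p j) = 0"
      by (intro assms(2)) simp
    moreover have "w (p j) = 0" using False by (intro assms(1)) simp
    ultimately have "s (g * w j) = 0"
      using False by (simp add: app_T app_lmul dem_zero[OF r])
    then have "g * w j = s 0"
      by (metis rfl_rfl[OF r])
    then show ?thesis using assms(3) by (simp add: rfl_simps[OF r])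
  qed (simp add: assms(1))
qed

end

section \<open>The four generators as operators\<close>

locale daha_params =
  fixes q k0 k1 k0v k1v :: "'a::field"
  assumes nz: "q \<noteq> 0" "k0 \<noteq> 0" "k1 \<noteq> 0" "k0v \<noteq> 0" "k1v \<noteq> 0"
begin

definition "c0 = k0 + inverse k0"
definition "c1 = k1 + inverse k1"
definition "c0v = k0v + inverse k0v"
definition "c1v = k1v + inverse k1v"

text \<open>The constants are dictated by t0v = q^-1 X^-1 t0^-1 and t1v = X t1^-1. The trace
  condition of t0v reads t0 X = q^-2 X^-1 t0 + gamma0, that of t1v reads t1 X^-1 = X t1 -
  gamma1.\<close>

definition "r0 = inverse (q\<^sup>2)"
definition "\<gamma>0 = Const (inverse q * c0v) - Const (c0 * r0) * Xp (- 1)"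
definition "\<gamma>1 = Const c1 * Xp 1 - Const c1v"

lemma r0: "r0 \<noteq> 0"
  using nz by (simp add: r0_def)

lemma r1: "(1::'a) \<noteq> 0"
  by simp

text \<open>A positive index j is the alternating word of length j beginning with t0, a negative one
  the word of length -j beginning with t1. Hence t0 prolongs the word j \<le> 0 to 1 - j, and t1
  prolongs j \<ge> 0 to -1 - j.\<close>

sublocale R0: reflection_op r0 c0 \<gamma>0 "\<lambda>j. 1 - j" "\<lambda>j. j \<le> 0"
proof
  show "dem r0 \<gamma>0 = Const c0"
    using r0 by (simp add: \<gamma>0_def dem_diff dem_mult dem_Const dem_Xp rfl_simps mult.assoc flip: Const_mult)
qed (auto simp: r0)

sublocale R1: reflection_op 1 c1 \<gamma>1 "\<lambda>j. - 1 - j" "\<lambda>j. j \<ge> 0"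
proof
  show "dem 1 \<gamma>1 = Const c1"
    by (simp add: \<gamma>1_def dem_diff dem_mult dem_Const dem_Xp rfl_simps)
qed auto

definition "T0 = R0.T"
definition "T1 = R1.T"
definition "S0 = R0.S"
definition "S1 = R1.S"

definition "sc x = lmul (Const x)"

lemma sc_add: "sc (x + y) = sc x + sc y"
  and sc_mult: "sc (x * y) = sc x * sc y"
  and sc_diff: "sc (x - y) = sc x - sc y"
  and sc_one: "sc 1 = 1"
  and sc_zero: "sc 0 = 0"
  by (simp_all add: sc_def lmul_add lmul_diff lmul_mult Const_add Const_mult Const_diff Const_one Const_zero lmul_one lmul_zero)

definition "T0' = sc c0 - T0"
definition "T1' = sc c1 - T1"
definition "T0v = sc (inverse q) * (lmul (Xp (- 1)) * T0')"
definition "T1v = lmul (Xp 1) * T1'"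
definition "T0v' = sc q * (T0 * lmul (Xp 1))"
definition "T1v' = T1 * lmul (Xp (- 1))"

lemma T0_inv: "T0 * T0' = 1" "T0' * T0 = 1" and T1_inv: "T1 * T1' = 1" "T1' * T1 = 1"
  using R0.T_inverse R1.T_inverse by (simp_all add: T0'_def T1'_def T0_def T1_def sc_def)

lemma sc_T0: "T0 * sc x = sc x * T0" and sc_T1: "T1 * sc x = sc x * T1"
  by (simp_all add: sc_def T0_def T1_def R0.T_Const R1.T_Const)

lemma sc_lmul: "lmul f * sc x = sc x * lmul f"
  by (simp add: sc_def lmul_commute)

lemma sc_sc: "sc x * sc y = sc y * sc x"
  by (simp add: sc_def lmul_commute)

lemma sc_T0': "T0' * sc x = sc x * T0'" and sc_T1': "T1' * sc x = sc x * T1'"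
  by (simp_all add: T0'_def T1'_def algebra_simps sc_T0 sc_T1 sc_sc)

lemma sc_mult_commute: "y * sc x = sc x * y \<Longrightarrow> z * sc x = sc x * z \<Longrightarrow> (y * z) * sc x = sc x * (y * z)"
  by (metis mult.assoc)

lemma sc_T0v: "T0v * sc x = sc x * T0v" and sc_T1v: "T1v * sc x = sc x * T1v"
  by (simp_all only: T0v_def T1v_def sc_mult_commute sc_T0' sc_T1' sc_lmul sc_sc)

lemma sc_q: "sc q * sc (inverse q) = 1" "sc (inverse q) * sc q = 1"
  using nz by (simp_all add: sc_one flip: sc_mult)

lemma T0v_inv: "T0v * T0v' = 1" "T0v' * T0v = 1"
proof -
  have m: "(a * y) * (b * z) = (a * b) * (y * z)" if "y * b = b * y" for a b y z :: "'a vec endo"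
    by (metis that mult.assoc)
  have "lmul (Xp (- 1)) * T0' * (T0 * lmul (Xp 1)) = 1"
    by (rule mult_inverses[OF T0_inv(2) lmul_Xp_cancel(1)])
  moreover have "T0 * lmul (Xp 1) * (lmul (Xp (- 1)) * T0') = 1"
    by (rule mult_inverses[OF lmul_Xp_cancel(2) T0_inv(1)])
  moreover have "(lmul (Xp (- 1)) * T0') * sc x = sc x * (lmul (Xp (- 1)) * T0')"
    "(T0 * lmul (Xp 1)) * sc x = sc x * (T0 * lmul (Xp 1))" for x
    by (simp_all only: sc_mult_commute sc_T0 sc_T0' sc_lmul)
  ultimately show "T0v * T0v' = 1" "T0v' * T0v = 1"
    unfolding T0v_def T0v'_def by (simp_all only: m sc_q mult_1_left)
qed

lemma T1v_inv: "T1v * T1v' = 1" "T1v' * T1v = 1"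
  unfolding T1v_def T1v'_def
  by (rule mult_inverses[OF T1_inv(2) lmul_Xp_cancel(2)] mult_inverses[OF lmul_Xp_cancel(1) T1_inv(1)])+

lemma T1v_trace: "T1v + T1v' = sc c1v"
proof -
  have "T1v' = lmul (Xp 1) * T1 + lmul (\<gamma>1 * (- 1))"
    unfolding T1v'_def by (simp add: T1_def R1.T_lmul rfl_Xp dem_Xp Const_one)
  then show ?thesis
    by (simp add: \<gamma>1_def T1v_def T1'_def sc_def right_diff_distrib lmul_diff lmul_uminus mult.commute flip: lmul_mult)
qed

lemma T0v_trace: "T0v + T0v' = sc c0v"
proof -
  have "T0 * lmul (Xp 1) = lmul (Const r0 * Xp (- 1)) * T0 + lmul \<gamma>0"
    by (simp add: T0_def R0.T_lmul rfl_Xp[OF r0] dem_Xp[OF r0])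
  then have "T0v' = lmul (Const q * (Const r0 * Xp (- 1))) * T0 + lmul (Const q * \<gamma>0)"
    by (simp add: T0v'_def sc_def mult.assoc distrib_left lmul_lmul flip: lmul_mult)
  moreover have "Const q * (Const r0 * Xp (- 1)) = Const (inverse q) * Xp (- 1)"
    using nz by (simp add: r0_def power2_eq_square flip: Const_mult mult.assoc)
  moreover have "Const q * \<gamma>0 = Const c0v - Const (inverse q) * Xp (- 1) * Const c0"
  proof -
    have "Const q * \<gamma>0 = Const (q * (inverse q * c0v)) - Const (q * (c0 * r0)) * Xp (- 1)"
      by (simp only: \<gamma>0_def right_diff_distrib Const_mult mult.assoc)
    also have "q * (inverse q * c0v) = c0v" using nz by simp
    also have "q * (c0 * r0) = inverse q * c0" using nz by (simp add: r0_def power2_eq_square)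
    finally show ?thesis by (simp add: Const_mult mult_ac)
  qed
  ultimately show ?thesis
    by (simp add: T0v_def T0'_def sc_def right_diff_distrib lmul_diff lmul_lmul mult.assoc flip: lmul_mult)
qed

lemma T0_trace: "T0 + T0' = sc c0" and T1_trace: "T1 + T1' = sc c1"
  by (simp_all add: T0'_def T1'_def)

lemma T1v_T1: "T1v * T1 = lmul (Xp 1)"
  by (simp add: T1v_def mult.assoc T1_inv)

lemma T0v_T0: "T0v * T0 = sc (inverse q) * lmul (Xp (- 1))"
  by (simp add: T0v_def mult.assoc T0_inv)

lemma daha_product: "T0v * T0 * T1v * T1 = sc (inverse q)"
  by (simp add: mult.assoc T1v_T1) (simp add: T0v_T0 lmul_Xp_cancel mult.assoc flip: mult.assoc[of T0v])

lemma quadratic_factor: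
  assumes "t * t' = 1" "t + t' = sc (k + inverse k)" "k \<noteq> 0" "t * sc k = sc k * t"
  shows "(t - sc k) * (t - sc (inverse k)) = 0"
proof -
  have "t * sc (k + inverse k) = t * t + 1"
    by (simp add: assms(1) distrib_left flip: assms(2))
  then show ?thesis
    using assms(3) by (simp add: algebra_simps assms(4) sc_add sc_one flip: sc_mult)
qed

lemma daha_quadratic:
  "(T0 - sc k0) * (T0 - sc (inverse k0)) = 0" "(T1 - sc k1) * (T1 - sc (inverse k1)) = 0"
  "(T0v - sc k0v) * (T0v - sc (inverse k0v)) = 0" "(T1v - sc k1v) * (T1v - sc (inverse k1v)) = 0"
  using quadratic_factor[OF T0_inv(1) T0_trace[unfolded c0_def] nz(2) sc_T0]
    quadratic_factor[OF T1_inv(1) T1_trace[unfolded c1_def] nz(3) sc_T1]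
    quadratic_factor[OF T0v_inv(1) T0v_trace[unfolded c0v_def] nz(4) sc_T0v]
    quadratic_factor[OF T1v_inv(1) T1v_trace[unfolded c1v_def] nz(5) sc_T1v] by simp_all

end

section \<open>Normal forms and faithfulness\<close>

abbreviation (input) "RT \<equiv> ring_of_type_algebra"

lemma ring_of_type_algebra_simps [simp]:
  "carrier RT = UNIV" "x \<otimes>\<^bsub>RT\<^esub> y = x * y" "x \<oplus>\<^bsub>RT\<^esub> y = x + y" "\<one>\<^bsub>RT\<^esub> = 1" "\<zero>\<^bsub>RT\<^esub> = 0"
  for x y :: "'a::ring_1"
  by (simp_all add: ring_of_type_algebra_def)

lemma ring_type: "ring (RT :: 'a::ring_1 ring)"
proof -
  have "\<exists>y. x + y = 0" "\<exists>y. y + x = 0" for x :: 'a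
    using add.right_inverse add.left_inverse by blast+
  then show ?thesis
    by unfold_locales (auto simp: algebra_simps Units_def)
qed

lemma ring_of_type_algebra_uminus [simp]: "\<ominus>\<^bsub>RT\<^esub> x = - x" for x :: "'a::ring_1"
proof -
  interpret ring "RT :: 'a ring" by (rule ring_type)
  show ?thesis by (rule minus_equality) simp_all
qed

lemma ideal_type_iff:
  "ideal I (RT :: 'a::ring_1 ring) \<longleftrightarrow>
    0 \<in> I \<and> (\<forall>x\<in>I. \<forall>y\<in>I. x + y \<in> I) \<and> (\<forall>x\<in>I. \<forall>y. x * y \<in> I \<and> y * x \<in> I)"
  (is "?L \<longleftrightarrow> ?R")
proof
  assume ?L
  then interpret ideal I "RT :: 'a ring" .
  show ?R
    using additive_subgroup.zero_closed[OF additive_subgroup_axioms]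
      additive_subgroup.a_closed[OF additive_subgroup_axioms] I_l_closed I_r_closed by simp
next
  assume R: ?R
  have "- x \<in> I" if "x \<in> I" for x
    using R that by (metis mult_minus1)
  moreover have inv: "inv\<^bsub>add_monoid RT\<^esub> a = - a" for a :: 'a
    using ring_of_type_algebra_uminus[of a] by (simp only: a_inv_def)
  ultimately show ?L
    using R by (intro idealI ring_type group.subgroupI abelian_group.a_group ring.is_abelian_group) auto
qed

section \<open>Alternating words indexed by integers\<close>

fun altw :: "'r::monoid_mult \<Rightarrow> 'r \<Rightarrow> nat \<Rightarrow> bool \<Rightarrow> 'r" where
  "altw a b 0 x = 1"
| "altw a b (Suc n) x = (if x then a else b) * altw a b n (\<not> x)"

definition alt_word :: "'r::monoid_mult \<Rightarrow> 'r \<Rightarrow> int \<Rightarrow> 'r" where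
  "alt_word a b j = altw a b (nat \<bar>j\<bar>) (j > 0)"

lemma alt_word_0 [simp]: "alt_word a b 0 = 1"
  by (simp add: alt_word_def)

lemma alt_word_left: "j \<le> 0 \<Longrightarrow> alt_word a b (1 - j) = a * alt_word a b j"
  and alt_word_right: "j \<ge> 0 \<Longrightarrow> alt_word a b (- 1 - j) = b * alt_word a b j"
proof -
  show "alt_word a b (1 - j) = a * alt_word a b j" if "j \<le> 0"
  proof -
    have "nat \<bar>1 - j\<bar> = Suc (nat \<bar>j\<bar>)" using that by auto
    moreover have "altw a b (nat \<bar>j\<bar>) False = altw a b (nat \<bar>j\<bar>) (j > 0)"
      using that by (cases "j = 0") auto
    ultimately show ?thesis using that by (simp add: alt_word_def)
  qed
  show "alt_word a b (- 1 - j) = b * alt_word a b j" if "j \<ge> 0"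
  proof -
    have "nat \<bar>- 1 - j\<bar> = Suc (nat \<bar>j\<bar>)" using that by auto
    moreover have "altw a b (nat \<bar>j\<bar>) True = altw a b (nat \<bar>j\<bar>) (j > 0)"
      using that by (cases "j = 0") auto
    ultimately show ?thesis using that by (simp add: alt_word_def)
  qed
qed

text \<open>Every nonempty word is one prolongation of a shorter one, so induction on the length
  needs only the two prolonging steps.\<close>

lemma word_induct [case_names zero left right]:
  fixes j :: int
  assumes "P 0" "\<And>j. j \<le> 0 \<Longrightarrow> P j \<Longrightarrow> P (1 - j)" "\<And>j. j \<ge> 0 \<Longrightarrow> P j \<Longrightarrow> P (- 1 - j)"
  shows "P j"
proof (induction "nat \<bar>j\<bar>" arbitrary: j)
  case 0
  then show ?case using assms(1) by simp
next
  case (Suc n)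
  show ?case
  proof (cases "j > 0")
    case True
    with Suc(2) have "n = nat \<bar>1 - j\<bar>" by auto
    from assms(2)[OF _ Suc(1)[OF this]] True show ?thesis by simp
  next
    case False
    with Suc(2) have "n = nat \<bar>- 1 - j\<bar>" "j < 0" by auto
    from assms(3)[OF _ Suc(1)[OF this(1)]] this(2) show ?thesis by simp
  qed
qed

context daha_params
begin

section \<open>Congruence modulo the defining ideal and straightening rules\<close>

definition "DI = daha_ideal q k0 k1 k0v k1v"

lemma DI_ideal: "ideal DI RT"
  unfolding DI_def daha_ideal_def
  by (rule ring.genideal_ideal[OF ring_type]) simp

definition eqv :: "(gen, 'a) free_alg \<Rightarrow> (gen, 'a) free_alg \<Rightarrow> bool" (infix "\<approx>" 50) where
  "x \<approx> y \<longleftrightarrow> x - y \<in> DI"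

lemma DI_0: "0 \<in> DI" and DI_add: "x \<in> DI \<Longrightarrow> y \<in> DI \<Longrightarrow> x + y \<in> DI"
  and DI_left: "x \<in> DI \<Longrightarrow> y * x \<in> DI" and DI_right: "x \<in> DI \<Longrightarrow> x * y \<in> DI"
  using DI_ideal by (auto simp: ideal_type_iff)

lemma DI_uminus: "x \<in> DI \<Longrightarrow> - x \<in> DI"
  using DI_left[of x "- 1"] by simp

lemma eqv_refl [simp]: "x \<approx> x"
  by (simp add: eqv_def DI_0)

lemma eqv_sym: "x \<approx> y \<Longrightarrow> y \<approx> x"
  using DI_uminus[of "x - y"] by (simp add: eqv_def)

lemma eqv_trans [trans]: "x \<approx> y \<Longrightarrow> y \<approx> z \<Longrightarrow> x \<approx> z"
  using DI_add[of "x - y" "y - z"] by (simp add: eqv_def)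

lemma eqv_add: "x \<approx> y \<Longrightarrow> x' \<approx> y' \<Longrightarrow> x + x' \<approx> y + y'"
  using DI_add[of "x - y" "x' - y'"] by (simp add: eqv_def algebra_simps)

lemma eqv_diff: "x \<approx> y \<Longrightarrow> x' \<approx> y' \<Longrightarrow> x - x' \<approx> y - y'"
  using DI_add[OF _ DI_uminus, of "x - y" "x' - y'"] by (simp add: eqv_def algebra_simps)

lemma eqv_left: "x \<approx> y \<Longrightarrow> z * x \<approx> z * y"
  using DI_left[of "x - y" z] by (simp add: eqv_def algebra_simps)

lemma eqv_right: "x \<approx> y \<Longrightarrow> x * z \<approx> y * z"
  using DI_right[of "x - y" z] by (simp add: eqv_def algebra_simps)

abbreviation "g0 \<equiv> free_gen G0 :: (gen, 'a) free_alg"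
abbreviation "g1 \<equiv> free_gen G1 :: (gen, 'a) free_alg"
abbreviation "g0v \<equiv> free_gen G0v :: (gen, 'a) free_alg"
abbreviation "g1v \<equiv> free_gen G1v :: (gen, 'a) free_alg"

text \<open>By the quadratic relation the inverse of a generator is its trace minus itself, so
  inverses modulo the ideal are available inside the free algebra.\<close>

definition "g0' = Const c0 - g0"
definition "g1' = Const c1 - g1"
definition "g0v' = Const c0v - g0v"
definition "g1v' = Const c1v - g1v"

lemma relator_DI: "x \<in> daha_relators q k0 k1 k0v k1v \<Longrightarrow> x \<in> DI"
  using ring.genideal_self[OF ring_type, of "daha_relators q k0 k1 k0v k1v"]
  by (auto simp: DI_def daha_ideal_def)

lemma quadratic_eqv:
  fixes g :: "(gen, 'a) free_alg"
  assumes "(g - Const k) * (g - Const (inverse k)) \<in> DI" "k \<noteq> 0"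
  shows "g * (Const (k + inverse k) - g) \<approx> 1" "(Const (k + inverse k) - g) * g \<approx> 1"
proof -
  have "(g - Const k) * (g - Const (inverse k)) = 1 - g * (Const (k + inverse k) - g)"
    using assms(2) Const_commute[of _ g]
    by (simp add: algebra_simps Const_add Const_one flip: Const_mult)
  with assms(1) show "g * (Const (k + inverse k) - g) \<approx> 1"
    using eqv_sym by (simp add: eqv_def)
  then show "(Const (k + inverse k) - g) * g \<approx> 1"
    by (simp add: right_diff_distrib left_diff_distrib Const_commute)
qed

lemma g_inv: "g0 * g0' \<approx> 1" "g0' * g0 \<approx> 1" "g1 * g1' \<approx> 1" "g1' * g1 \<approx> 1"
  "g0v * g0v' \<approx> 1" "g0v' * g0v \<approx> 1" "g1v * g1v' \<approx> 1" "g1v' * g1v \<approx> 1"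
  unfolding g0'_def g1'_def g0v'_def g1v'_def c0_def c1_def c0v_def c1v_def
  by (intro quadratic_eqv nz relator_DI; simp add: daha_relators_def)+

definition "xx = g1v * g1"
definition "yy = g1' * g1v'"

lemma eqv_mult_inverses:
  assumes "a * b \<approx> 1" "c * d \<approx> 1"
  shows "(c * a) * (b * d) \<approx> 1"
proof -
  have "(c * a) * (b * d) \<approx> c * 1 * d"
    unfolding mult.assoc by (intro eqv_left) (metis assms(1) eqv_right mult.assoc)
  also have "c * 1 * d \<approx> 1" using assms(2) by simp
  finally show ?thesis .
qed

lemma xx_yy: "xx * yy \<approx> 1" "yy * xx \<approx> 1"
  unfolding xx_def yy_def by (intro eqv_mult_inverses g_inv)+

lemma g_cross: "g0v * g0 * xx \<approx> Const (inverse q)"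
  using relator_DI[of "g0v * g0 * g1v * g1 - Const (inverse q)"]
  by (simp add: daha_relators_def xx_def eqv_def mult.assoc)

text \<open>Together with the rules for \<open>g1 * yy\<close>, \<open>g0 * xx\<close> and
  \<open>g0 * yy\<close> this is the abstract counterpart of \<open>T_lmul\<close>: it sorts
  products so that powers of X stand on the left.\<close>

lemma g1_xx: "g1 * xx \<approx> yy * g1 + Const c1 * xx - Const c1v"
proof -
  have "Const c1 * xx = g1 * xx + g1' * xx"
    by (simp add: g1'_def left_diff_distrib)
  moreover have "yy * g1 = g1' * (Const c1v * g1) - g1' * xx"
    by (simp add: yy_def g1v'_def xx_def algebra_simps)
  moreover have "g1' * (Const c1v * g1) = Const c1v * (g1' * g1)"
    by (metis Const_commute mult.assoc)
  ultimately have "yy * g1 + Const c1 * xx - Const c1v = g1 * xx + (Const c1v * (g1' * g1) - Const c1v * 1)"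
    by simp
  moreover have "g1 * xx + (Const c1v * (g1' * g1) - Const c1v * 1) \<approx> g1 * xx + (Const c1v * 1 - Const c1v * 1)"
    by (intro eqv_add eqv_diff eqv_left eqv_refl g_inv)
  ultimately show ?thesis
    using eqv_sym[of "yy * g1 + Const c1 * xx - Const c1v" "g1 * xx"] by (simp add: add_diff_eq)
qed

lemma g1_yy: "g1 * yy \<approx> xx * g1 - Const c1 * xx + Const c1v"
proof -
  have "g1 * yy \<approx> 1 * g1v'"
    unfolding yy_def by (metis eqv_right g_inv(3) mult.assoc)
  also have "1 * g1v' = Const c1v - g1v * 1"
    by (simp add: g1v'_def)
  also have "\<dots> \<approx> Const c1v - g1v * (g1 * g1')"
    by (intro eqv_diff eqv_left eqv_sym[OF g_inv(3)] eqv_refl)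
  also have "\<dots> = xx * g1 - Const c1 * xx + Const c1v"
    by (simp add: g1'_def xx_def algebra_simps) (metis Const_commute mult.assoc)
  finally show ?thesis .
qed

lemma g0v_eqv: "g0v \<approx> Const (inverse q) * (yy * g0')"
proof -
  have "g0v = g0v * 1 * 1" by simp
  also have "\<dots> \<approx> g0v * g0 * 1 * g0'"
    using eqv_left[OF eqv_sym[OF g_inv(1)], of g0v] by (simp add: mult.assoc)
  also have "\<dots> \<approx> g0v * g0 * (xx * yy) * g0'"
    by (intro eqv_right eqv_left eqv_sym[OF xx_yy(1)])
  also have "\<dots> = (g0v * g0 * xx) * (yy * g0')"
    by (simp add: mult.assoc)
  also have "\<dots> \<approx> Const (inverse q) * (yy * g0')"
    by (intro eqv_right g_cross)
  finally show ?thesis .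
qed

lemma g0_xx: "g0 * xx \<approx> Const (inverse q) * (Const c0v - Const (inverse q) * (yy * g0'))"
proof -
  have "g0 * xx \<approx> (g0v' * g0v) * (g0 * xx)"
    using eqv_right[OF eqv_sym[OF g_inv(6)], of "g0 * xx"] by simp
  also have "\<dots> = g0v' * (g0v * g0 * xx)"
    by (simp add: mult.assoc)
  also have "\<dots> \<approx> g0v' * Const (inverse q)"
    by (intro eqv_left g_cross)
  also have "\<dots> = Const (inverse q) * (Const c0v - g0v)"
    by (simp add: Const_commute g0v'_def)
  also have "\<dots> \<approx> Const (inverse q) * (Const c0v - Const (inverse q) * (yy * g0'))"
    by (intro eqv_left eqv_diff eqv_refl g0v_eqv)
  finally show ?thesis .
qed

lemma g0_yy: "g0 * yy \<approx> Const (q * q) * (xx * g0) - Const (q * c0v) + Const c0 * yy"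
proof -
  have left: "xx * (Const c * x) = Const c * (xx * x)" for c x
    by (metis Const_commute mult.assoc)
  \<comment> \<open>The rule for \<open>g0 * xx\<close> is multiplied by X on the left, by the
    inverse of X on the right, and by q^2.\<close>
  have "Const q * (Const q * (xx * (g0 * xx) * yy)) \<approx>
      Const q * (Const q * (xx * (Const (inverse q) * (Const c0v - Const (inverse q) * (yy * g0'))) * yy))"
    by (intro eqv_left eqv_right g0_xx)
  also have "\<dots> = Const (q * (q * (inverse q * c0v))) * (xx * yy)
      - Const (q * (q * (inverse q * inverse q))) * (xx * (yy * (g0' * yy)))"
    by (simp only: right_diff_distrib left_diff_distrib mult.assoc left Const_mult)
  also have "q * (q * (inverse q * c0v)) = q * c0v"
    using nz by simp
  also have "q * (q * (inverse q * inverse q)) = 1"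
    using nz by (simp add: field_simps)
  also have "Const (q * c0v) * (xx * yy) - Const 1 * (xx * (yy * (g0' * yy))) =
      Const (q * c0v) * (xx * yy) - (xx * yy) * (g0' * yy)"
    by (simp add: Const_one mult.assoc)
  also have "\<dots> \<approx> Const (q * c0v) * 1 - 1 * (g0' * yy)"
    by (intro eqv_diff eqv_left eqv_right xx_yy)
  also have "\<dots> = Const (q * c0v) - Const c0 * yy + g0 * yy"
    by (simp add: g0'_def left_diff_distrib)
  finally have 1: "Const q * (Const q * (xx * (g0 * xx) * yy)) \<approx> Const (q * c0v) - Const c0 * yy + g0 * yy" .
  have "Const q * (Const q * (xx * (g0 * xx) * yy)) = Const (q * q) * (xx * g0 * (xx * yy))"
    by (simp add: Const_mult mult.assoc)
  also have "\<dots> \<approx> Const (q * q) * (xx * g0 * 1)"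
    by (intro eqv_left xx_yy)
  finally have "Const (q * q) * (xx * g0 * 1) \<approx> Const (q * c0v) - Const c0 * yy + g0 * yy"
    using 1 eqv_sym eqv_trans by blast
  then have "Const (q * q) * (xx * g0 * 1) - (Const (q * c0v) - Const c0 * yy) \<approx>
      Const (q * c0v) - Const c0 * yy + g0 * yy - (Const (q * c0v) - Const c0 * yy)"
    by (intro eqv_diff eqv_refl)
  then show ?thesis
    using eqv_sym by (simp add: algebra_simps)
qed

section \<open>Spanning by the normal forms X^m w_j\<close>

definition xpow :: "int \<Rightarrow> (gen, 'a) free_alg" where
  "xpow m = (if m \<ge> 0 then xx ^ nat m else yy ^ nat (- m))"

lemma xx_xpow: "xx * xpow m \<approx> xpow (m + 1)"
proof (cases "m \<ge> 0")
  case True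
  then show ?thesis by (simp add: xpow_def nat_add_distrib)
next
  case False
  then have "nat (- m) = Suc (nat (- (m + 1)))" by simp
  then have "xx * xpow m = (xx * yy) * yy ^ nat (- (m + 1))"
    using False by (simp add: xpow_def mult.assoc)
  also have "\<dots> \<approx> 1 * yy ^ nat (- (m + 1))"
    by (intro eqv_right xx_yy)
  also have "\<dots> = xpow (m + 1)"
    using False by (auto simp: xpow_def)
  finally show ?thesis .
qed

lemma yy_xpow: "yy * xpow m \<approx> xpow (m - 1)"
proof (cases "m \<le> 0")
  case True
  then have "nat (- (m - 1)) = Suc (nat (- m))" by simp
  with True show ?thesis by (auto simp: xpow_def)
next
  case False
  then have "nat m = Suc (nat (m - 1))" by simp
  then have "yy * xpow m = (yy * xx) * xx ^ nat (m - 1)"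
    using False by (simp add: xpow_def mult.assoc)
  also have "\<dots> \<approx> 1 * xx ^ nat (m - 1)"
    by (intro eqv_right xx_yy)
  also have "\<dots> = xpow (m - 1)"
    using False by (auto simp: xpow_def)
  finally show ?thesis .
qed

definition nform :: "int \<times> int \<Rightarrow> (gen, 'a) free_alg" where
  "nform = (\<lambda>(m, j). xpow m * alt_word g0 g1 j)"

sublocale FC: scalar_hom "Const :: 'a \<Rightarrow> (gen, 'a) free_alg"
  by (rule scalar_hom_Const)

text \<open>It contains 1 and turns out to be stable under left multiplication by each generator,
  hence it is everything.\<close>

definition "NF = {x. \<exists>u. x \<approx> FC.lin nform u}"

lemma NF_I: "x \<approx> FC.lin nform u \<Longrightarrow> x \<in> NF"
  unfolding NF_def by blast

lemma NF_E: "x \<in> NF \<Longrightarrow> (\<And>u. x \<approx> FC.lin nform u \<Longrightarrow> thesis) \<Longrightarrow> thesis"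
  unfolding NF_def by blast

lemma NF_eqv: "x \<approx> y \<Longrightarrow> y \<in> NF \<Longrightarrow> x \<in> NF"
  by (elim NF_E, rule NF_I, erule (1) eqv_trans)

lemma NF_zero: "0 \<in> NF"
  by (rule NF_I[of _ 0]) (simp add: FC.lin_zero)

lemma NF_add: "x \<in> NF \<Longrightarrow> y \<in> NF \<Longrightarrow> x + y \<in> NF"
proof (elim NF_E)
  fix u u' assume "x \<approx> FC.lin nform u" "y \<approx> FC.lin nform u'"
  then have "x + y \<approx> FC.lin nform (u + u')"
    unfolding FC.lin_add by (rule eqv_add)
  then show "x + y \<in> NF" by (rule NF_I)
qed

lemma NF_single: "Const c * nform k \<in> NF"
  by (rule NF_I[of _ "Poly_Mapping.single k c"]) (simp add: FC.lin_single)

lemma NF_nform: "nform k \<in> NF"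
  using NF_single[of 1 k] by (simp add: Const_one)

lemma NF_mult:
  assumes "\<And>k. t * nform k \<in> NF" "x \<in> NF"
  shows "t * x \<in> NF"
proof -
  have const: "Const c * x \<in> NF" if "x \<in> NF" for c x
  proof -
    from that obtain u where u: "x \<approx> FC.lin nform u" by (rule NF_E)
    have "Const c * FC.lin nform u \<in> NF"
      by (induction u rule: poly_mapping_induct_single)
        (simp_all add: FC.lin_zero FC.lin_add FC.lin_single NF_zero NF_add NF_single distrib_left
          flip: mult.assoc Const_mult)
    from NF_eqv[OF eqv_left[OF u] this] show ?thesis .
  qed
  from assms(2) obtain u where u: "x \<approx> FC.lin nform u" by (rule NF_E)
  have "t * FC.lin nform u \<in> NF"
  proof (induction u rule: poly_mapping_induct_single)
    case (add k c u)
    have "t * (Const c * nform k) = Const c * (t * nform k)"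
      by (metis Const_commute mult.assoc)
    with add show ?case
      by (simp add: FC.lin_add FC.lin_single distrib_left NF_add const assms(1))
  qed (simp add: FC.lin_zero NF_zero)
  from NF_eqv[OF eqv_left[OF u] this] show ?thesis .
qed

lemma NF_Const: "x \<in> NF \<Longrightarrow> Const c * x \<in> NF"
  by (rule NF_mult[OF NF_single])

lemma NF_diff: "x \<in> NF \<Longrightarrow> y \<in> NF \<Longrightarrow> x - y \<in> NF"
  using NF_add[of x "Const (- 1) * y"] NF_Const[of y "- 1"] by (simp add: Const_uminus Const_one)

lemma NF_xx: "x \<in> NF \<Longrightarrow> xx * x \<in> NF"
proof (rule NF_mult)
  fix k :: "int \<times> int"
  have "xx * nform k = (xx * xpow (fst k)) * alt_word g0 g1 (snd k)"
    by (simp add: nform_def case_prod_beta mult.assoc)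
  also have "\<dots> \<approx> nform (fst k + 1, snd k)"
    unfolding nform_def case_prod_conv by (intro eqv_right xx_xpow)
  finally show "xx * nform k \<in> NF" by (rule NF_eqv[OF _ NF_nform])
qed

lemma NF_yy: "x \<in> NF \<Longrightarrow> yy * x \<in> NF"
proof (rule NF_mult)
  fix k :: "int \<times> int"
  have "yy * nform k = (yy * xpow (fst k)) * alt_word g0 g1 (snd k)"
    by (simp add: nform_def case_prod_beta mult.assoc)
  also have "\<dots> \<approx> nform (fst k - 1, snd k)"
    unfolding nform_def case_prod_conv by (intro eqv_right yy_xpow)
  finally show "yy * nform k \<in> NF" by (rule NF_eqv[OF _ NF_nform])
qed

text \<open>Passing one factor X or 1 / X leaves the letter in front of a shorter power of X, plus
  terms that are sorted already; so induction on the exponent applies. General coefficients let one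
  proof serve \<open>g0\<close> and \<open>g1\<close>.\<close>

lemma NF_letter:
  assumes word: "\<And>j. g * alt_word g0 g1 j \<in> NF"
    and xx: "g * xx \<approx> a1 * yy * g + a2 * yy + a3 * xx + a4" and yy: "g * yy \<approx> b1 * xx * g + b2 * xx + b3 * yy + b4"
    and coeff: "{a1, a2, a3, a4, b1, b2, b3, b4} \<subseteq> Set.range Const"
    and x: "x \<in> NF"
  shows "g * x \<in> NF"
proof (rule NF_mult[OF _ x])
  have *: "g * (xpow m * alt_word g0 g1 j) \<in> NF" for m j
  proof (induction m rule: int_induct[where k = 0])
    case base
    then show ?case using word by (simp add: xpow_def)
  next
    case (step1 m)
    let ?z = "xpow m * alt_word g0 g1 j"
    have z: "?z \<in> NF" using NF_nform[of "(m, j)"] by (simp add: nform_def)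
    have "g * (xpow (m + 1) * alt_word g0 g1 j) = g * xx * ?z"
      using step1 by (simp add: xpow_def nat_add_distrib mult.assoc)
    also have "\<dots> \<approx> (a1 * yy * g + a2 * yy + a3 * xx + a4) * ?z"
      by (intro eqv_right xx)
    also have "\<dots> = a1 * (yy * (g * ?z)) + a2 * (yy * ?z) + a3 * (xx * ?z) + a4 * ?z"
      by (simp only: distrib_right mult.assoc)
    finally show ?case
      using coeff step1 z by (auto intro!: NF_add NF_Const NF_xx NF_yy elim!: NF_eqv)
  next
    case (step2 m)
    let ?z = "xpow m * alt_word g0 g1 j"
    have z: "?z \<in> NF" using NF_nform[of "(m, j)"] by (simp add: nform_def)
    have "nat (1 - m) = Suc (nat (- m))" using step2 by simp
    then have "g * (xpow (m - 1) * alt_word g0 g1 j) = g * yy * ?z"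
      using step2 by (cases "m = 0") (simp_all add: xpow_def mult.assoc)
    also have "\<dots> \<approx> (b1 * xx * g + b2 * xx + b3 * yy + b4) * ?z"
      by (intro eqv_right yy)
    also have "\<dots> = b1 * (xx * (g * ?z)) + b2 * (xx * ?z) + b3 * (yy * ?z) + b4 * ?z"
      by (simp only: distrib_right mult.assoc)
    finally show ?case
      using coeff step2 z by (auto intro!: NF_add NF_Const NF_xx NF_yy elim!: NF_eqv)
  qed
  show "g * nform k \<in> NF" for k
    using * by (simp add: nform_def case_prod_beta)
qed

lemma NF_alt_word: "alt_word g0 g1 j \<in> NF"
  using NF_nform[of "(0, j)"] by (simp add: nform_def xpow_def)

lemma NF_g0_word: "g0 * alt_word g0 g1 j \<in> NF"
proof (cases "j \<le> 0")
  case True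
  then show ?thesis using NF_alt_word by (simp flip: alt_word_left)
next
  case False
  then have w: "alt_word g0 g1 j = g0 * alt_word g0 g1 (1 - j)"
    using alt_word_left[of "1 - j" g0 g1] by simp
  have "g0 * g0 \<approx> Const c0 * g0 - 1"
    using g_inv(2) eqv_diff[OF eqv_refl g_inv(2), of "Const c0 * g0"] by (simp add: g0'_def left_diff_distrib)
  from eqv_right[OF this] have "g0 * alt_word g0 g1 j \<approx> Const c0 * alt_word g0 g1 j - alt_word g0 g1 (1 - j)"
    by (simp add: w left_diff_distrib mult.assoc)
  then show ?thesis
    by (rule NF_eqv) (intro NF_diff NF_Const NF_alt_word)
qed

lemma NF_g1_word: "g1 * alt_word g0 g1 j \<in> NF"
proof (cases "j \<ge> 0")
  case True
  then show ?thesis using NF_alt_word by (simp flip: alt_word_right)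
next
  case False
  then have w: "alt_word g0 g1 j = g1 * alt_word g0 g1 (- 1 - j)"
    using alt_word_right[of "- 1 - j" g0 g1] by simp
  have "g1 * g1 \<approx> Const c1 * g1 - 1"
    using g_inv(4) eqv_diff[OF eqv_refl g_inv(4), of "Const c1 * g1"] by (simp add: g1'_def left_diff_distrib)
  from eqv_right[OF this] have "g1 * alt_word g0 g1 j \<approx> Const c1 * alt_word g0 g1 j - alt_word g0 g1 (- 1 - j)"
    by (simp add: w left_diff_distrib mult.assoc)
  then show ?thesis
    by (rule NF_eqv) (intro NF_diff NF_Const NF_alt_word)
qed

lemma NF_g0: "x \<in> NF \<Longrightarrow> g0 * x \<in> NF"
proof (rule NF_letter[OF NF_g0_word])
  have "Const (inverse q) * (Const c0v - Const (inverse q) * (yy * g0')) =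
      Const (inverse q * inverse q) * yy * g0 + Const (- (inverse q * inverse q * c0)) * yy + Const 0 * xx
      + Const (inverse q * c0v)"
    by (simp add: g0'_def right_diff_distrib Const_mult Const_uminus mult.assoc Const_commute[of c0] Const_zero)
  then show "g0 * xx \<approx> Const (inverse q * inverse q) * yy * g0 + Const (- (inverse q * inverse q * c0)) * yy + Const 0 * xx
      + Const (inverse q * c0v)"
    using g0_xx by simp
  show "g0 * yy \<approx> Const (q * q) * xx * g0 + Const 0 * xx + Const c0 * yy + Const (- (q * c0v))"
    using g0_yy by (simp add: Const_uminus Const_zero mult.assoc algebra_simps)
qed auto

lemma NF_g1: "x \<in> NF \<Longrightarrow> g1 * x \<in> NF"
proof (rule NF_letter[OF NF_g1_word])
  show "g1 * xx \<approx> Const 1 * yy * g1 + Const 0 * yy + Const c1 * xx + Const (- c1v)"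
    using g1_xx by (simp add: Const_one Const_zero Const_uminus)
  show "g1 * yy \<approx> Const 1 * xx * g1 + Const (- c1) * xx + Const 0 * yy + Const c1v"
    using g1_yy by (simp add: Const_one Const_zero Const_uminus)
qed auto

lemma NF_g1': "x \<in> NF \<Longrightarrow> g1' * x \<in> NF" and NF_g0': "x \<in> NF \<Longrightarrow> g0' * x \<in> NF"
  by (simp_all add: g1'_def g0'_def left_diff_distrib NF_diff NF_Const NF_g0 NF_g1)

lemma NF_g1v: "x \<in> NF \<Longrightarrow> g1v * x \<in> NF"
proof -
  assume x: "x \<in> NF"
  have "g1v * 1 * x \<approx> g1v * (g1 * g1') * x"
    by (intro eqv_left eqv_right eqv_sym[OF g_inv(3)])
  then have "g1v * x \<approx> xx * (g1' * x)"
    by (simp add: xx_def mult.assoc)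
  with x show ?thesis by (auto elim!: NF_eqv intro: NF_xx NF_g1')
qed

lemma NF_g0v: "x \<in> NF \<Longrightarrow> g0v * x \<in> NF"
proof -
  assume x: "x \<in> NF"
  have "g0v * x \<approx> Const (inverse q) * (yy * (g0' * x))"
    using eqv_right[OF g0v_eqv, of x] by (simp add: mult.assoc)
  with x show ?thesis by (auto elim!: NF_eqv intro: NF_yy NF_g0' NF_Const)
qed

lemma NF_UNIV: "x \<in> NF"
proof (induction x rule: poly_mapping_induct_single)
  case zero
  then show ?case by (rule NF_zero)
next
  case (add w c x)
  obtain l where w: "w = Word l" by (cases w)
  have "Poly_Mapping.single (Word l) 1 \<in> NF"
  proof (induction l)
    case Nil
    then show ?case
      using NF_alt_word[of 0] by (simp flip: zero_word_def)
  next
    case (Cons g l)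
    have "Poly_Mapping.single (Word (g # l)) 1 = free_gen g * Poly_Mapping.single (Word l) (1::'a)"
      by (simp add: free_gen_def mult_single)
    with Cons show ?case
      using NF_g0 NF_g1 NF_g0v NF_g1v by (cases g) simp_all
  qed
  moreover have "Poly_Mapping.single w c = Const c * Poly_Mapping.single w 1"
    by (simp add: Const_def mult_single)
  ultimately show ?case using add w by (simp add: NF_add NF_Const)
qed

end

section \<open>Supports of vectors and faithfulness of the representation\<close>

definition unit_vec :: "int \<Rightarrow> 'a::field vec" where
  "unit_vec j = (\<lambda>i. if i = j then 1 else 0)"

definition supp :: "int \<Rightarrow> 'a::field vec \<Rightarrow> bool" where
  "supp l v \<longleftrightarrow> (\<forall>j. \<bar>j\<bar> > l \<longrightarrow> v j = 0)"

lemma suppD: "supp l v \<Longrightarrow> \<bar>j\<bar> > l \<Longrightarrow> v j = 0"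
  by (simp add: supp_def)

lemma supp_mono: "supp l v \<Longrightarrow> l \<le> l' \<Longrightarrow> supp l' v"
  by (simp add: supp_def)

lemma supp_add: "supp l v \<Longrightarrow> supp l w \<Longrightarrow> supp l (v + w)"
  and supp_diff: "supp l v \<Longrightarrow> supp l w \<Longrightarrow> supp l (v - w)"
  by (simp_all add: supp_def)

lemma supp_lmul: "supp l v \<Longrightarrow> supp l (app (lmul f) v)"
  by (simp add: supp_def app_lmul)

lemma supp_unit_vec: "\<bar>j\<bar> \<le> l \<Longrightarrow> supp l (unit_vec j)"
  by (auto simp: supp_def unit_vec_def)

lemma supp_shrink:
  assumes "supp l v" "v l = 0" "v (- l) = 0"
  shows "supp (l - 1) v"
  unfolding supp_def
proof (intro allI impI)
  fix j assume "l - 1 < \<bar>j\<bar>"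
  then have "l < \<bar>j\<bar> \<or> j = l \<or> j = - l" by linarith
  with assms show "v j = 0" by (auto simp: supp_def)
qed

context daha_params
begin

fun letter_op :: "gen \<Rightarrow> 'a vec endo" where
  "letter_op G0 = T0"
| "letter_op G1 = T1"
| "letter_op G0v = T0v"
| "letter_op G1v = T1v"

definition word_op :: "gen word \<Rightarrow> 'a vec endo" where
  "word_op w = (case w of Word l \<Rightarrow> prod_list (map letter_op l))"

lemma sc_letter: "letter_op g * sc c = sc c * letter_op g"
  by (cases g) (simp_all add: sc_T0 sc_T1 sc_T0v sc_T1v)

sublocale RHO: monoid_alg_eval sc word_op
proof
  fix m m' :: "gen word" and x :: 'a
  show "word_op (m + m') = word_op m * word_op m'"
    by (cases m; cases m') (simp add: word_op_def)
  obtain l where m: "m = Word l" by (cases m)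
  show "word_op m * sc x = sc x * word_op m"
    unfolding m by (induction l) (simp_all add: word_op_def sc_mult_commute sc_letter)
qed (simp_all add: sc_add sc_mult sc_one word_op_def zero_word_def)

abbreviation "rho \<equiv> RHO.ev"

lemma rho_gen: "rho g0 = T0" "rho g1 = T1" "rho g0v = T0v" "rho g1v = T1v"
  by (simp_all add: free_gen_def RHO.ev_single word_op_def sc_one)

lemma rho_DI: "x \<in> DI \<Longrightarrow> rho x = 0"
proof -
  have "ideal {x. rho x = 0} RT"
    by (auto simp: ideal_type_iff RHO.ev_zero RHO.ev_add RHO.ev_mult)
  moreover have "daha_relators q k0 k1 k0v k1v \<subseteq> {x. rho x = 0}"
    by (auto simp: daha_relators_def RHO.ev_mult RHO.ev_diff rho_gen RHO.ev_Const daha_quadratic daha_product)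
  ultimately have "DI \<subseteq> {x. rho x = 0}"
    unfolding DI_def daha_ideal_def by (rule ring.genideal_minimal[OF ring_type])
  then show "x \<in> DI \<Longrightarrow> rho x = 0" by auto
qed

lemma rho_eqv: "x \<approx> y \<Longrightarrow> rho x = rho y"
  using rho_DI[of "x - y"] by (simp add: eqv_def RHO.ev_diff)

abbreviation "W \<equiv> alt_word T0 T1"

lemma rho_alt_word: "rho (alt_word g0 g1 j) = W j"
  by (induction j rule: word_induct)
    (simp_all add: RHO.ev_one alt_word_left alt_word_right RHO.ev_mult rho_gen)

lemma rho_xpow: "rho (xpow m) = lmul (Xp m)"
proof -
  have xx: "rho xx = lmul (Xp 1)"
    by (simp add: xx_def RHO.ev_mult rho_gen T1v_T1)
  have "rho xx * rho yy = 1"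
    using rho_eqv[OF xx_yy(1)] by (simp add: RHO.ev_mult RHO.ev_one)
  then have "lmul (Xp (- 1)) * (lmul (Xp 1) * rho yy) = lmul (Xp (- 1))"
    by (simp add: xx)
  then have yy: "rho yy = lmul (Xp (- 1))"
    by (simp add: lmul_Xp_cancel flip: mult.assoc)
  show ?thesis
    by (simp add: xpow_def RHO.ev_power xx yy Xp_power flip: lmul_power)
qed

abbreviation "e0 \<equiv> unit_vec 0 :: 'a vec"

lemma T0_unit_vec: "j \<le> 0 \<Longrightarrow> app T0 (unit_vec j) = unit_vec (1 - j)"
  and T1_unit_vec: "j \<ge> 0 \<Longrightarrow> app T1 (unit_vec j) = unit_vec (- 1 - j)"
  by (rule ext; auto simp: T0_def T1_def R0.app_T R1.app_T unit_vec_def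
        dem_zero[OF r0] dem_one[OF r0] rfl_simps[OF r0] dem_zero[OF r1] dem_one[OF r1] rfl_simps[OF r1])+

lemma W_e0: "app (W j) e0 = unit_vec j"
  by (induction j rule: word_induct) (simp_all add: alt_word_left alt_word_right T0_unit_vec T1_unit_vec)

lemma app_sc: "app (sc c) v j = Const c * v j"
  by (simp add: sc_def app_lmul)

text \<open>The normal form X^m w_j sends \<open>e0\<close> to X^m at coordinate j, so all
  coefficients can be read off from one vector. Independence of the normal forms and faithfulness
  follow together.\<close>

lemma lookup_rho_nform:
  "Poly_Mapping.lookup (app (rho (FC.lin nform u)) e0 j) m = Poly_Mapping.lookup u (m, j)"
proof (induction u rule: poly_mapping_induct_single)
  case (add k c u)
  have "app (rho (nform k)) e0 j = (if j = snd k then Xp (fst k) else 0)"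
    by (simp add: nform_def case_prod_beta RHO.ev_mult rho_xpow rho_alt_word W_e0 app_lmul)
      (simp add: unit_vec_def)
  then show ?case
    using add by (cases k) (auto simp: FC.lin_add FC.lin_single RHO.ev_add RHO.ev_mult RHO.ev_Const lookup_add app_sc
        lookup_Const_mult lookup_Xp lookup_single when_def)
qed (simp add: FC.lin_zero RHO.ev_zero)

lemma rho_kernel: "rho x = 0 \<longleftrightarrow> x \<in> DI"
proof
  assume x: "rho x = 0"
  from NF_UNIV[of x] obtain u where u: "x \<approx> FC.lin nform u" by (rule NF_E)
  have "Poly_Mapping.lookup u k = 0" for k
    using lookup_rho_nform[of u "snd k" "fst k"] rho_eqv[OF u] x by simp
  then have "u = 0" by (intro poly_mapping_eqI) simp
  with u show "x \<in> DI" by (simp add: FC.lin_zero eqv_def)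
qed (rule rho_DI)

definition "Himg = Set.range rho"

text \<open>The algebra element with value \<open>v\<close> at \<open>e0\<close>, provided
  \<open>v\<close> vanishes beyond length \<open>l\<close>. By \<open>Himg_eq_opr\<close> every
  element is recovered in this way from its value at \<open>e0\<close>.\<close>

definition opr :: "int \<Rightarrow> 'a vec \<Rightarrow> 'a vec endo" where
  "opr l v = (\<Sum>j\<in>{- l..l}. lmul (v j) * W j)"

lemma opr_mono: "supp l v \<Longrightarrow> l \<le> l' \<Longrightarrow> opr l v = opr l' v"
  unfolding opr_def by (rule sum.mono_neutral_left) (auto simp: supp_def lmul_zero)

lemma opr_app: "app (opr l v) w j = (\<Sum>i\<in>{- l..l}. v i * app (W i) w j)"
proof -
  have "(\<Sum>i\<in>A. f i) j = (\<Sum>i\<in>A. f i j)" for f :: "int \<Rightarrow> 'a vec" and A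
    by (induction A rule: infinite_finite_induct) simp_all
  then show ?thesis by (simp add: opr_def app_sum app_lmul)
qed

lemma opr_e0: "supp l v \<Longrightarrow> app (opr l v) e0 = v"
proof
  fix j assume v: "supp l v"
  have "app (opr l v) e0 j = (\<Sum>i\<in>{- l..l}. if i = j then v i else 0)"
    unfolding opr_app W_e0 by (rule sum.cong) (simp_all add: unit_vec_def)
  then show "app (opr l v) e0 j = v j"
    using v by (auto simp: supp_def)
qed

lemma Himg_opr: "z \<in> Himg \<Longrightarrow> \<exists>l\<ge>0. \<exists>v. supp l v \<and> z = opr l v"
proof -
  assume "z \<in> Himg"
  then obtain x where x: "z = rho x" by (auto simp: Himg_def)
  from NF_UNIV[of x] obtain u where u: "x \<approx> FC.lin nform u" by (rule NF_E)
  have "\<exists>l\<ge>0. \<exists>v. supp l v \<and> rho (FC.lin nform u) = opr l v"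
  proof (induction u rule: poly_mapping_induct_single)
    case zero
    have "supp 0 (0 :: 'a vec)" "opr 0 0 = 0" by (simp_all add: supp_def opr_def lmul_zero)
    then show ?case by (metis FC.lin_zero RHO.ev_zero order_refl)
  next
    case (add k c u)
    then obtain l v where l: "l \<ge> 0" "supp l v" "rho (FC.lin nform u) = opr l v" by auto
    let ?w = "app (lmul (Const c * Xp (fst k))) (unit_vec (snd k))"
    let ?l = "max l \<bar>snd k\<bar>"
    have w: "supp \<bar>snd k\<bar> ?w"
      by (simp add: supp_lmul supp_unit_vec)
    have "opr \<bar>snd k\<bar> ?w = (\<Sum>j\<in>{- \<bar>snd k\<bar>..\<bar>snd k\<bar>}. if j = snd k then lmul (Const c * Xp (fst k)) * W (snd k) else 0)"
      unfolding opr_def by (rule sum.cong) (auto simp: app_lmul unit_vec_def lmul_zero)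
    also have "\<dots> = rho (Const c * nform k)"
      by (simp add: nform_def case_prod_beta RHO.ev_mult rho_xpow rho_alt_word RHO.ev_Const sc_def lmul_mult mult.assoc)
        (use abs_ge_self abs_ge_minus_self in auto)
    finally have "rho (Const c * nform k) = opr ?l ?w"
      using opr_mono[OF w, of ?l] by simp
    moreover have "opr l v = opr ?l v" using opr_mono[OF l(2), of ?l] by simp
    moreover have "opr ?l ?w + opr ?l v = opr ?l (?w + v)"
      by (simp add: opr_def lmul_add distrib_right sum.distrib)
    ultimately have "rho (FC.lin nform (Poly_Mapping.single k c + u)) = opr ?l (?w + v)"
      by (simp add: FC.lin_add FC.lin_single RHO.ev_add l(3))
    moreover have "supp ?l (?w + v)"
      by (intro supp_add supp_mono[OF w] supp_mono[OF l(2)]) auto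
    ultimately show ?case using l(1) by (intro exI[of _ ?l]) auto
  qed
  then show ?thesis using x rho_eqv[OF u] by simp
qed

lemma Himg_supp: "z \<in> Himg \<Longrightarrow> \<exists>l\<ge>0. supp l (app z e0)"
  using Himg_opr[of z] opr_e0 by auto

lemma Himg_eq_opr: "z \<in> Himg \<Longrightarrow> supp l (app z e0) \<Longrightarrow> z = opr l (app z e0)"
proof -
  assume z: "z \<in> Himg" and l: "supp l (app z e0)"
  from Himg_opr[OF z] obtain l' v where *: "l' \<ge> 0" "supp l' v" "z = opr l' v" by auto
  then have v: "app z e0 = v" by (simp add: opr_e0)
  have "opr l v = opr (max l l') v" "opr l' v = opr (max l l') v"
    using opr_mono[of l v "max l l'"] opr_mono[of l' v "max l l'"] l *(2) v by simp_all
  then have "z = opr l v" by (simp only: *(3))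
  then show ?thesis unfolding v .
qed

lemma Himg_faithful: "z \<in> Himg \<Longrightarrow> app z e0 = 0 \<Longrightarrow> z = 0"
  using Himg_eq_opr[of z 0] by (simp add: supp_def opr_def lmul_zero)

lemma Himg_add: "x \<in> Himg \<Longrightarrow> y \<in> Himg \<Longrightarrow> x + y \<in> Himg"
  and Himg_diff: "x \<in> Himg \<Longrightarrow> y \<in> Himg \<Longrightarrow> x - y \<in> Himg"
  and Himg_mult: "x \<in> Himg \<Longrightarrow> y \<in> Himg \<Longrightarrow> x * y \<in> Himg"
  by (auto simp: Himg_def simp flip: RHO.ev_add RHO.ev_diff RHO.ev_mult)

lemma Himg_one: "1 \<in> Himg" and Himg_sc: "sc c \<in> Himg"
  using RHO.ev_one RHO.ev_Const[of c] by (auto simp: Himg_def image_iff) metis+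

lemma Himg_power: "x \<in> Himg \<Longrightarrow> x ^ k \<in> Himg"
  by (induction k) (simp_all add: Himg_one Himg_mult)

lemma Himg_T: "T0 \<in> Himg" "T1 \<in> Himg" "T0v \<in> Himg" "T1v \<in> Himg"
  unfolding Himg_def by (simp_all flip: rho_gen)

lemma Himg_T': "T0' \<in> Himg" "T1' \<in> Himg"
  by (simp_all add: T0'_def T1'_def Himg_diff Himg_sc Himg_T)

lemma Himg_lmul: "lmul f \<in> Himg"
proof (induction f rule: lau_induct)
  case zero
  then show ?case using Himg_sc[of 0] by (simp add: sc_zero lmul_zero)
next
  case (add m c f)
  have "lmul (Xp m) \<in> Himg" by (simp add: Himg_def flip: rho_xpow)
  with add show ?case
    using Himg_sc[of c] by (simp add: lmul_add lmul_mult Himg_add Himg_mult sc_def)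
qed

text \<open>Among the words of length l + 1 only the one beginning with t0 is reached, namely from
  index -l; so index -(l + 1) receives nothing.\<close>

lemma T0_supp:
  assumes "supp l v" "l \<ge> 0"
  shows "supp (l + 1) (app T0 v)" "app T0 v (l + 1) = rfl r0 (v (- l))" "app T0 v (- (l + 1)) = 0"
  using assms by (auto simp: supp_def T0_def R0.app_T rfl_simps[OF r0] dem_zero[OF r0])

lemma T1_supp:
  assumes "supp l v" "l \<ge> 0"
  shows "supp (l + 1) (app T1 v)" "app T1 v (- (l + 1)) = rfl 1 (v l)" "app T1 v (l + 1) = 0"
  using assms by (auto simp: supp_def T1_def R1.app_T rfl_simps[OF r1] dem_zero[OF r1])

text \<open>The automorphism by which the word j moves past Laurent polynomials up to shorter words.
  It is a composite of the two reflections, here in closed form; \<open>act_left\<close> and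
  \<open>act_right\<close> give the recursion.\<close>

definition act :: "int \<Rightarrow> 'a lau \<Rightarrow> 'a lau" where
  "act j f = (if even j then scl (q powi j) f
    else if j > 0 then rfl r0 (scl (q powi (1 - j)) f) else rfl 1 (scl (q powi (- 1 - j)) f))"

lemma scl_scl: "a \<noteq> 0 \<Longrightarrow> b \<noteq> 0 \<Longrightarrow> scl a (scl b f) = scl (a * b) f"
  by (rule poly_mapping_eqI) (simp add: lookup_scl power_int_mult_distrib)

lemma scl_1: "scl (1::'a) f = f"
  by (rule poly_mapping_eqI) (simp add: lookup_scl)

lemma rfl_rfl_scl: "rfl r0 (rfl 1 f) = scl (q\<^sup>2) f" "rfl 1 (rfl r0 f) = scl (inverse (q\<^sup>2)) f"
  using nz r0 by (induction f rule: lau_induct)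
    (simp_all add: rfl_simps scl_simps rfl_Xp scl_Xp r0_def power_int_minus power_int_inverse Const_one)

lemma act_0: "act 0 f = f"
  by (simp add: act_def scl_1)

lemma act_left: "j \<le> 0 \<Longrightarrow> act (1 - j) f = rfl r0 (act j f)"
  and act_right: "j \<ge> 0 \<Longrightarrow> act (- 1 - j) f = rfl 1 (act j f)"
proof -
  have q: "q powi j \<noteq> 0" for j using nz by simp
  have e: "q\<^sup>2 * q powi (- 1 - j) = q powi (1 - j)" "inverse (q\<^sup>2) * q powi (1 - j) = q powi (- 1 - j)" for j
    using nz power_int_add[of q 2 "- 1 - j"] power_int_add[of q "- 2" "1 - j"]
    by (simp_all add: power_int_minus)
  show "act (1 - j) f = rfl r0 (act j f)" if "j \<le> 0"
    using that nz q by (cases "j = 0") (auto simp: act_def rfl_rfl_scl scl_scl e)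
  show "act (- 1 - j) f = rfl 1 (act j f)" if "j \<ge> 0"
    using that nz q by (cases "j = 0") (auto simp: act_def rfl_rfl_scl scl_scl e)
qed

text \<open>The last letter of the word j, determined by the sign and parity of j, selects the
  extremal word of \<open>v\<close> that is prolonged without cancellation: the one beginning with
  the other letter.\<close>

lemma W_supp:
  assumes "supp l v" "l \<ge> 0"
  shows "supp (\<bar>j\<bar> + l) (app (W j) v) \<and>
    (j \<le> 0 \<longrightarrow> app (W j) v (j - l) = act j (v (if even j then - l else l))) \<and>
    (j \<ge> 0 \<longrightarrow> app (W j) v (j + l) = act j (v (if even j then l else - l))) \<and>
    (j < 0 \<longrightarrow> app (W j) v (- j + l) = 0) \<and> (j > 0 \<longrightarrow> app (W j) v (- j - l) = 0)"
proof (induction j rule: word_induct)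
  case zero
  then show ?case using assms by (simp add: act_0)
next
  case (left j)
  then have "supp (- j + l) (app (W j) v)" "- j + l \<ge> 0" using assms by simp_all
  from T0_supp[OF this] left show ?case
    by (simp add: alt_word_left act_left algebra_simps)
next
  case (right j)
  then have "supp (j + l) (app (W j) v)" "j + l \<ge> 0" using assms by simp_all
  from T1_supp[OF this] right show ?case
    by (simp add: alt_word_right act_right algebra_simps)
qed

text \<open>Words shorter than l do not reach the extremal index, and of the two words of length l
  one misses it. A single product remains, twisted by \<open>act\<close>.\<close>

lemma opr_top:
  assumes "l > 0" "k \<ge> 0" "supp k w"
  shows "app (opr l v) w (l + k) = v l * act l (w (if even l then k else - k))"
    and "app (opr l v) w (- l - k) = v (- l) * act (- l) (w (if even l then - k else k))"
proof -
  note W = W_supp[OF assms(3,2)]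
  have "app (W i) w j = 0" if "\<bar>j\<bar> > \<bar>i\<bar> + k" for i j
    using W[of i] that suppD by blast
  then have "app (opr l v) w j = (\<Sum>i\<in>{l, - l}. v i * app (W i) w j)" if "\<bar>j\<bar> = l + k" for j
    unfolding opr_app using that assms by (intro sum.mono_neutral_right) auto
  moreover have "l \<noteq> - l" "\<bar>l + k\<bar> = l + k" "\<bar>- l - k\<bar> = l + k" using assms by auto
  ultimately show "app (opr l v) w (l + k) = v l * act l (w (if even l then k else - k))"
    "app (opr l v) w (- l - k) = v (- l) * act (- l) (w (if even l then - k else k))"
    using W[of l] W[of "- l"] assms(1) by simp_all
qed

end

text \<open>Here \<open>n\<close> will be \<open>dbar d\<close>. The condition
  \<open>q_order\<close> says that q^2 has exact order n; \<open>q_sign\<close> records that n = d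
  is odd for odd d, and that q^n = -1 for even d.\<close>

locale daha_root = daha_params +
  fixes n :: nat
  assumes n_pos: "n > 0"
    and q_order: "\<And>m::int. q powi (2 * m) = 1 \<longleftrightarrow> int n dvd m"
    and q_sign: "odd n \<and> q ^ n = 1 \<or> q ^ n = - 1"
begin

lemma act_Xp_1:
  assumes "act j (Xp 1) = Xp 1"
  shows "2 * int n dvd j"
proof -
  have q: "q powi j \<noteq> 0" for j using nz by simp
  have "Poly_Mapping.lookup (act j (Xp 1)) 1 = (1::'a)"
    unfolding assms by (simp add: lookup_Xp)
  then have "even j \<and> q powi j = 1"
    by (auto simp: act_def scl_Xp[OF q] rfl_Xp[OF r0] rfl_Xp[OF r1] rfl_simps[OF r0] rfl_simps[OF r1]
        lookup_Const_mult lookup_Xp split: if_splits)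
  then show ?thesis
    using q_order[of "j div 2"] by (auto elim!: evenE)
qed

text \<open>Comparing extremal coordinates of z X and X z, the coefficient of the word l either
  vanishes or \<open>act l\<close> fixes X, and the latter forces 2n to divide l. The same holds at
  -l.\<close>

lemma centralizer_X_top:
  assumes "z \<in> Himg" "z * lmul (Xp 1) = lmul (Xp 1) * z" "supp l (app z e0)" "l > 0" "\<not> 2 * int n dvd l"
  shows "supp (l - 1) (app z e0)"
proof (rule supp_shrink[OF assms(3)])
  let ?v = "app z e0" and ?w = "app (lmul (Xp 1)) e0"
  have z: "z = opr l ?v" by (rule Himg_eq_opr[OF assms(1,3)])
  have w: "supp 0 ?w" by (simp add: supp_lmul supp_unit_vec)
  have "app z ?w j = Xp 1 * ?v j" for j
    using arg_cong[OF assms(2), of "\<lambda>z. app z e0 j"] by (simp add: app_lmul)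
  then have e: "app (opr l ?v) ?w j = Xp 1 * ?v j" for j
    using z by metis
  have w0: "?w 0 = Xp 1" by (simp add: app_lmul unit_vec_def)
  have n: "act l (Xp 1) \<noteq> Xp 1" "act (- l) (Xp 1) \<noteq> Xp 1"
    using assms(5) act_Xp_1 by force+
  have "?v l = 0 \<or> Xp 1 = act l (Xp 1)"
    using opr_top(1)[OF assms(4) order_refl w, of ?v] e[of l] w0 by (simp add: algebra_simps cong: if_cong)
  then show "?v l = 0" using n by metis
  have "?v (- l) = 0 \<or> Xp 1 = act (- l) (Xp 1)"
    using opr_top(2)[OF assms(4) order_refl w, of ?v] e[of "- l"] w0 by (simp add: algebra_simps cong: if_cong)
  then show "?v (- l) = 0" using n by metis
qed

lemma centralizer_X_short:
  assumes "z \<in> Himg" "z * lmul (Xp 1) = lmul (Xp 1) * z" "supp (2 * int n - 1) (app z e0)"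
  shows "z = lmul (app z e0 0)"
proof -
  have "supp (int m) (app z e0)" if "m \<le> 2 * n - 1" for m
    using that
  proof (induction rule: inc_induct)
    case base
    then show ?case using assms(3) n_pos by (simp add: of_nat_diff)
  next
    case (step m)
    have "\<not> 2 * int n dvd int (Suc m)"
      using step.hyps by (intro zdvd_not_zless) auto
    from centralizer_X_top[OF assms(1,2) step.IH _ this] show ?case by simp
  qed
  from Himg_eq_opr[OF assms(1) this[of 0]] show ?thesis
    by (simp add: opr_def)
qed

text \<open>At the extremal indices commutation with t0 gives v(l) = s0 v(-l), commutation with t1
  gives v(-l) = s1 v(l). Hence v(l) is fixed by s0 s1, the translation X -> q^2 X.\<close>

lemma central_top:
  assumes z: "z \<in> Himg" and comm: "z * T0 = T0 * z" "z * T1 = T1 * z" and l: "supp l (app z e0)" "l \<ge> 0" "even l"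
  shows "app z e0 (- l) = rfl 1 (app z e0 l)" "scl (q\<^sup>2) (app z e0 l) = app z e0 l"
proof -
  let ?v = "app z e0"
  have z: "z = opr l ?v" by (rule Himg_eq_opr[OF z l(1)])
  have act1: "act j 1 = 1" for j
    using nz r0 by (simp add: act_def scl_simps rfl_simps)
  have "app z (unit_vec 1) = app T0 ?v" "app z (unit_vec (- 1)) = app T1 ?v"
    using arg_cong[OF comm(1), of "\<lambda>z. app z e0"] arg_cong[OF comm(2), of "\<lambda>z. app z e0"]
    by (simp_all add: T0_unit_vec T1_unit_vec)
  then have *: "app (opr l ?v) (unit_vec 1) = app T0 ?v" "app (opr l ?v) (unit_vec (- 1)) = app T1 ?v"
    using z by metis+
  have "app T0 ?v (l + 1) = ?v l" "app T1 ?v (- l - 1) = ?v (- l)"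
  proof -
    have u: "supp 1 (unit_vec 1 :: 'a vec)" "supp 1 (unit_vec (- 1) :: 'a vec)" by (simp_all add: supp_unit_vec)
    show "app T0 ?v (l + 1) = ?v l"
      using opr_top(1)[OF _ _ u(1), of l ?v] l by (cases "l = 0") (simp_all flip: *, simp_all add: unit_vec_def act1 opr_def app_lmul)
    show "app T1 ?v (- l - 1) = ?v (- l)"
      using opr_top(2)[OF _ _ u(2), of l ?v] l by (cases "l = 0") (simp_all flip: *, simp_all add: unit_vec_def act1 opr_def app_lmul)
  qed
  moreover have "- (l + 1) = - l - 1" by simp
  ultimately have "rfl r0 (?v (- l)) = ?v l" and 1: "rfl 1 (?v l) = ?v (- l)"
    using T0_supp(2)[OF l(1,2)] T1_supp(2)[OF l(1,2)] by simp_all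
  then show "?v (- l) = rfl 1 (?v l)" "scl (q\<^sup>2) (?v l) = ?v l"
    by (simp_all flip: rfl_rfl_scl)
qed

end

section \<open>The central elements\<close>

lemma commute_mult:
  fixes x y z :: "'r::semigroup_mult"
  assumes "x * y = y * x" "x * z = z * x"
  shows "x * (y * z) = y * z * x"
  using assms by (metis mult.assoc)

lemma power_mult_commute:
  fixes x y :: "'r::monoid_mult"
  assumes "x * y = y * x"
  shows "(x * y) ^ m = x ^ m * y ^ m"
proof (induction m)
  case (Suc m)
  have "y * x ^ m = x ^ m * y"
    using assms by (metis power_commuting_commutes)
  then have "x * y * (x ^ m * y ^ m) = x * (x ^ m * y) * y ^ m"
    by (simp add: mult.assoc) (simp flip: mult.assoc)
  with Suc show ?case by (simp add: mult.assoc)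
qed simp

context daha_params
begin

definition central :: "'a vec endo \<Rightarrow> bool" where
  "central z \<longleftrightarrow> z \<in> Himg \<and> (\<forall>x\<in>Himg. z * x = x * z)"

lemma centralI:
  assumes "z \<in> Himg" "\<And>g. z * letter_op g = letter_op g * z"
  shows "central z"
proof -
  have "z * rho p = rho p * z" for p
  proof (induction p rule: poly_mapping_induct_single)
    case (add w c p)
    obtain l where w: "w = Word l" by (cases w)
    have "z * prod_list (map letter_op l) = prod_list (map letter_op l) * z"
      by (induction l) (simp_all add: commute_mult assms(2))
    moreover have "z * sc c = sc c * z"
    proof -
      from assms(1) obtain p where "z = rho p" by (auto simp: Himg_def)
      then show ?thesis by (simp add: Const_commute flip: RHO.ev_Const RHO.ev_mult)
    qed
    ultimately have "z * (sc c * word_op w) = sc c * word_op w * z"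
      by (simp add: w word_op_def commute_mult)
    with add show ?case by (simp add: RHO.ev_add RHO.ev_single distrib_left distrib_right)
  qed (simp add: RHO.ev_zero)
  with assms(1) show ?thesis by (auto simp: central_def Himg_def)
qed

lemma central_add: "central x \<Longrightarrow> central y \<Longrightarrow> central (x + y)"
  and central_diff: "central x \<Longrightarrow> central y \<Longrightarrow> central (x - y)"
  by (simp_all add: central_def Himg_add Himg_diff algebra_simps)

lemma central_mult: "central x \<Longrightarrow> central y \<Longrightarrow> central (x * y)"
  unfolding central_def
proof (intro conjI ballI)
  fix w assume *: "x \<in> Himg \<and> (\<forall>w\<in>Himg. x * w = w * x)" "y \<in> Himg \<and> (\<forall>w\<in>Himg. y * w = w * y)" "w \<in> Himg"
  then have "w * x = x * w" "w * y = y * w" by simp_all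
  then show "x * y * w = w * (x * y)" by (rule commute_mult[symmetric])
qed (blast intro: Himg_mult)

lemma central_commute: "central x \<Longrightarrow> y \<in> Himg \<Longrightarrow> x * y = y * x"
  and central_Himg: "central x \<Longrightarrow> x \<in> Himg"
  unfolding central_def by blast+

lemma central_sc: "central (sc c)"
  by (rule centralI) (simp_all add: Himg_sc sc_letter)

lemma central_power: "central x \<Longrightarrow> central (x ^ k)"
  using central_sc[of 1] by (induction k) (simp_all add: sc_one central_mult)

lemma central_lmul:
  assumes "rfl r0 f = f" "rfl 1 f = f"
  shows "central (lmul f)"
proof (rule centralI[OF Himg_lmul])
  have "dem r0 f = 0" "dem 1 f = 0"
    by (rule dem_unique; simp add: assms r0)+
  then have T: "lmul f * T0 = T0 * lmul f" "lmul f * T1 = T1 * lmul f"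
    by (simp_all add: T0_def T1_def R0.T_lmul R1.T_lmul assms lmul_zero)
  then have T': "lmul f * T0' = T0' * lmul f" "lmul f * T1' = T1' * lmul f"
    by (simp_all add: T0'_def T1'_def algebra_simps sc_lmul)
  show "lmul f * letter_op g = letter_op g * lmul f" for g
  proof (cases g)
    case G0v
    then show ?thesis
      unfolding letter_op.simps G0v T0v_def by (intro commute_mult T'(1) lmul_commute sc_lmul)
  next
    case G1v
    then show ?thesis
      unfolding letter_op.simps G1v T1v_def by (intro commute_mult T'(2) lmul_commute)
  qed (simp_all add: T)
qed

lemma opr_supp: "supp k w \<Longrightarrow> k \<ge> 0 \<Longrightarrow> supp (l + k) (app (opr l v) w)"
  unfolding supp_def opr_app
proof (intro allI impI sum.neutral ballI)
  fix j i assume w: "\<forall>j. k < \<bar>j\<bar> \<longrightarrow> w j = 0" "k \<ge> 0" "l + k < \<bar>j\<bar>" "i \<in> {- l..l}"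
  then have "\<bar>i\<bar> + k < \<bar>j\<bar>" by auto
  moreover have "supp (\<bar>i\<bar> + k) (app (W i) w)"
    using W_supp[of k w i] w(1,2) by (simp add: supp_def)
  ultimately show "v i * app (W i) w j = 0"
    by (simp add: suppD)
qed

lemma T0'_supp:
  assumes "supp l v" "l \<ge> 0"
  shows "supp (l + 1) (app T0' v)" "app T0' v (l + 1) = - rfl r0 (v (- l))" "app T0' v (- (l + 1)) = 0"
  using T0_supp[OF assms] assms by (auto simp: T0'_def app_sc supp_def)

lemma T1'_supp:
  assumes "supp l v" "l \<ge> 0"
  shows "supp (l + 1) (app T1' v)" "app T1' v (- (l + 1)) = - rfl 1 (v l)" "app T1' v (l + 1) = 0"
  using T1_supp[OF assms] assms by (auto simp: T1'_def app_sc supp_def)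

end

context daha_root
begin

definition "\<eta> = q ^ n"

text \<open>By \<open>q_sign\<close>, \<open>\<eta>\<close> is a sign. The second equation evaluates
  the constant in the leading coordinate of \<open>aa\<close>.\<close>

lemma eta_eta: "\<eta> * \<eta> = 1" and eta_power: "(- 1) ^ n * inverse (q ^ (n * n)) = - \<eta>"
  using q_sign by (auto simp: \<eta>_def power_mult)

lemma eta_nz: "\<eta> \<noteq> 0" and eta_inverse: "inverse \<eta> = \<eta>"
  using eta_eta by (auto intro: inverse_unique)

lemma q_2n: "q powi (2 * (int n * k)) = 1"
  using q_order[of "int n * k"] by simp

lemma q_2n': "(q\<^sup>2) powi (int n * k) = 1" "r0 powi (int n * k) = 1" "inverse (q\<^sup>2) powi (int n * k) = 1"
proof -
  have "(q\<^sup>2) powi m = q powi (2 * m)" for m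
    using power_int_mult[of q 2 m] by simp
  then show "(q\<^sup>2) powi (int n * k) = 1"
    using q_2n[of k] by simp
  then show "r0 powi (int n * k) = 1" "inverse (q\<^sup>2) powi (int n * k) = 1"
    by (simp_all only: r0_def power_int_inverse inverse_1)
qed

definition Zp :: "int \<Rightarrow> 'a lau" where
  "Zp k = Xp (int n * k)"

lemma Zp_0 [simp]: "Zp 0 = 1" and Zp_add: "Zp (j + k) = Zp j * Zp k"
  by (simp_all add: Zp_def Xp_add distrib_left)

lemma Zp_inverse [simp]: "Zp k * Zp (- k) = 1" "Zp (- k) * Zp k = 1"
  by (simp_all flip: Zp_add)

lemma rfl_Zp: "rfl r0 (Zp k) = Zp (- k)" "rfl 1 (Zp k) = Zp (- k)"
  using nz by (simp_all add: Zp_def rfl_Xp r0 q_2n' Const_one)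

lemma act_2n: "act (2 * int n * m) f = f"
  using q_2n[of m] by (simp add: act_def scl_1 mult.assoc)

definition "beta = Zp 1 + Zp (- 1)"

lemma rfl_beta: "rfl r0 beta = beta" "rfl 1 beta = beta"
  by (simp_all add: beta_def rfl_simps r0 rfl_Zp add.commute)

text \<open>The Chebyshev values of the three traces, written through \<open>ncheb_inverse\<close>
  as power sums of a product and its inverse.\<close>

definition "aa = (T1 * T0v) ^ n + (T0v' * T1') ^ n"
definition "bb = (T1v * T1) ^ n + (T1' * T1v') ^ n"
definition "cc = (T0 * T1) ^ n + (T1' * T0') ^ n"

lemma bb_eq: "bb = lmul beta"
proof -
  have "T1' * T1v' = lmul (Xp (- 1))"
    by (simp add: T1v'_def T1_inv flip: mult.assoc)
  then show ?thesis
    by (simp add: bb_def T1v_T1 Xp_power beta_def Zp_def lmul_add flip: lmul_power)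
qed

lemma central_bb: "central bb"
  unfolding bb_eq by (rule central_lmul[OF rfl_beta])

lemma Himg_T0v': "T0v' \<in> Himg" and Himg_T1v': "T1v' \<in> Himg"
  by (simp_all add: T0v'_def T1v'_def Himg_mult Himg_sc Himg_T Himg_lmul)

lemma Himg_aa: "aa \<in> Himg" and Himg_cc: "cc \<in> Himg"
  by (simp_all add: aa_def cc_def Himg_add Himg_power Himg_mult Himg_T Himg_T' Himg_T0v')

lemma Himg_sc_commute: "x \<in> Himg \<Longrightarrow> x * sc c = sc c * x"
  by (simp add: central_commute[OF central_sc])

lemma traces_commute:
  assumes "x \<in> Himg"
  shows "(T0 + T0') * x = x * (T0 + T0')" "(T1 + T1') * x = x * (T1 + T1')"
    "(T0v + T0v') * x = x * (T0v + T0v')" "(T1v + T1v') * x = x * (T1v + T1v')"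
  using assms by (simp_all add: T0_trace T1_trace T0v_trace T1v_trace Himg_sc_commute)

lemma sc_power_sum:
  assumes "x \<in> Himg" "y \<in> Himg"
  shows "(sc (inverse q) * x) ^ n + (sc q * y) ^ n = sc \<eta> * (x ^ n + y ^ n)"
proof -
  have "(sc (inverse q) * x) ^ n = sc \<eta> * x ^ n" "(sc q * y) ^ n = sc \<eta> * y ^ n"
    using assms eta_inverse by (simp_all add: power_mult_commute Himg_sc_commute \<eta>_def power_inverse flip: RHO.sc_power)
  then show ?thesis by (simp add: distrib_left)
qed

lemma sc_eta_commute:
  assumes "x * (sc \<eta> * z) = sc \<eta> * z * x" "x \<in> Himg"
  shows "z * x = x * z"
proof -
  have ee: "sc \<eta> * (sc \<eta> * w) = w" for w
    by (simp add: eta_eta sc_one flip: sc_mult mult.assoc)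
  have "sc \<eta> * (x * z) = x * sc \<eta> * z"
    by (simp only: Himg_sc_commute[OF assms(2)] mult.assoc)
  also have "\<dots> = sc \<eta> * (z * x)"
    using assms(1) by (simp only: mult.assoc)
  finally have "sc \<eta> * (sc \<eta> * (x * z)) = sc \<eta> * (sc \<eta> * (z * x))" by simp
  then show ?thesis by (simp only: ee)
qed

lemma inverse_commute:
  fixes t :: "'a vec endo"
  assumes "t * t' = 1" "t' * t = 1" "z * t = t * z"
  shows "z * t' = t' * z"
proof -
  have "t' * (z * t) * t' = t' * (t * z) * t'" using assms(3) by simp
  then have "t' * z * (t * t') = (t' * t) * z * t'" by (simp only: mult.assoc)
  then show ?thesis by (simp add: assms)
qed

lemma inverse_scaled:
  assumes "m * m' = 1" "sc (inverse q) * m' * e = 1" "m \<in> Himg"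
  shows "e = sc q * m"
proof -
  have "sc q * m = sc q * m * (sc (inverse q) * m' * e)"
    by (simp only: assms mult_1_right)
  also have "\<dots> = sc q * (m * sc (inverse q)) * m' * e"
    by (simp only: mult.assoc)
  also have "m * sc (inverse q) = sc (inverse q) * m"
    by (simp only: Himg_sc_commute assms)
  also have "sc q * (sc (inverse q) * m) * m' * e = (sc q * sc (inverse q)) * (m * m') * e"
    by (simp only: mult.assoc)
  finally show ?thesis
    by (simp add: sc_q assms)
qed

text \<open>The defining product makes t0 t1v a scalar multiple of the inverse of t1 t0v. So
  \<open>aa\<close> is, up to the sign \<open>\<eta>\<close>, the same power sum in t0 and t1v, and
  it commutes with all four generators.\<close>

lemma product_T1_T0v: "T0 * T1v = sc (inverse q) * (T0v' * T1')" "T1v' * T0' = sc q * (T1 * T0v)"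
proof -
  have "T0v * (T0 * T1v) * T1 = sc (inverse q)"
    using daha_product by (simp add: mult.assoc)
  then have "T0v' * (T0v * (T0 * T1v) * T1) * T1' = T0v' * sc (inverse q) * T1'"
    by (simp add: mult.assoc)
  moreover have "T0v' * (T0v * (T0 * T1v) * T1) * T1' = (T0v' * T0v) * (T0 * T1v) * (T1 * T1')"
    by (simp only: mult.assoc)
  ultimately show 1: "T0 * T1v = sc (inverse q) * (T0v' * T1')"
    by (simp add: T0v_inv T1_inv Himg_sc_commute[OF Himg_T0v'] mult.assoc)
  have "(T0 * T1v) * (T1v' * T0') = 1"
    by (rule mult_inverses[OF T1v_inv(1) T0_inv(1)])
  then have 2: "sc (inverse q) * (T0v' * T1') * (T1v' * T0') = 1" unfolding 1 .
  show "T1v' * T0' = sc q * (T1 * T0v)"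
    by (rule inverse_scaled[OF mult_inverses[OF T0v_inv(1) T1_inv(1)] 2]) (simp add: Himg_mult Himg_T)
qed

lemma central_aa: "central aa"
proof (rule centralI[OF Himg_aa])
  note 1 = power_trace_commute[OF T1_inv T0v_inv traces_commute(2)[OF Himg_T(3)] traces_commute(3)[OF Himg_T(2)], of n, folded aa_def]
  have "(T0v' * T1') ^ n + (T1 * T0v) ^ n = aa" by (simp add: aa_def add.commute)
  then have "(T0 * T1v) ^ n + (T1v' * T0') ^ n = sc \<eta> * aa"
    unfolding product_T1_T0v by (simp add: sc_power_sum Himg_mult Himg_T Himg_T' Himg_T0v')
  with power_trace_commute[OF T0_inv T1v_inv traces_commute(1)[OF Himg_T(4)] traces_commute(4)[OF Himg_T(1)], of n]
  have "aa * T0 = T0 * aa" "aa * T1v = T1v * aa"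
    by (simp_all add: sc_eta_commute Himg_T)
  with 1 show "aa * letter_op g = letter_op g * aa" for g
    by (cases g) simp_all
qed

text \<open>The conjugate \<open>T1' * T1v * T1\<close> of \<open>T1v\<close> makes \<open>T0 * T1\<close> the inverse of a product of two generators, up to a scalar.\<close>

lemma central_cc: "central cc"
proof (rule centralI[OF Himg_cc])
  note 1 = power_trace_commute[OF T0_inv T1_inv traces_commute(1)[OF Himg_T(2)] traces_commute(2)[OF Himg_T(1)], of n, folded cc_def]
  define u where "u = T1' * T1v * T1"
  define u' where "u' = T1' * T1v' * T1"
  have u: "u * u' = 1" "u' * u = 1"
    using mult_inverses[OF T1_inv(1), of "T1' * T1v" "T1v' * T1"]
      mult_inverses[OF T1_inv(1), of "T1' * T1v'" "T1v * T1"]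
      mult_inverses[OF T1v_inv(1) T1_inv(2)] mult_inverses[OF T1v_inv(2) T1_inv(2)]
    by (simp_all add: u_def u'_def mult.assoc)
  have tr: "u + u' = sc c1v"
  proof -
    have "u + u' = T1' * (T1v + T1v') * T1" by (simp add: u_def u'_def algebra_simps)
    also have "\<dots> = sc c1v * (T1' * T1)"
      by (simp add: T1v_trace sc_T1' mult.assoc)
    finally show ?thesis by (simp add: T1_inv)
  qed
  have Hu: "u \<in> Himg" "u' \<in> Himg"
    by (simp_all add: u_def u'_def Himg_mult Himg_T Himg_T' Himg_T1v')
  have "T0v * (T0 * T1) * u = T0v * T0 * (T1 * T1') * T1v * T1"
    by (simp add: u_def mult.assoc)
  also have "\<dots> = sc (inverse q)"
    using daha_product by (simp add: T1_inv)
  finally have *: "T0v * (T0 * T1) * u = sc (inverse q)" .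
  have "T0 * T1 = (T0v' * T0v) * (T0 * T1) * (u * u')"
    by (simp add: T0v_inv u)
  also have "\<dots> = T0v' * (T0v * (T0 * T1) * u) * u'"
    by (simp only: mult.assoc)
  also have "\<dots> = sc (inverse q) * (T0v' * u')"
    unfolding * Himg_sc_commute[OF Himg_T0v'] by (simp only: mult.assoc)
  finally have 2: "T0 * T1 = sc (inverse q) * (T0v' * u')" .
  have "(T0 * T1) * (T1' * T0') = 1"
    by (rule mult_inverses[OF T1_inv(1) T0_inv(1)])
  then have "sc (inverse q) * (T0v' * u') * (T1' * T0') = 1" unfolding 2 .
  then have 3: "T1' * T0' = sc q * (u * T0v)"
    by (rule inverse_scaled[OF mult_inverses[OF T0v_inv(1) u(1)]]) (simp add: Himg_mult Himg_T Hu)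
  have comm: "(u + u') * T0v = T0v * (u + u')"
    by (simp add: tr sc_T0v)
  have cc: "cc = sc \<eta> * ((u * T0v) ^ n + (T0v' * u') ^ n)"
    unfolding cc_def 2 3 add.commute[of "(u * T0v) ^ n"]
    by (rule sc_power_sum) (simp_all add: Himg_mult Himg_T Himg_T0v' Hu)
  have T0v: "cc * T0v = T0v * cc"
    unfolding cc
    by (rule commute_mult[symmetric]) (simp_all only: sc_T0v power_trace_commute(2)[OF u T0v_inv comm traces_commute(3)[OF Hu(1)]])
  \<comment> \<open>The remaining generator is, up to a scalar, a product of inverses of the other
    three.\<close>
  have "T1v = sc (inverse q) * (T0' * T0v' * T1')"
  proof -
    have "T0' * (T0 * T1v) = T0' * (sc (inverse q) * (T0v' * T1'))"
      by (simp only: product_T1_T0v)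
    then have "(T0' * T0) * T1v = (T0' * sc (inverse q)) * (T0v' * T1')"
      by (simp only: mult.assoc)
    then show ?thesis
      by (simp add: T0_inv mult.assoc Himg_sc_commute[OF Himg_T'(1)])
  qed
  moreover have "cc * T0' = T0' * cc" "cc * T1' = T1' * cc" "cc * T0v' = T0v' * cc"
    using 1 T0v by (simp_all add: inverse_commute[OF T0_inv] inverse_commute[OF T1_inv] inverse_commute[OF T0v_inv])
  moreover have "cc * sc x = sc x * cc" for x
    by (rule Himg_sc_commute[OF Himg_cc])
  ultimately have "cc * T1v = T1v * cc"
    by (simp only: commute_mult)
  with 1 T0v show "cc * letter_op g = letter_op g * cc" for g
    by (cases g) simp_all
qed

section \<open>Leading coordinates of the central elements\<close>

lemma T0T1_power: "(T0 * T1) ^ m = W (2 * int m)"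
proof (induction m)
  case (Suc m)
  have "W (2 * int (Suc m)) = T0 * (T1 * W (2 * int m))"
    using alt_word_left[of "- 1 - 2 * int m" T0 T1] alt_word_right[of "2 * int m" T0 T1]
    by (simp add: algebra_simps)
  with Suc show ?case by (simp add: mult.assoc)
qed simp

text \<open>An inverse lengthens words like its generator but with a minus sign, and the signs
  cancel in pairs.\<close>

lemma T1'T0'_power:
  "supp (2 * int m) (app ((T1' * T0') ^ m) e0) \<and> app ((T1' * T0') ^ m) e0 (- (2 * int m)) = 1 \<and>
    (m > 0 \<longrightarrow> app ((T1' * T0') ^ m) e0 (2 * int m) = 0)"
proof (induction m)
  case 0
  then show ?case by (simp add: supp_unit_vec) (simp add: unit_vec_def)
next
  case (Suc m)
  let ?v = "app ((T1' * T0') ^ m) e0"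
  have v: "supp (2 * int m) ?v" "?v (- (2 * int m)) = 1" using Suc by auto
  have w: "supp (2 * int m + 1) (app T0' ?v)" "app T0' ?v (2 * int m + 1) = - 1"
    using T0'_supp[OF v(1)] v(2) by (simp_all add: rfl_simps r0)
  from T1'_supp[OF w(1)] w(2) show ?case
    by (simp add: rfl_simps algebra_simps)
qed

text \<open>The step from m to m + 1 multiplies by -q^-1 X and by the factor q^(-2m) that the
  translation puts on X^m; the exponents 1, 3, 5, ... add up to m^2.\<close>

lemma T1T0v_power:
  "supp (2 * int m) (app ((T1 * T0v) ^ m) e0) \<and>
    app ((T1 * T0v) ^ m) e0 (- (2 * int m)) = Const ((- 1) ^ m * inverse (q ^ (m * m))) * Xp (int m) \<and>
    (m > 0 \<longrightarrow> app ((T1 * T0v) ^ m) e0 (2 * int m) = 0)"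
proof (induction m)
  case 0
  then show ?case by (simp add: supp_unit_vec) (simp add: unit_vec_def Const_one)
next
  case (Suc m)
  let ?v = "app ((T1 * T0v) ^ m) e0" and ?k = "(- 1) ^ m * inverse (q ^ (m * m))"
  have v: "supp (2 * int m) ?v" "?v (- (2 * int m)) = Const ?k * Xp (int m)" using Suc by auto
  have w: "supp (2 * int m + 1) (app T0v ?v)"
    "app T0v ?v (2 * int m + 1) = Const (inverse q) * (Xp (- 1) * - rfl r0 (Const ?k * Xp (int m)))"
    using T0'_supp[OF v(1)] v(2) by (simp_all add: T0v_def sc_def supp_lmul app_lmul)
  have "rfl 1 (app T0v ?v (2 * int m + 1)) =
      Const (inverse q) * (Xp 1 * - (Const ?k * (Const (inverse (q\<^sup>2) powi int m) * Xp (int m))))"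
    using nz by (simp add: w(2) rfl_simps[OF r1] rfl_Xp rfl_rfl_scl scl_simps scl_Xp Const_one)
  also have "\<dots> = Const (inverse q * - (?k * inverse (q\<^sup>2) ^ m)) * (Xp 1 * Xp (int m))"
    by (simp add: Const_mult Const_uminus ac_simps)
  also have "inverse q * - (?k * inverse (q\<^sup>2) ^ m) = (- 1) ^ Suc m * inverse (q ^ (Suc m * Suc m))"
    using nz by (simp add: field_simps power_add flip: power_mult) (simp add: power_add power_mult power2_eq_square power_mult_distrib ac_simps)
  also have "Xp 1 * Xp (int m) = Xp (int (Suc m))"
    by (simp flip: Xp_add)
  finally show ?case
    using T1_supp[OF w(1)] by (simp add: algebra_simps)
qed

lemma T0v'T1'_power:
  "supp (2 * int m) (app ((T0v' * T1') ^ m) e0) \<and>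
    app ((T0v' * T1') ^ m) e0 (2 * int m) = Const ((- 1) ^ m * inverse (q ^ (m * m))) * Xp (- int m) \<and>
    (m > 0 \<longrightarrow> app ((T0v' * T1') ^ m) e0 (- (2 * int m)) = 0)"
proof (induction m)
  case 0
  then show ?case by (simp add: supp_unit_vec) (simp add: unit_vec_def Const_one)
next
  case (Suc m)
  let ?v = "app ((T0v' * T1') ^ m) e0" and ?k = "(- 1) ^ m * inverse (q ^ (m * m))"
  let ?w = "app (lmul (Xp 1)) (app T1' ?v)"
  have ap: "app ((T0v' * T1') ^ Suc m) e0 = app (lmul (Const q)) (app T0 ?w)"
    by (simp add: T0v'_def sc_def)
  have v: "supp (2 * int m) ?v" "?v (2 * int m) = Const ?k * Xp (- int m)" using Suc by auto
  have w: "supp (2 * int m + 1) ?w"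
    "?w (- (2 * int m + 1)) = Xp 1 * - rfl 1 (Const ?k * Xp (- int m))"
    using T1'_supp[OF v(1)] v(2) by (simp_all add: supp_lmul app_lmul)
  have u: "supp (2 * int m + 1 + 1) (app T0 ?w)"
    "app T0 ?w (2 * int m + 1 + 1) = rfl r0 (?w (- (2 * int m + 1)))"
    "app T0 ?w (- (2 * int m + 1 + 1)) = 0"
    by (rule T0_supp[OF w(1)]; simp)+
  have "Const q * rfl r0 (?w (- (2 * int m + 1))) =
      Const q * (Const r0 * Xp (- 1) * - (Const ?k * (Const (inverse (q\<^sup>2) ^ m) * Xp (- int m))))"
    using nz by (simp only: w(2) rfl_simps[OF r0] rfl_simps[OF r1] rfl_Xp[OF r0] rfl_Xp[OF r1] rfl_rfl_scl scl_simps scl_Xp)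
      (simp add: rfl_rfl_scl scl_simps scl_Xp rfl_simps[OF r0] rfl_Xp[OF r0] Const_one r0_def power_int_minus power_inverse)
  also have "\<dots> = Const (q * - (r0 * ?k * inverse (q\<^sup>2) ^ m)) * (Xp (- 1) * Xp (- int m))"
    by (simp add: Const_mult Const_uminus ac_simps power_int_minus power_inverse)
  also have "q * - (r0 * ?k * inverse (q\<^sup>2) ^ m) = (- 1) ^ Suc m * inverse (q ^ (Suc m * Suc m))"
    using nz by (simp add: r0_def field_simps power_add flip: power_mult) (simp add: power_add power_mult power2_eq_square power_mult_distrib ac_simps)
  also have "Xp (- 1) * Xp (- int m) = Xp (- int (Suc m))"
    by (simp flip: Xp_add)
  finally have e: "Const q * rfl r0 (?w (- (2 * int m + 1))) =
      Const ((- 1) ^ Suc m * inverse (q ^ (Suc m * Suc m))) * Xp (- int (Suc m))" .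
  have i: "2 * int m + 1 + 1 = 2 * int (Suc m)" by simp
  show ?case
    unfolding ap
  proof (intro conjI impI)
    show "supp (2 * int (Suc m)) (app (lmul (Const q)) (app T0 ?w))"
      using supp_lmul[OF u(1)] unfolding i .
    show "app (lmul (Const q)) (app T0 ?w) (2 * int (Suc m)) =
        Const ((- 1) ^ Suc m * inverse (q ^ (Suc m * Suc m))) * Xp (- int (Suc m))"
      using u(2) e unfolding i by (simp only: app_lmul)
    show "app (lmul (Const q)) (app T0 ?w) (- (2 * int (Suc m))) = 0"
      using u(3) unfolding i by (simp only: app_lmul mult_zero_right)
  qed
qed

text \<open>Only the positive end is recorded. For central elements the coordinate at the negative
  end follows from \<open>central_top\<close>.\<close>

definition htop :: "nat \<Rightarrow> 'a vec endo \<Rightarrow> 'a lau \<Rightarrow> bool" where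
  "htop r z f \<longleftrightarrow> z \<in> Himg \<and> supp (2 * int n * int r) (app z e0) \<and> app z e0 (2 * int n * int r) = f"

lemma htop_cc: "htop 1 cc 1" and cc_bot: "app cc e0 (- (2 * int n)) = 1"
  using T1'T0'_power[of n] n_pos W_e0[of "2 * int n"] Himg_cc[unfolded cc_def T0T1_power]
  by (simp_all add: htop_def cc_def T0T1_power supp_add supp_unit_vec, simp_all add: unit_vec_def)

lemma htop_aa: "htop 1 aa (Const (- \<eta>) * Zp (- 1))"
  and aa_bot: "app aa e0 (- (2 * int n)) = Const (- \<eta>) * Zp 1"
  using T1T0v_power[of n] T0v'T1'_power[of n] n_pos Himg_aa[unfolded aa_def]
  by (simp_all add: htop_def aa_def supp_add eta_power Zp_def)

text \<open>Words whose length is a multiple of 2n act trivially on Laurent polynomials, so the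
  twist in \<open>opr_top\<close> disappears and leading coordinates multiply.\<close>

lemma htop_mult:
  assumes "htop r z f" "htop r' z' f'"
  shows "htop (r + r') (z * z') (f * f')"
proof -
  let ?l = "2 * int n * int r" and ?k = "2 * int n * int r'"
  have z: "z = opr ?l (app z e0)" using assms(1) by (intro Himg_eq_opr) (auto simp: htop_def)
  have k: "supp ?k (app z' e0)" using assms(2) by (auto simp: htop_def)
  have e: "app (z * z') e0 = app (opr ?l (app z e0)) (app z' e0)"
    using z by simp
  have "supp (?l + ?k) (app (z * z') e0)"
    unfolding e by (rule opr_supp[OF k]) simp
  moreover have "app (opr ?l (app z e0)) (app z' e0) (?l + ?k) = app z e0 ?l * app z' e0 ?k"
  proof (cases "r = 0")
    case True
    then show ?thesis by (simp add: opr_def app_lmul)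
  next
    case False
    then have "?l > 0" using n_pos by simp
    from opr_top(1)[OF this _ k] show ?thesis
      using act_2n[of "int r"] by simp
  qed
  ultimately show ?thesis
    using assms Himg_mult[of z z'] unfolding htop_def e by (simp add: algebra_simps)
qed

lemma htop_lmul: "htop 0 (lmul f) f"
  by (simp add: htop_def Himg_lmul supp_lmul supp_unit_vec) (simp add: app_lmul unit_vec_def)

lemma htop_one: "htop 0 1 1"
  using htop_lmul[of 1] by (simp add: lmul_one)

lemma htop_power: "htop r z f \<Longrightarrow> htop (r * k) (z ^ k) (f ^ k)"
proof (induction k)
  case (Suc k)
  then show ?case using htop_mult[of r z f "r * k" "z ^ k" "f ^ k"] by (simp add: algebra_simps)
qed (simp add: htop_one)

lemma htop_add: "htop r z f \<Longrightarrow> htop r z' f' \<Longrightarrow> htop r (z + z') (f + f')"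
  by (auto simp: htop_def Himg_add supp_add)

lemma htop_lift: "htop r z f \<Longrightarrow> r < r' \<Longrightarrow> htop r' z 0"
  using n_pos by (auto simp: htop_def intro!: suppD[of "2 * int n * int r"] supp_mono[of "2 * int n * int r"])

lemma htop_sum:
  assumes "finite A" "\<And>x. x \<in> A \<Longrightarrow> htop r (z x) (f x)"
  shows "htop r (sum z A) (sum f A)"
  using assms
proof (induction A rule: finite_induct)
  case empty
  then show ?case
    using htop_lmul[of 0] htop_lift[of 0 "lmul 0" 0 r] by (cases "r = 0") (simp_all add: lmul_zero)
qed (simp add: htop_add)

section \<open>Generation of the center\<close>

lemma theta_invariant_keys:
  assumes "scl (q\<^sup>2) f = f" "m \<in> Poly_Mapping.keys f"
  shows "int n dvd m"
proof -
  have "q powi (2 * m) * Poly_Mapping.lookup f m = Poly_Mapping.lookup f m"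
    using assms(1) lookup_scl[of "q\<^sup>2" f m] nz power_int_mult[of q 2 m] by simp
  then show ?thesis
    using assms(2) q_order by (simp add: in_keys_iff)
qed

text \<open>The ring of invariant Laurent polynomials in \<open>Z = X\<^sup>n\<close> is free with basis \<open>1, Z\<^sup>-\<^sup>1\<close> over the
  subring generated by \<open>beta\<close>. The set \<open>B\<close> below is only required to contain that subring.\<close>

lemma theta_invariant_decomp:
  assumes inv: "scl (q\<^sup>2) f = f"
    and B: "beta \<in> B" "\<And>c. Const c \<in> B" "\<And>x y. x \<in> B \<Longrightarrow> y \<in> B \<Longrightarrow> x + y \<in> B"
      "\<And>x y. x \<in> B \<Longrightarrow> y \<in> B \<Longrightarrow> x * y \<in> B"
  shows "\<exists>g\<in>B. \<exists>h\<in>B. f = g + Zp (- 1) * h"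
proof -
  define D where "D = {g + Zp (- 1) * h | g h. g \<in> B \<and> h \<in> B}"
  have DI: "g \<in> B \<Longrightarrow> h \<in> B \<Longrightarrow> g + Zp (- 1) * h \<in> D" for g h
    unfolding D_def by blast
  have neg: "- x \<in> B" if "x \<in> B" for x
    using B(4)[OF B(2)[of "- 1"] that] by (simp add: Const_uminus Const_one)
  have zero: "0 \<in> B" using B(2)[of 0] by (simp add: Const_zero)
  have one: "1 \<in> B" using B(2)[of 1] by (simp add: Const_one)
  have add: "x + y \<in> D" if xy: "x \<in> D" "y \<in> D" for x y
  proof -
    from xy obtain g h g' h' where "x = g + Zp (- 1) * h" "y = g' + Zp (- 1) * h'" "g \<in> B" "h \<in> B" "g' \<in> B" "h' \<in> B"
      unfolding D_def by blast
    then show ?thesis using DI[OF B(3) B(3), of g g' h h'] by (simp add: algebra_simps)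
  qed
  have const: "Const c * x \<in> D" if x: "x \<in> D" for c x
  proof -
    from x obtain g h where "x = g + Zp (- 1) * h" "g \<in> B" "h \<in> B"
      unfolding D_def by blast
    then show ?thesis
      using DI[OF B(4) B(4), OF B(2) _ B(2), of g h c c] by (simp add: algebra_simps)
  qed
  have up: "Zp 1 * x \<in> D" if x: "x \<in> D" for x
  proof -
    from x obtain g h where x: "x = g + Zp (- 1) * h" "g \<in> B" "h \<in> B"
      unfolding D_def by blast
    have "Zp 1 * x = (beta * g + h) + Zp (- 1) * (- g)"
      by (simp add: x(1) beta_def algebra_simps flip: mult.assoc)
    then show ?thesis using DI[OF B(3)[OF B(4)[OF B(1) x(2)] x(3)] neg[OF x(2)]] by simp
  qed
  have down: "Zp (- 1) * x \<in> D" if x: "x \<in> D" for x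
  proof -
    from x obtain g h where x: "x = g + Zp (- 1) * h" "g \<in> B" "h \<in> B"
      unfolding D_def by blast
    have "(- h) + Zp (- 1) * (g + beta * h) = (- h) + Zp (- 1) * g + (Zp (- 1) * Zp 1) * h + Zp (- 1) * (Zp (- 1) * h)"
      by (simp only: beta_def distrib_left distrib_right mult.assoc add.assoc)
    also have "\<dots> = Zp (- 1) * x"
      by (simp add: x(1) distrib_left)
    finally show ?thesis using DI[OF neg[OF x(3)] B(3)[OF x(2) B(4)[OF B(1) x(3)]]] by simp
  qed
  have Zp: "Zp k \<in> D" for k
  proof (induction k rule: int_induct[where k = 0])
    case base
    then show ?case using DI[OF one zero] by simp
  next
    case (step1 k)
    then show ?case using up by (simp add: add.commute[of k] Zp_add)
  next
    case (step2 k)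
    then show ?case using down Zp_add[of "- 1" k] by simp
  qed
  have "(\<Sum>k\<in>K. Poly_Mapping.single k (Poly_Mapping.lookup f k)) \<in> D"
    if "finite K" "K \<subseteq> Poly_Mapping.keys f" for K
    using that
  proof (induction K rule: finite_induct)
    case empty
    then show ?case using DI[OF zero zero] by simp
  next
    case (insert m K)
    from insert.prems have "int n dvd m" using theta_invariant_keys[OF inv] by auto
    then obtain k where "m = int n * k" by (elim dvdE)
    then have "Poly_Mapping.single m c \<in> D" for c
      using const[OF Zp[of k], of c] by (simp add: single_eq_Const_Xp Zp_def)
    with insert show ?case by (simp add: add)
  qed
  from this[OF finite_keys order_refl] have "f \<in> D"
    by (simp flip: poly_mapping_sum_single)
  then show ?thesis unfolding D_def by blast
qed

text \<open>Subtracting the equation from its image under X -> 1 / X leaves (Z - Z^-1) h =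
  0.\<close>

lemma Zp_independent:
  assumes "rfl 1 g = g" "rfl 1 h = h" "g + Zp (- 1) * h = 0"
  shows "g = 0" "h = 0"
proof -
  have "rfl 1 (g + Zp (- 1) * h) = g + Zp 1 * h"
    by (simp add: rfl_simps assms(1,2) rfl_Zp)
  moreover have "rfl 1 (g + Zp (- 1) * h) = 0"
    by (simp only: assms(3)) (simp add: rfl_simps)
  ultimately have "g + Zp 1 * h = 0" by simp
  then have "g + Zp 1 * h - (g + Zp (- 1) * h) = 0"
    unfolding assms(3) by simp
  then have "(Zp 1 - Zp (- 1)) * h = 0"
    by (simp only: left_diff_distrib add_diff_cancel_left)
  moreover have "Poly_Mapping.lookup (Zp 1 - Zp (- 1)) (int n) \<noteq> (0::'a)"
    using n_pos by (simp add: Zp_def lookup_minus lookup_Xp)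
  then have "Zp 1 - Zp (- 1) \<noteq> 0" by auto
  ultimately show "h = 0" by simp
  with assms(3) show "g = 0" by simp
qed

text \<open>\<open>Z\<close> stands for the subalgebra generated by the three elements. An element
  of \<open>Z\<close> with the same leading coordinate is subtracted, which shortens a central
  element; strong induction on the length does the rest.\<close>

lemma center_spanned:
  assumes Z: "aa \<in> Z" "bb \<in> Z" "cc \<in> Z" "\<And>c. sc c \<in> Z"
    and cl: "\<And>x y. x \<in> Z \<Longrightarrow> y \<in> Z \<Longrightarrow> x + y \<in> Z" "\<And>x y. x \<in> Z \<Longrightarrow> y \<in> Z \<Longrightarrow> x * y \<in> Z"
    and cen: "\<And>x. x \<in> Z \<Longrightarrow> central x"
    and z: "central z"
  shows "z \<in> Z"
proof -
  have pow: "x \<in> Z \<Longrightarrow> x ^ k \<in> Z" for x k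
    using Z(4)[of 1] by (induction k) (simp_all add: sc_one cl)
  define B where "B = {g. lmul g \<in> Z \<and> rfl 1 g = g}"
  have B: "beta \<in> B" "Const c \<in> B" "x \<in> B \<Longrightarrow> y \<in> B \<Longrightarrow> x + y \<in> B" "x \<in> B \<Longrightarrow> y \<in> B \<Longrightarrow> x * y \<in> B" for c x y
    using Z cl by (auto simp: B_def rfl_beta rfl_simps lmul_add lmul_mult simp flip: bb_eq sc_def)
  have main: "\<forall>z. central z \<longrightarrow> supp (int l) (app z e0) \<longrightarrow> z \<in> Z" for l
  proof (induction l rule: less_induct)
    case (less l)
    show ?case
    proof (intro allI impI)
      fix z assume z: "central z" and l: "supp (int l) (app z e0)"
      note cz = central_Himg[OF z] central_commute[OF z Himg_T(1)] central_commute[OF z Himg_T(2)]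
      let ?f = "app z e0 (int l)"
      show "z \<in> Z"
      proof (cases "2 * int n dvd int l")
        case False
        then have "l > 0" by (cases l) auto
        with centralizer_X_top[OF cz(1) central_commute[OF z Himg_lmul] l _ False]
        have "supp (int (l - 1)) (app z e0)" by (simp add: of_nat_diff)
        with less.IH[of "l - 1"] z \<open>l > 0\<close> show ?thesis by simp
      next
        case True
        then obtain r' where "int l = 2 * int n * r'" by (elim dvdE)
        then have "0 \<le> 2 * int n * r'" by (metis of_nat_0_le_iff)
        then have "r' \<ge> 0" using n_pos by (simp add: zero_le_mult_iff)
        with \<open>int l = 2 * int n * r'\<close> obtain r where r: "int l = 2 * int n * int r"
          by (metis nonneg_int_cases)
        have "even (int l)" using r by simp
        note top = central_top[OF cz(1,2,3) l _ this]
        obtain g h where gh: "g \<in> B" "h \<in> B" "?f = g + Zp (- 1) * h"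
          using theta_invariant_decomp[OF top(2) B(1-4)] by auto
        show ?thesis
        proof (cases "r = 0")
          case True
          then have l0: "l = 0" using r by simp
          then have zf: "z = lmul ?f"
            using Himg_eq_opr[OF cz(1) l] by (simp add: opr_def)
          \<comment> \<open>In length 0 the coordinate itself is symmetric, so independence of 1 and
            Z^-1 leaves only \<open>g\<close>.\<close>
          have "rfl 1 ?f = ?f" using top(1) l0 by simp
          then have "rfl 1 (?f - g) = ?f - g" using gh by (simp add: rfl_simps B_def)
          moreover have "rfl 1 (- h) = - h" using gh by (simp add: rfl_simps B_def)
          moreover have "?f - g + Zp (- 1) * (- h) = 0" using gh by simp
          ultimately have "?f - g = 0" by (rule Zp_independent)
          then have "?f = g" by simp
          with zf gh(1) show ?thesis by (simp add: B_def)
        next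
          case False
          then obtain r' where r': "r = Suc r'" by (cases r) auto
          \<comment> \<open>The factor \<open>- \<eta>\<close> cancels the one in the leading
            coordinate of \<open>aa\<close>, since \<open>\<eta>\<close> squares to 1.\<close>
          define y where "y = lmul g * cc ^ r + lmul (Const (- \<eta>) * h) * (aa * cc ^ r')"
          have yZ: "y \<in> Z"
            using gh B(2)[of "- \<eta>"] B(4) Z(1,3) by (auto simp: y_def B_def intro!: cl pow)
          have "htop r y (g * 1 + Const (- \<eta>) * h * (Const (- \<eta>) * Zp (- 1) * 1))"
            unfolding y_def using htop_mult[OF htop_lmul htop_power[OF htop_cc, of r]]
              htop_mult[OF htop_lmul htop_mult[OF htop_aa htop_power[OF htop_cc, of r']]] r'
            by (intro htop_add) simp_all
          also have "g * 1 + Const (- \<eta>) * h * (Const (- \<eta>) * Zp (- 1) * 1) = g + Const (\<eta> * \<eta>) * (Zp (- 1) * h)"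
            by (simp add: Const_mult Const_uminus ac_simps)
          also have "\<dots> = ?f" by (simp add: eta_eta Const_one gh)
          finally have y: "htop r y ?f" .
          have "central (z - y)" by (intro central_diff z cen yZ)
          moreover have s: "supp (int l) (app (z - y) e0)"
            using l y by (simp add: htop_def r supp_diff)
          moreover have t: "app (z - y) e0 (int l) = 0" using y by (simp add: htop_def r)
          moreover have "app (z - y) e0 (- int l) = 0"
          proof -
            note c = central_diff[OF z cen[OF yZ]]
            from central_top(1)[OF central_Himg[OF c] central_commute[OF c Himg_T(1)] central_commute[OF c Himg_T(2)] s]
            have "app (z - y) e0 (- int l) = rfl 1 (app (z - y) e0 (int l))" using \<open>even (int l)\<close> by simp
            then show ?thesis unfolding t by (simp add: rfl_simps)
          qed
          ultimately have "supp (int l - 1) (app (z - y) e0)" by (intro supp_shrink)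
          moreover have "l > 0" using r r' n_pos by (cases l) auto
          ultimately have "supp (int (l - 1)) (app (z - y) e0)" by (simp add: of_nat_diff)
          with less.IH[of "l - 1"] \<open>central (z - y)\<close> \<open>l > 0\<close> have "z - y \<in> Z" by simp
          then show ?thesis using cl(1)[OF _ yZ] by fastforce
        qed
      qed
    qed
  qed
  obtain l where "l \<ge> 0" "supp l (app z e0)" using Himg_supp[OF central_Himg[OF z]] by auto
  then show ?thesis using main[of "nat l"] z by simp
qed

text \<open>As a Laurent polynomial in Z, the power is monic of degree j. The last branch makes no
  claim about lower coefficients.\<close>

lemma lookup_beta_power:
  "Poly_Mapping.lookup (beta ^ j) (int n * m) = (if m = int j then 1 else if m > int j then 0 else Poly_Mapping.lookup (beta ^ j) (int n * m))"
proof -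
  have sh: "Poly_Mapping.lookup (Zp k * f) (int n * m) = Poly_Mapping.lookup f (int n * (m - k))" for k m and f :: "'a lau"
  proof (induction f rule: lau_induct)
    case (add m' c f)
    have "Zp k * (Const c * Xp m' + f) = Const c * Xp (m' + int n * k) + Zp k * f"
      by (simp add: Zp_def Xp_add algebra_simps)
    with add show ?case
      by (auto simp: lookup_add lookup_Const_mult lookup_Xp right_diff_distrib)
  qed simp
  have "m \<ge> int j \<Longrightarrow> Poly_Mapping.lookup (beta ^ j) (int n * m) = (if m = int j then 1 else 0)" for m
  proof (induction j arbitrary: m)
    case 0
    then show ?case using n_pos by (simp add: lookup_one when_def)
  next
    case (Suc j)
    have "beta ^ Suc j = Zp 1 * beta ^ j + Zp (- 1) * beta ^ j"
      by (simp add: beta_def distrib_right)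
    with Suc show ?case by (simp add: lookup_add sh del: power_Suc)
  qed
  then show ?thesis by auto
qed

lemma beta_independent:
  assumes "finite J" "(\<Sum>j\<in>J. Const (c j) * beta ^ j) = 0"
  shows "\<forall>j\<in>J. c j = 0"
proof (rule ccontr)
  assume "\<not> ?thesis"
  then have ne: "{j \<in> J. c j \<noteq> 0} \<noteq> {}" by auto
  define M where "M = Max {j \<in> J. c j \<noteq> 0}"
  have M: "M \<in> J" "c M \<noteq> 0" "\<And>j. j \<in> J \<Longrightarrow> c j \<noteq> 0 \<Longrightarrow> j \<le> M"
    using Max_in[OF _ ne] assms(1) by (auto simp: M_def)
  have "0 = Poly_Mapping.lookup (\<Sum>j\<in>J. Const (c j) * beta ^ j) (int n * int M)"
    by (simp add: assms(2))
  also have "\<dots> = (\<Sum>j\<in>J. if j = M then c M else 0)"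
    unfolding lookup_sum
  proof (rule sum.cong)
    fix j assume j: "j \<in> J"
    show "Poly_Mapping.lookup (Const (c j) * beta ^ j) (int n * int M) = (if j = M then c M else 0)"
      using M(3)[OF j] lookup_beta_power[of j "int M"] by (cases "c j = 0") (auto simp: lookup_Const_mult Const_zero split: if_splits)
  qed simp
  also have "\<dots> = c M" using M(1) assms(1) by simp
  finally show False using M(2) by simp
qed

end

section \<open>Eigenvectors\<close>

context reflection_op
begin

text \<open>At an index with \<open>up j\<close> the equation (T + h) v = 0 determines the value of
  v at \<open>p j\<close> from its value at j; this is that recursion.\<close>

definition step :: "'a lau \<Rightarrow> 'a lau endo" where
  "step h = Abs_endo (\<lambda>x. s (\<gamma> * dem r x + h * x))"

lemma app_step: "app (step h) x = s (\<gamma> * dem r x + h * x)"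
  unfolding step_def
  by (subst Abs_endo_inverse) (simp_all add: dem_add[OF r] rfl_simps[OF r] algebra_simps)

lemma app_T_step:
  assumes "up j" "v (p j) = app (step h) (v j)"
  shows "app (T + lmul h) v j = 0"
  using assms by (simp add: app_T app_lmul app_step rfl_rfl[OF r])

lemma app_S:
  assumes "app T v = app (lmul h) v"
  shows "app S v = app (lmul (root_diff r * h - \<gamma>)) v"
  by (rule ext) (simp add: S_def assms app_lmul algebra_simps)

end

context daha_params
begin

text \<open>Each nonempty word has one first letter, so the two recursions define \<open>v\<close>
  on all words without conflict and give each equation on half of the indices. The factorised
  quadratic relation annihilates the defect, which \<open>half_coordinates\<close> then forces to
  vanish.\<close>

lemma eigenvector:
  assumes h0: "(T0 + lmul h0') * lmul u0 * (T0 + lmul h0) = 0" "u0 \<noteq> 0"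
    and h1: "(T1 + lmul h1') * lmul u1 * (T1 + lmul h1) = 0" "u1 \<noteq> 0"
  obtains v where "v 0 = 1" "app T0 v = app (lmul (- h0)) v" "app T1 v = app (lmul (- h1)) v"
proof
  define v where "v j = app (alt_word (R0.step h0) (R1.step h1) j) 1" for j
  show "v 0 = 1" by (simp add: v_def)
  have "app (T0 + lmul h0) v j = 0" if "j \<le> 0" for j
    unfolding T0_def by (rule R0.app_T_step) (use that in \<open>simp_all add: v_def alt_word_left\<close>)
  then have "app (T0 + lmul h0) v = 0"
    using arg_cong[OF h0(1), of "\<lambda>z. app z v"]
    by (intro R0.half_coordinates[OF _ _ h0(2), of _ h0']) (simp_all add: T0_def[symmetric])
  then show "app T0 v = app (lmul (- h0)) v"
    by (simp add: lmul_uminus eq_neg_iff_add_eq_0)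
  have "app (T1 + lmul h1) v j = 0" if "j \<ge> 0" for j
    unfolding T1_def by (rule R1.app_T_step) (use that in \<open>simp_all add: v_def alt_word_right\<close>)
  then have "app (T1 + lmul h1) v = 0"
    using arg_cong[OF h1(1), of "\<lambda>z. app z v"]
    by (intro R1.half_coordinates[OF _ _ h1(2), of _ h1']) (simp_all add: T1_def[symmetric])
  then show "app T1 v = app (lmul (- h1)) v"
    by (simp add: lmul_uminus eq_neg_iff_add_eq_0)
qed

lemma T0_factor: "(T0 + lmul (- Const (inverse k0))) * lmul 1 * (T0 + lmul (- Const k0)) = 0"
  and T1_factor: "(T1 + lmul (- Const (inverse k1))) * lmul 1 * (T1 + lmul (- Const k1)) = 0"
  using quadratic_factor[OF T0_inv(1), of "inverse k0"] quadratic_factor[OF T1_inv(1), of "inverse k1"]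
  by (simp_all add: lmul_uminus lmul_one nz T0_trace T1_trace c0_def c1_def add.commute sc_T0 sc_T1 flip: sc_def)

text \<open>Since t0^-1 = q X t0v, an eigenvector of t0v solves an equation for t0 with a Laurent
  polynomial coefficient, the form that \<open>eigenvector\<close> expects.\<close>

lemma T0_eq_T0v: "T0 + lmul (Const (q * k) * Xp 1 - Const c0) = lmul (- (Const q * Xp 1)) * (T0v - sc k)"
proof -
  have 1: "lmul (Const q * Xp 1) * T0v = T0'"
  proof -
    have "lmul (Const q * Xp 1) * T0v = lmul (Const q * Xp 1 * Const (inverse q) * Xp (- 1)) * T0'"
      by (simp add: T0v_def sc_def lmul_lmul mult.assoc flip: lmul_mult)
    also have "Const q * Xp 1 * Const (inverse q) * Xp (- 1) = (Const q * Const (inverse q)) * (Xp 1 * Xp (- 1))"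
      by (simp only: ac_simps)
    finally show ?thesis using nz by (simp add: lmul_one Const_one flip: Const_mult)
  qed
  have 2: "lmul (Const q * Xp 1) * sc k = lmul (Const (q * k) * Xp 1)"
    by (simp add: sc_def Const_mult ac_simps flip: lmul_mult)
  have "lmul (- (Const q * Xp 1)) * (T0v - sc k) = lmul (Const q * Xp 1) * sc k - lmul (Const q * Xp 1) * T0v"
    by (simp add: lmul_uminus right_diff_distrib)
  then show ?thesis
    unfolding 1 2 by (simp add: T0'_def sc_def lmul_diff)
qed

text \<open>The quadratic relation of t0v. The middle factor X^-1 meets the -q X of
  \<open>T0_eq_T0v\<close> and leaves a scalar, which can be moved out.\<close>

lemma T0v_factor:
  "(T0 + lmul (Const (q * inverse k0v) * Xp 1 - Const c0)) * lmul (Xp (- 1)) * (T0 + lmul (Const (q * k0v) * Xp 1 - Const c0)) = 0"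
proof -
  have c: "T0v * sc q = sc q * T0v" "sc k * sc q = sc q * sc k" for k
    by (rule sc_T0v sc_sc)+
  have e: "lmul (Xp (- 1)) * lmul (- (Const q * Xp 1)) = - sc q"
  proof -
    have "lmul (Xp (- 1)) * lmul (- (Const q * Xp 1)) = lmul (- (Const q * (Xp (- 1) * Xp 1)))"
      by (simp only: lmul_mult[symmetric] mult_minus_right mult.left_commute)
    then show ?thesis by (simp add: sc_def lmul_uminus)
  qed
  have "(T0 + lmul (Const (q * inverse k0v) * Xp 1 - Const c0)) * lmul (Xp (- 1)) * (T0 + lmul (Const (q * k0v) * Xp 1 - Const c0))
     = lmul (- (Const q * Xp 1)) * ((T0v - sc (inverse k0v)) * (lmul (Xp (- 1)) * lmul (- (Const q * Xp 1)))) * (T0v - sc k0v)"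
    by (simp only: T0_eq_T0v mult.assoc)
  also have "\<dots> = lmul (- (Const q * Xp 1)) * (- sc q * ((T0v - sc (inverse k0v)) * (T0v - sc k0v)))"
    unfolding e by (simp add: left_diff_distrib right_diff_distrib c mult.assoc)
  also have "(T0v - sc (inverse k0v)) * (T0v - sc k0v) = 0"
    using quadratic_factor[OF T0v_inv(1), of "inverse k0v"]
    by (simp add: nz T0v_trace c0v_def add.commute sc_T0v)
  finally show ?thesis by simp
qed

lemma app_sc_sc: "app (sc a) (app (sc b) v) = app (sc (a * b)) v"
  by (simp add: sc_mult)

lemma eigen_power:
  assumes "app x v = app (sc c) v" "\<And>c. x * sc c = sc c * x"
  shows "app (x ^ m) v = app (sc (c ^ m)) v"
proof (induction m)
  case (Suc m)
  have "app (x ^ Suc m) v = app (x * sc (c ^ m)) v"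
    using Suc by simp
  also have "\<dots> = app (sc (c ^ m)) (app x v)"
    by (simp add: assms(2))
  finally show ?case by (simp only: assms(1) app_sc_sc power_Suc2)
qed (simp add: sc_one)

lemma eigen_inverse:
  assumes "app x v = app (sc c) v" "y * x = 1" "c \<noteq> 0" "y * sc c = sc c * y"
  shows "app y v = app (sc (inverse c)) v"
proof -
  have "app (sc c) (app y v) = app (y * x) v"
    using assms(1,4) by (metis app_simps(6))
  then have "app (sc (inverse c)) (app (sc c) (app y v)) = app (sc (inverse c)) v"
    by (simp add: assms(2))
  then show ?thesis using assms(3) by (simp add: sc_one app_sc_sc)
qed

lemma eigen_mult:
  assumes "app x v = app (sc c) v" "app y v = app (sc c') v" "x * sc c' = sc c' * x"
  shows "app (x * y) v = app (sc (c * c')) v"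
proof -
  have "app (x * y) v = app (x * sc c') v" using assms(2) by simp
  then show ?thesis by (simp only: assms(1,3) app_simps(6) app_sc_sc mult.commute[of c'])
qed

end

section \<open>The relation\<close>

context daha_root
begin

text \<open>The cocycle of a translation: if x f = scl zeta (f) x, and x multiplies a vector by
  omega, then x^m multiplies it by this product.\<close>

definition op :: "'a \<Rightarrow> 'a lau \<Rightarrow> nat \<Rightarrow> 'a lau" where
  "op \<zeta> \<omega> m = (\<Prod>i<m. scl (\<zeta> ^ i) \<omega>)"

lemma op_0: "op \<zeta> \<omega> 0 = 1"
  by (simp add: op_def)

lemma op_Suc: "\<zeta> \<noteq> 0 \<Longrightarrow> op \<zeta> \<omega> (Suc m) = \<omega> * scl \<zeta> (op \<zeta> \<omega> m)"
proof -
  assume z: "\<zeta> \<noteq> 0"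
  have "scl \<zeta> (\<Prod>i<m. scl (\<zeta> ^ i) \<omega>) = (\<Prod>i<m. scl (\<zeta> ^ Suc i) \<omega>)"
    by (induction m) (use z in \<open>simp_all add: scl_simps scl_scl\<close>)
  then show ?thesis
    by (simp add: op_def prod.lessThan_Suc_shift scl_1 del: prod.lessThan_Suc)
qed

lemma op_mult: "\<zeta> \<noteq> 0 \<Longrightarrow> op \<zeta> (\<omega> * \<omega>') m = op \<zeta> \<omega> m * op \<zeta> \<omega>' m"
  by (simp add: op_def scl_simps prod.distrib)

abbreviation "\<zeta>1 \<equiv> q\<^sup>2"
abbreviation "\<zeta>2 \<equiv> inverse (q\<^sup>2)"

lemma zeta_nz: "\<zeta>1 \<noteq> 0" "\<zeta>2 \<noteq> 0"
  using nz by simp_all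

lemma zeta_primitive:
  assumes "\<zeta> \<in> {\<zeta>1, \<zeta>2}"
  shows "\<zeta> ^ n = 1" "\<And>m. 0 < m \<Longrightarrow> m < n \<Longrightarrow> \<zeta> ^ m \<noteq> 1"
proof -
  have *: "(q\<^sup>2) ^ m = 1 \<longleftrightarrow> n dvd m" for m
    using q_order[of "int m"] power_int_mult[of q 2 "int m"] by (simp add: power_int_mult)
  then have "(inverse (q\<^sup>2)) ^ m = 1 \<longleftrightarrow> n dvd m" for m
    by (simp only: power_inverse inverse_eq_1_iff)
  with * assms have "\<zeta> ^ m = 1 \<longleftrightarrow> n dvd m" for m by blast
  then show "\<zeta> ^ n = 1" and "\<And>m. 0 < m \<Longrightarrow> m < n \<Longrightarrow> \<zeta> ^ m \<noteq> 1"
    by (simp_all add: nat_dvd_not_less)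
qed

lemma op_linear:
  assumes "\<zeta> \<in> {\<zeta>1, \<zeta>2}"
  shows "op \<zeta> (1 - Const \<rho> * Xp 1) n = 1 - Const (\<rho> ^ n) * Zp 1"
proof -
  have z: "\<zeta> ^ i \<noteq> 0" for i using assms zeta_nz by auto
  have "op \<zeta> (1 - Const \<rho> * Xp 1) n = (\<Prod>i<n. 1 - Const (\<zeta> ^ i) * (Const \<rho> * Xp 1))"
    unfolding op_def by (rule prod.cong) (simp_all add: scl_simps[OF z] scl_Xp[OF z] ac_simps)
  also have "\<dots> = 1 - (Const \<rho> * Xp 1) ^ n"
    by (rule prod_one_minus_root_power[OF zeta_primitive[OF assms] n_pos])
  also have "(Const \<rho> * Xp 1) ^ n = Const (\<rho> ^ n) * Zp 1"
  proof -
    have "Const \<rho> ^ m = (Const (\<rho> ^ m) :: 'a lau)" for m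
      by (induction m) (simp_all add: Const_one Const_mult)
    then show ?thesis by (simp add: power_mult_distrib Xp_power Zp_def)
  qed
  finally show ?thesis .
qed

lemma op_Const: "\<zeta> \<noteq> 0 \<Longrightarrow> op \<zeta> (Const \<kappa>) m = Const (\<kappa> ^ m)"
  by (induction m) (simp_all add: op_0 op_Suc Const_one scl_simps Const_mult)

lemma prod_power_triangular: "(\<Prod>i<Suc m. (x ^ i) ^ 2) = (x ^ Suc m) ^ m" for x :: 'a
proof (induction m)
  case (Suc m)
  have "(\<Prod>i<Suc (Suc m). (x ^ i) ^ 2) = (x ^ Suc m) ^ m * (x ^ Suc m) ^ 2"
    using Suc by simp
  also have "\<dots> = (x ^ Suc (Suc m)) ^ Suc m"
  proof -
    have "Suc m * m + Suc m * 2 = Suc (Suc m) * Suc m" by simp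
    then show ?thesis by (simp only: power_mult[symmetric] power_add[symmetric])
  qed
  finally show ?case .
qed simp

text \<open>This is q^(n(n-1)), the product of the first n powers of q^2; it is the constant that X
  contributes to an orbit product.\<close>

definition "\<tau> = \<eta> ^ (n - 1)"

lemma tau_tau: "\<tau> * \<tau> = 1"
  by (simp add: \<tau>_def eta_eta flip: power_mult_distrib)

lemma op_Xp:
  assumes "\<zeta> \<in> {\<zeta>1, \<zeta>2}"
  shows "op \<zeta> (Xp 1) n = Const \<tau> * Zp 1" "op \<zeta> (Xp (- 1)) n = Const \<tau> * Zp (- 1)"
proof -
  have z: "\<zeta> \<noteq> 0" using assms zeta_nz by auto
  obtain m where m: "n = Suc m" using n_pos by (cases n) auto
  have "(\<Prod>i<n. (q\<^sup>2) ^ i) = (\<Prod>i<n. (q ^ i) ^ 2)"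
    by (simp add: mult.commute flip: power_mult)
  also have "\<dots> = (q ^ n) ^ (n - 1)"
    using prod_power_triangular[of q m] by (simp only: m diff_Suc_1)
  also have "\<dots> = \<tau>"
    by (simp only: \<tau>_def \<eta>_def)
  finally have t1: "(\<Prod>i<n. \<zeta>1 ^ i) = \<tau>" .
  have "(\<Prod>i<n. \<zeta>2 ^ i) = inverse (\<Prod>i<n. \<zeta>1 ^ i)"
    using prod_inversef[of "\<lambda>i. \<zeta>1 ^ i" "{..<n}"] by (simp add: o_def power_inverse)
  then have t2: "(\<Prod>i<n. \<zeta>2 ^ i) = \<tau>"
    unfolding t1 using inverse_unique[OF tau_tau] by simp
  have prodC: "(\<Prod>i<n. Const (f i) :: 'a lau) = Const (\<Prod>i<n. f i)" for f and n :: nat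
    by (induction n) (simp_all add: Const_one Const_mult)
  have "op \<zeta> (Xp e) n = (\<Prod>i<n. Const ((\<zeta> ^ i) powi e) * Xp e)" for e
    unfolding op_def by (rule prod.cong) (use z in \<open>simp_all add: scl_Xp\<close>)
  then have e: "op \<zeta> (Xp e) n = Const (\<Prod>i<n. (\<zeta> ^ i) powi e) * Zp e" for e
    by (simp add: prod.distrib Xp_power Zp_def prodC mult.commute)
  have t: "(\<Prod>i<n. \<zeta> ^ i) = \<tau>" using assms t1 t2 by auto
  then have "(\<Prod>i<n. inverse (\<zeta> ^ i)) = \<tau>"
    using inverse_unique[OF tau_tau] by (simp add: prod_inversef[unfolded o_def])
  with t show "op \<zeta> (Xp 1) n = Const \<tau> * Zp 1" "op \<zeta> (Xp (- 1)) n = Const \<tau> * Zp (- 1)"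
    unfolding e by (simp_all add: power_int_minus)
qed

lemma Const_Const: "Const a * (Const b * f) = Const (a * b) * f" for f :: "'a lau"
  by (simp add: Const_mult mult.assoc)

text \<open>The trinomial is kappa X^-1 (1 - x y X) (1 - x y^-1 X). Orbit products replace X by Z
  and each parameter by its n-th power, up to \<open>\<tau>\<close>, so the shape is
  preserved.\<close>

lemma trinomial_op:
  assumes "\<zeta> \<in> {\<zeta>1, \<zeta>2}" "y \<noteq> 0"
    and "\<omega> = Const \<kappa> * Xp (- 1) - Const (\<kappa> * (x * (y + inverse y))) + Const (\<kappa> * (x * x)) * Xp 1"
  shows "op \<zeta> \<omega> n = Const \<tau> * (Const (\<kappa> ^ n) * Zp (- 1) - Const (\<kappa> ^ n * (x ^ n * (y ^ n + inverse (y ^ n))))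
      + Const (\<kappa> ^ n * (x ^ n * x ^ n)) * Zp 1)"
proof -
  have z: "\<zeta> \<noteq> 0" using assms zeta_nz by auto
  have tri: "Const k * W' * (1 - Const (a * b) * W) * (1 - Const (a * inverse b) * W) =
      Const k * W' - Const (k * (a * (b + inverse b))) + Const (k * (a * a)) * W"
    if "W' * W = 1" "b \<noteq> 0" for W W' :: "'a lau" and k a b :: 'a
  proof -
    have "Const k * W' * (1 - Const (a * b) * W) * (1 - Const (a * inverse b) * W) =
        Const k * W' - Const k * (Const (a * b) + Const (a * inverse b)) * (W' * W)
        + Const k * (Const (a * b) * Const (a * inverse b)) * ((W' * W) * W)"
      by (simp add: algebra_simps)
    also have "Const (a * b) * Const (a * inverse b) = (Const (a * a) :: 'a lau)"
      using that(2) by (simp add: field_simps flip: Const_mult)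
    also have "Const k * (Const (a * b) + Const (a * inverse b)) = (Const (k * (a * (b + inverse b))) :: 'a lau)"
      by (simp only: distrib_left Const_add Const_mult)
    finally show ?thesis using that(1) by (simp add: Const_mult)
  qed
  have "\<omega> = Const \<kappa> * Xp (- 1) * (1 - Const (x * y) * Xp 1) * (1 - Const (x * inverse y) * Xp 1)"
    unfolding assms(3) by (rule tri[symmetric]) (use assms(2) in simp_all)
  then have "op \<zeta> \<omega> n = Const (\<kappa> ^ n) * (Const \<tau> * Zp (- 1)) * (1 - Const ((x * y) ^ n) * Zp 1) * (1 - Const ((x * inverse y) ^ n) * Zp 1)"
    by (simp only: op_mult[OF z] op_Const[OF z] op_Xp[OF assms(1)] op_linear[OF assms(1)])
  also have "\<dots> = Const \<tau> * (Const (\<kappa> ^ n) * Zp (- 1) * (1 - Const (x ^ n * y ^ n) * Zp 1) * (1 - Const (x ^ n * inverse (y ^ n)) * Zp 1))"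
    by (simp only: power_mult_distrib power_inverse ac_simps)
  also have "\<dots> = Const \<tau> * (Const (\<kappa> ^ n) * Zp (- 1) - Const (\<kappa> ^ n * (x ^ n * (y ^ n + inverse (y ^ n))))
      + Const (\<kappa> ^ n * (x ^ n * x ^ n)) * Zp 1)"
    by (subst tri) (use assms(2) in simp_all)
  finally show ?thesis .
qed

section \<open>Powers of the intertwiners\<close>

lemma S_lmul: "S0 * lmul f = lmul (rfl r0 f) * S0" "S1 * lmul f = lmul (rfl 1 f) * S1"
  by (simp_all add: S0_def S1_def R0.S_lmul R1.S_lmul)

lemma S0S1_lmul: "S0 * S1 * lmul f = lmul (scl \<zeta>1 f) * (S0 * S1)"
proof -
  have "S0 * S1 * lmul f = S0 * (S1 * lmul f)"
    by (simp only: mult.assoc)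
  also have "\<dots> = S0 * lmul (rfl 1 f) * S1"
    by (simp only: S_lmul(2) mult.assoc)
  also have "\<dots> = lmul (rfl r0 (rfl 1 f)) * S0 * S1"
    by (simp only: S_lmul(1))
  finally show ?thesis
    by (simp only: rfl_rfl_scl mult.assoc)
qed

lemma S1S0_lmul: "S1 * S0 * lmul f = lmul (scl \<zeta>2 f) * (S1 * S0)"
proof -
  have "S1 * S0 * lmul f = S1 * (S0 * lmul f)"
    by (simp only: mult.assoc)
  also have "\<dots> = S1 * lmul (rfl r0 f) * S0"
    by (simp only: S_lmul(1) mult.assoc)
  also have "\<dots> = lmul (rfl 1 (rfl r0 f)) * S1 * S0"
    by (simp only: S_lmul(2))
  finally show ?thesis
    by (simp only: rfl_rfl_scl mult.assoc)
qed

definition "P = (S0 * S1) ^ n"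
definition "Q = (S1 * S0) ^ n"

lemma S_Himg: "S0 \<in> Himg" "S1 \<in> Himg"
  by (simp_all add: S0_def S1_def R0.S_def R1.S_def Himg_diff Himg_mult Himg_lmul Himg_T flip: T0_def T1_def)

lemma PQ_Himg: "P \<in> Himg" "Q \<in> Himg"
  by (simp_all add: P_def Q_def Himg_power Himg_mult S_Himg)

lemma PQ_lmul: "P * lmul f = lmul f * P" "Q * lmul f = lmul f * Q"
proof -
  have "x ^ m * lmul f = lmul (scl (\<zeta> ^ m) f) * x ^ m"
    if x: "\<And>f. x * lmul f = lmul (scl \<zeta> f) * x" and z: "\<zeta> \<noteq> 0" for x \<zeta> m
  proof (induction m)
    case (Suc m)
    have "x ^ Suc m * lmul f = x * (lmul (scl (\<zeta> ^ m) f) * x ^ m)"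
      by (simp only: power_Suc mult.assoc Suc)
    also have "\<dots> = x * lmul (scl (\<zeta> ^ m) f) * x ^ m"
      by (simp only: mult.assoc)
    finally show ?case using z by (simp add: x scl_scl mult.assoc)
  qed (simp add: scl_1)
  from this[OF S0S1_lmul zeta_nz(1), of n] this[OF S1S0_lmul zeta_nz(2), of n]
  show "P * lmul f = lmul f * P" "Q * lmul f = lmul f * Q"
    using zeta_primitive(1)[of \<zeta>1] zeta_primitive(1)[of \<zeta>2] by (simp_all add: P_def Q_def scl_1)
qed

text \<open>The product collapses from the middle because the square of each intertwiner is a
  Laurent polynomial. Only existence is needed here; an eigenvector supplies the value
  later.\<close>

lemma PQ_lau: "\<exists>N. P * Q = lmul N"
proof -
  have "\<exists>N. (S0 * S1) ^ m * (S1 * S0) ^ m = lmul N" for m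
  proof (induction m)
    case 0
    show ?case by (intro exI[of _ 1]) (simp add: lmul_one)
  next
    case (Suc m)
    then obtain N where N: "(S0 * S1) ^ m * (S1 * S0) ^ m = lmul N" by auto
    have "(S0 * S1) ^ Suc m * (S1 * S0) ^ Suc m = S0 * S1 * ((S0 * S1) ^ m * (S1 * S0) ^ m) * (S1 * S0)"
      by (simp only: power_Suc power_commutes mult.assoc)
    also have "\<dots> = lmul (scl \<zeta>1 N) * (S0 * (S1 * S1) * S0)"
      unfolding N S0S1_lmul by (simp only: mult.assoc)
    also have "\<exists>N'. \<dots> = lmul N'"
      unfolding S0_def S1_def R1.S_S R0.S_lmul mult.assoc R0.S_S by (intro exI) (simp only: lmul_mult[symmetric])
    finally show ?case .
  qed
  then show ?thesis by (simp add: P_def Q_def)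
qed

abbreviation "rd0 \<equiv> root_diff r0"
abbreviation "rd1 \<equiv> root_diff (1::'a)"

lemma S0_supp:
  assumes "supp l v" "l \<ge> 0"
  shows "supp (l + 1) (app S0 v)" "app S0 v (l + 1) = rd0 * rfl r0 (v (- l))" "app S0 v (- (l + 1)) = 0"
  using T0_supp[OF assms] assms by (auto simp: S0_def R0.S_def T0_def app_lmul supp_def)

lemma S1_supp:
  assumes "supp l v" "l \<ge> 0"
  shows "supp (l + 1) (app S1 v)" "app S1 v (- (l + 1)) = rd1 * rfl 1 (v l)" "app S1 v (l + 1) = 0"
  using T1_supp[OF assms] assms by (auto simp: S1_def R1.S_def T1_def app_lmul supp_def)

lemma S0S1_power:
  "supp (2 * int m) (app ((S0 * S1) ^ m) e0) \<and> app ((S0 * S1) ^ m) e0 (2 * int m) = op \<zeta>1 (rd0 * rfl r0 rd1) m \<and>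
    (m > 0 \<longrightarrow> app ((S0 * S1) ^ m) e0 (- (2 * int m)) = 0)"
proof (induction m)
  case 0
  then show ?case by (simp add: supp_unit_vec op_0) (simp add: unit_vec_def)
next
  case (Suc m)
  let ?v = "app ((S0 * S1) ^ m) e0"
  have v: "supp (2 * int m) ?v" "?v (2 * int m) = op \<zeta>1 (rd0 * rfl r0 rd1) m" using Suc by auto
  note w = S1_supp[OF v(1)]
  have "supp (2 * int m + 1) (app S1 ?v)" using w(1) by simp
  note u = S0_supp[OF this]
  have i: "2 * int m + 1 + 1 = 2 * int (Suc m)" by simp
  show ?case
    unfolding power_Suc app_simps(6) op_Suc[OF zeta_nz(1)]
    using u w(2) unfolding i v(2)
    by (simp add: rfl_simps[OF r0] rfl_rfl_scl mult.assoc)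
qed

lemma S1S0_power:
  "supp (2 * int m) (app ((S1 * S0) ^ m) e0) \<and> app ((S1 * S0) ^ m) e0 (- (2 * int m)) = op \<zeta>2 (rd1 * rfl 1 rd0) m \<and>
    (m > 0 \<longrightarrow> app ((S1 * S0) ^ m) e0 (2 * int m) = 0)"
proof (induction m)
  case 0
  then show ?case by (simp add: supp_unit_vec op_0) (simp add: unit_vec_def)
next
  case (Suc m)
  let ?v = "app ((S1 * S0) ^ m) e0"
  have v: "supp (2 * int m) ?v" "?v (- (2 * int m)) = op \<zeta>2 (rd1 * rfl 1 rd0) m" using Suc by auto
  note w = S0_supp[OF v(1)]
  have "supp (2 * int m + 1) (app S0 ?v)" using w(1) by simp
  note u = S1_supp[OF this]
  have i: "2 * int m + 1 + 1 = 2 * int (Suc m)" by simp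
  show ?case
    unfolding power_Suc app_simps(6) op_Suc[OF zeta_nz(2)]
    using u w(2) unfolding i v(2)
    by (simp add: rfl_simps[OF r1] rfl_rfl_scl mult.assoc)
qed

text \<open>Moving S0 past the eigenvalue of S1 reflects it: S0 S1 v = s0(sigma1) sigma0 v.
  Iteration produces the orbit product.\<close>

lemma S0S1_eigen:
  assumes "app S0 v = app (lmul \<sigma>0) v" "app S1 v = app (lmul \<sigma>1) v"
  shows "app P v = app (lmul (op \<zeta>1 (\<sigma>0 * rfl r0 \<sigma>1) n)) v" "app Q v = app (lmul (op \<zeta>2 (\<sigma>1 * rfl 1 \<sigma>0) n)) v"
proof -
  have ll: "app (lmul f) (app (lmul g) v) = app (lmul (g * f)) v" for f g v
    by (simp add: lmul_mult lmul_commute[of g] flip: app_simps(6))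
  have *: "app (x ^ m) v = app (lmul (op \<zeta> \<omega> m)) v"
    if x: "\<And>f. x * lmul f = lmul (scl \<zeta> f) * x" and z: "\<zeta> \<noteq> 0" and e: "app x v = app (lmul \<omega>) v" for x \<zeta> \<omega> m
  proof (induction m)
    case (Suc m)
    have "app (x ^ Suc m) v = app (x * lmul (op \<zeta> \<omega> m)) v"
      using Suc by simp
    then show ?case by (simp only: x app_simps(6) e ll op_Suc[OF z])
  qed (simp add: op_0 lmul_one)
  have "app (S0 * S1) v = app (S0 * lmul \<sigma>1) v" "app (S1 * S0) v = app (S1 * lmul \<sigma>0) v"
    using assms by simp_all
  then have "app (S0 * S1) v = app (lmul (\<sigma>0 * rfl r0 \<sigma>1)) v" "app (S1 * S0) v = app (lmul (\<sigma>1 * rfl 1 \<sigma>0)) v"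
    unfolding S_lmul by (simp_all only: assms app_simps(6) ll)
  then show "app P v = app (lmul (op \<zeta>1 (\<sigma>0 * rfl r0 \<sigma>1) n)) v" "app Q v = app (lmul (op \<zeta>2 (\<sigma>1 * rfl 1 \<sigma>0) n)) v"
    unfolding P_def Q_def by (simp_all only: *[OF S0S1_lmul zeta_nz(1)] *[OF S1S0_lmul zeta_nz(2)])
qed

end

section \<open>Identities in commuting inverse pairs\<close>

lemma cancel_left:
  fixes a a' :: "'r::comm_ring_1"
  assumes "a * a' = 1" shows "a * (a' * x) = x" "a' * (a * x) = x" "a' * a = 1"
  using assms by (simp_all add: mult.commute flip: mult.assoc)

text \<open>Up to sign, \<open>D\<close> times the eigenvalue minus the values of \<open>P\<close>
  and \<open>Q\<close>. The terms in Z^2 and Z'^2 cancel, so the free term is linear in Z +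
  Z'.\<close>

lemma shift_identity:
  fixes Z :: "'r::comm_ring_1"
  assumes "Z * Z' = 1" "a * a' = 1" "b * b' = 1"
  shows "(Z - Z') * (Z - Z') * (a * b + a' * b') - (a' * Z' - x + a * Z) * (b' * Z' - y + b * Z)
      - (a * Z' - x + a' * Z) * (b * Z' - y + b' * Z) =
    (Z + Z') * (y * (a + a') + x * (b + b')) - 2 * ((a + a') * (b + b')) - 2 * (x * y)"
  by (simp add: algebra_simps assms cancel_left[OF assms(1)] cancel_left[OF assms(2)] cancel_left[OF assms(3)])

text \<open>One of the two factors of \<open>P Q\<close>; it is symmetric in Z and Z', hence a
  polynomial in Z + Z'.\<close>

lemma norm_identity:
  fixes Z :: "'r::comm_ring_1"
  assumes "Z * Z' = 1" "a * a' = 1"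
  shows "(a' * Z' - x + a * Z) * (a * Z' - x + a' * Z) =
    (Z + Z') * (Z + Z') - 4 + (a + a') * (a + a') + x * x - x * (a + a') * (Z + Z')"
  by (simp add: algebra_simps assms cancel_left[OF assms(1)] cancel_left[OF assms(2)])

text \<open>The divisibility behind the relation: with B = Z + Z^-1 the factor B^2 - 4 is (Z -
  Z^-1)^2, and the cofactor consists of the terms of the relation in \<open>b\<close> alone.\<close>

lemma relation_identity:
  fixes B :: "'r::comm_ring_1"
  assumes "E * E = 1"
    and "al = C1 * C0v + E * C1v * C0" "mu = C1 * C1v + E * C0v * C0" "ga = C1 * C0 + E * C0v * C1v"
    and "ps = C1 * C1 + C0 * C0 + C0v * C0v + C1v * C1v + E * C0 * C1 * C0v * C1v - 4"
  shows "(B * B - 4 + C0 * C0 + (E * C0v) * (E * C0v) - E * C0v * C0 * B) * (B * B - 4 + C1 * C1 + C1v * C1v - C1v * C1 * B)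
      - al * al - ga * ga + E * al * ga * B = (B * B - 4) * (B * B - mu * B + ps)"
  unfolding assms(2-5)
  by (simp add: algebra_simps assms(1) cancel_left[OF assms(1)])

context daha_root
begin

definition "sg = ((- 1) ^ n :: 'a)"

lemma sg_sg: "sg * sg = 1"
  by (simp add: sg_def flip: power_mult_distrib)

lemma eta_tau: "\<eta> * \<tau> = - \<eta> * sg"
proof -
  have "sg * inverse (\<eta> ^ n) = - \<eta>"
    using eta_power by (simp add: sg_def \<eta>_def power_mult)
  moreover have "inverse (\<eta> ^ n) = \<eta> ^ n"
    by (simp add: eta_inverse flip: power_inverse)
  moreover have "\<eta> ^ n = \<eta> * \<tau>"
    using n_pos by (simp add: \<tau>_def flip: power_Suc)
  ultimately have "sg * (\<eta> * \<tau>) = - \<eta>" by simp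
  then have "sg * sg * (\<eta> * \<tau>) = sg * - \<eta>" by (simp only: mult.assoc)
  then show ?thesis by (simp add: sg_sg)
qed

lemma q_powers: "r0 ^ n = 1" "\<zeta>1 ^ n = 1" "q ^ n = \<eta>" "inverse q ^ n = \<eta>"
  using zeta_primitive(1)[of \<zeta>1] zeta_primitive(1)[of \<zeta>2] eta_inverse
  by (simp_all add: r0_def \<eta>_def power_inverse)

definition "ww = Zp 1 - Zp (- 1)"
definition "DD = Const sg * (ww * ww)"

lemma ww_nonzero: "ww \<noteq> 0"
proof -
  have "Poly_Mapping.lookup (Zp 1 - Zp (- 1)) (int n) \<noteq> (0::'a)"
    using n_pos by (simp add: Zp_def lookup_minus lookup_Xp)
  then show ?thesis by (auto simp: ww_def)
qed

text \<open>From the factorisation kappa X^-1 (1 - a X) (1 + a X).\<close>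

lemma binomial_op:
  assumes "\<zeta> \<in> {\<zeta>1, \<zeta>2}" "\<omega> = Const \<kappa> * Xp (- 1) - Const (\<kappa> * (a * a)) * Xp 1"
  shows "op \<zeta> \<omega> n = Const (\<kappa> ^ n * \<tau>) * Zp (- 1) * (1 - Const (a ^ n) * Zp 1) * (1 - Const (sg * a ^ n) * Zp 1)"
proof -
  have z: "\<zeta> \<noteq> 0" using assms zeta_nz by auto
  have bin: "k * W' * (1 - b * W) * (1 - (- b) * W) = k * W' - k * (b * b) * W"
    if "W' * W = 1" for W W' k b :: "'a lau"
  proof -
    have "k * W' * (1 - b * W) * (1 - (- b) * W) = k * W' - k * (b * b) * ((W' * W) * W)"
      by (simp add: algebra_simps)
    with that show ?thesis by simp
  qed
  have "\<omega> = Const \<kappa> * Xp (- 1) * (1 - Const a * Xp 1) * (1 - Const (- a) * Xp 1)"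
    unfolding assms(2) Const_uminus by (subst bin) (simp_all add: Const_mult)
  then have "op \<zeta> \<omega> n = Const (\<kappa> ^ n) * (Const \<tau> * Zp (- 1)) * (1 - Const (a ^ n) * Zp 1) * (1 - Const ((- a) ^ n) * Zp 1)"
    by (simp only: op_mult[OF z] op_Const[OF z] op_Xp[OF assms(1)] op_linear[OF assms(1)])
  also have "(- a) ^ n = sg * a ^ n"
    unfolding sg_def by (rule power_minus)
  also have "Const (\<kappa> ^ n) * (Const \<tau> * Zp (- 1)) = Const (\<kappa> ^ n * \<tau>) * Zp (- 1)"
    by (rule Const_Const)
  finally show ?thesis .
qed

text \<open>The linear factors multiply to (1 - eta Z)(1 - sg eta Z)(1 - Z)(1 - sg Z). In every case
  that \<open>q_sign\<close> permits, two of them are 1 - Z and two are 1 + Z.\<close>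

lemma root_diff_orbit: "op \<zeta>1 (rd0 * rfl r0 rd1) n = DD" "op \<zeta>2 (rd1 * rfl 1 rd0) n = DD"
proof -
  have rq: "r0 * (q * q) = 1" "r0 * (q * q * (q * q)) = q * q" "inverse r0 = q * q" "inverse q * inverse q = r0"
    using nz by (simp_all add: r0_def power2_eq_square field_simps)
  have e0: "rd0 = Const (- r0) * Xp (- 1) - Const (- r0 * (q * q)) * Xp 1"
    and e1: "rfl r0 rd1 = Const r0 * Xp (- 1) - Const (r0 * (\<zeta>1 * \<zeta>1)) * Xp 1"
    and e2: "rd1 = Const (- 1) * Xp (- 1) - Const (- 1 * (1 * 1)) * Xp 1"
    and e3: "rfl 1 rd0 = Const 1 * Xp (- 1) - Const (1 * (inverse q * inverse q)) * Xp 1"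
    by (simp_all add: rq root_diff_def r0 rfl_simps rfl_Xp power_int_minus Const_one Const_uminus power2_eq_square)
  have fin: "Zp (- 1) * (1 - Const \<eta> * Zp 1) * (1 - Const (sg * \<eta>) * Zp 1) * (Zp (- 1) * (1 - Zp 1) * (1 - Const sg * Zp 1)) = ww * ww"
  proof -
    have s: "sg = 1 \<or> sg = - 1"
      by (cases "even n") (simp_all add: sg_def)
    have o: "odd n \<Longrightarrow> sg = - 1" by (simp add: sg_def)
    have "Zp (- 1) * (1 - Zp 1) * (1 + Zp 1) = - ww" "Zp (- 1) * (1 + Zp 1) * (1 - Zp 1) = - ww"
      by (simp_all add: ww_def algebra_simps flip: mult.assoc)
    then have 1: "(Zp (- 1) * (1 - Zp 1) * (1 + Zp 1)) * (Zp (- 1) * (1 - Zp 1) * (1 + Zp 1)) = ww * ww"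
      by simp
    show ?thesis
      using q_sign
    proof
      assume "odd n \<and> q ^ n = 1"
      then have "\<eta> = 1" "sg = - 1" by (simp_all add: \<eta>_def o)
      with 1 show ?thesis by (simp add: Const_one Const_uminus)
    next
      assume "q ^ n = - 1"
      then have e: "\<eta> = - 1" by (simp add: \<eta>_def)
      from s show ?thesis
      proof
        assume "sg = 1"
        with e 1 show ?thesis by (simp add: Const_one Const_uminus ac_simps)
      next
        assume "sg = - 1"
        with e 1 show ?thesis by (simp add: Const_one Const_uminus ac_simps)
      qed
    qed
  qed
  have p: "(- r0) ^ n = sg" "(inverse q) ^ n = \<eta>" "(- 1) ^ n = sg" "1 ^ n = (1::'a)"
    using q_powers by (simp_all add: sg_def power_minus[of r0])
  have c: "Const (sg * \<tau>) * Const (1 * \<tau>) = (Const sg :: 'a lau)"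
    using tau_tau by (simp add: mult.assoc flip: Const_mult)
  note b = binomial_op[OF _ e0, of \<zeta>1] binomial_op[OF _ e1, of \<zeta>1] binomial_op[OF _ e2, of \<zeta>2] binomial_op[OF _ e3, of \<zeta>2]
  have "op \<zeta>1 (rd0 * rfl r0 rd1) n = (Const (sg * \<tau>) * Const (1 * \<tau>)) *
      (Zp (- 1) * (1 - Const \<eta> * Zp 1) * (1 - Const (sg * \<eta>) * Zp 1) * (Zp (- 1) * (1 - Zp 1) * (1 - Const sg * Zp 1)))"
    unfolding op_mult[OF zeta_nz(1)] using b(1,2) by (simp add: p q_powers Const_one ac_simps)
  then show "op \<zeta>1 (rd0 * rfl r0 rd1) n = DD"
    unfolding fin c DD_def .
  have "op \<zeta>2 (rd1 * rfl 1 rd0) n = (Const (sg * \<tau>) * Const (1 * \<tau>)) *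
      (Zp (- 1) * (1 - Const \<eta> * Zp 1) * (1 - Const (sg * \<eta>) * Zp 1) * (Zp (- 1) * (1 - Zp 1) * (1 - Const sg * Zp 1)))"
    unfolding op_mult[OF zeta_nz(2)] using b(3,4) by (simp add: p q_powers Const_one ac_simps)
  then show "op \<zeta>2 (rd1 * rfl 1 rd0) n = DD"
    unfolding fin c DD_def .
qed

lemma P_top: "htop 1 P DD" and P_bot: "app P e0 (- (2 * int n)) = 0"
  using S0S1_power[of n] n_pos PQ_Himg by (simp_all add: htop_def P_def root_diff_orbit)

lemma Q_top: "htop 1 Q 0" and Q_bot: "app Q e0 (- (2 * int n)) = DD"
  using S1S0_power[of n] n_pos PQ_Himg by (simp_all add: htop_def Q_def root_diff_orbit)

text \<open>\<open>P\<close> has leading coordinate \<open>DD\<close> at the positive end only,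
  \<open>Q\<close> at the negative end only. The difference therefore vanishes at both ends and
  commutes with X, so \<open>centralizer_X_short\<close> applies.\<close>

lemma central_decomp:
  assumes z: "central z" "htop 1 z f" "app z e0 (- (2 * int n)) = g"
  obtains u where "lmul DD * z = lmul f * P + lmul g * Q + lmul u"
proof -
  let ?e = "lmul DD * z - (lmul f * P + lmul g * Q)"
  have H: "?e \<in> Himg"
    using z by (intro Himg_diff Himg_add Himg_mult Himg_lmul PQ_Himg central_Himg)
  have "?e * lmul (Xp 1) = lmul DD * (z * lmul (Xp 1)) - (lmul f * (P * lmul (Xp 1)) + lmul g * (Q * lmul (Xp 1)))"
    by (simp only: left_diff_distrib distrib_right mult.assoc)
  also have "\<dots> = lmul (Xp 1) * ?e"
    unfolding PQ_lmul central_commute[OF z(1) Himg_lmul]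
    by (simp only: right_diff_distrib distrib_left lmul_lmul mult.commute)
  finally have comm: "?e * lmul (Xp 1) = lmul (Xp 1) * ?e" .
  have s: "supp (2 * int n) (app ?e e0)"
    using z(2) P_top Q_top by (auto simp: htop_def intro!: supp_diff supp_add supp_lmul)
  have t: "app ?e e0 (2 * int n) = 0"
    using z(2) P_top Q_top by (simp add: htop_def app_lmul)
  have b: "app ?e e0 (- (2 * int n)) = 0"
    using z(3) P_bot Q_bot by (simp add: app_lmul)
  from centralizer_X_short[OF H comm supp_shrink[OF s t b]] obtain u where u: "?e = lmul u" ..
  have "lmul DD * z = lmul f * P + lmul g * Q + ?e" by simp
  then show ?thesis unfolding u by (rule that)
qed

section \<open>Orbit products of the eigenvalues\<close>

definition "C0 = k0 ^ n + inverse (k0 ^ n)"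
definition "C1 = k1 ^ n + inverse (k1 ^ n)"
definition "C0v = k0v ^ n + inverse (k0v ^ n)"
definition "C1v = k1v ^ n + inverse (k1v ^ n)"

text \<open>Shape of the orbit product of a trinomial; Z -> 1 / Z exchanges k and its
  inverse.\<close>

definition tri :: "'a \<Rightarrow> 'a \<Rightarrow> 'a lau" where
  "tri k x = Const k * Zp (- 1) - Const x + Const (inverse k) * Zp 1"

text \<open>The coefficients of the relation, matched with \<open>phi\<close> and \<open>psi\<close>
  in \<open>relator_eq\<close>. The -4 combines T_2n = T_n^2 - 2 with the -2 of the
  relation.\<close>

definition "al = C1 * C0v + \<eta> * C1v * C0"
definition "mu = C1 * C1v + \<eta> * C0v * C0"
definition "ga = C1 * C0 + \<eta> * C0v * C1v"
definition "ps = C1 * C1 + C0 * C0 + C0v * C0v + C1v * C1v + \<eta> * C0 * C1 * C0v * C1v - 4"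

lemma eta_left: "\<eta> * (\<eta> * x) = x" and tau_left: "\<tau> * (\<tau> * x) = x"
  using eta_eta tau_tau by (simp_all flip: mult.assoc)

lemma Const_numeral: "Const (numeral k) = (numeral k :: 'a lau)"
  by (simp add: Const_def)

lemma shift_value:
  assumes "a \<noteq> 0" "b \<noteq> 0"
  shows "ww * ww * Const (a * b + inverse (a * b)) - tri (inverse a) x * tri (inverse b) y - tri a x * tri b y =
    beta * Const (y * (a + inverse a) + x * (b + inverse b)) - Const (2 * ((a + inverse a) * (b + inverse b)) + 2 * (x * y))"
  using shift_identity[of "Zp 1" "Zp (- 1)" "Const a" "Const (inverse a)" "Const b" "Const (inverse b)" "Const x" "Const y"]
    assms
  by (simp add: Const_inverse ww_def beta_def tri_def Const_add Const_mult Const_numeral diff_diff_eq)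

lemma norm_value:
  assumes "a \<noteq> 0"
  shows "tri (inverse a) x * tri a x = beta * beta - 4 + Const (a + inverse a) * Const (a + inverse a)
    + Const x * Const x - Const x * Const (a + inverse a) * beta"
  using norm_identity[of "Zp 1" "Zp (- 1)" "Const a" "Const (inverse a)" "Const x"] assms
  by (simp add: Const_inverse beta_def tri_def Const_add)

lemma trinomial_tri:
  assumes "\<zeta> \<in> {\<zeta>1, \<zeta>2}" "y \<noteq> 0" "\<omega> = Const a * Xp (- 1) - Const b + Const c * Xp 1"
    and "b = a * (x * (y + inverse y))" "c = a * (x * x)" "a ^ n = t * k"
    and "t * k * (x ^ n * (y ^ n + inverse (y ^ n))) = t * e" "t * k * (x ^ n * x ^ n) = t * inverse k"
  shows "op \<zeta> \<omega> n = Const (\<tau> * t) * tri k e"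
proof -
  have "op \<zeta> \<omega> n = Const \<tau> * (Const (t * k) * Zp (- 1) - Const (t * e) + Const (t * inverse k) * Zp 1)"
    using trinomial_op[OF assms(1,2) assms(3)[unfolded assms(4,5)]] by (simp only: assms(6-8))
  then show ?thesis
    by (simp add: tri_def Const_mult algebra_simps)
qed

text \<open>By \<open>app_S\<close> the polynomial is the eigenvalue of S1. It factors as -k1 X^-1
  (1 - k1^-1 k1v X)(1 - k1^-1 k1v^-1 X), which is the source of the witness x; its reflection enters
  \<open>P\<close>.\<close>

lemma sigma1_ops:
  "op \<zeta>1 (rfl r0 (rd1 * Const k1 - \<gamma>1)) n = Const (\<tau> * sg) * tri (inverse (k1 ^ n)) C1v"
  "op \<zeta>2 (rd1 * Const k1 - \<gamma>1) n = Const (\<tau> * sg) * tri (k1 ^ n) C1v"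
proof -
  have s: "rd1 * Const k1 - \<gamma>1 = Const (- k1) * Xp (- 1) - Const (- c1v) + Const (k1 - c1) * Xp 1"
    by (simp add: root_diff_def \<gamma>1_def Const_uminus Const_one Const_diff algebra_simps)
  have m: "(- k1) ^ n = sg * k1 ^ n" "(- (r0 * inverse k1)) ^ n = sg * inverse (k1 ^ n)"
    using q_powers(1) by (simp_all add: sg_def power_minus[of k1] power_minus[of "r0 * inverse k1"] power_mult_distrib power_inverse)
  show "op \<zeta>2 (rd1 * Const k1 - \<gamma>1) n = Const (\<tau> * sg) * tri (k1 ^ n) C1v"
    by (rule trinomial_tri[OF _ nz(5) s, where x = "inverse k1"])
      (use nz in \<open>simp_all add: m c1v_def c1_def C1v_def power_inverse field_simps\<close>)
  have s': "rfl r0 (rd1 * Const k1 - \<gamma>1) = Const (- (r0 * inverse k1)) * Xp (- 1) - Const (- c1v) + Const (- (k1 * \<zeta>1)) * Xp 1"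
    unfolding s using nz
    by (simp add: rfl_simps r0 rfl_Xp c1_def Const_mult Const_uminus power_int_minus ac_simps) (simp add: r0_def)
  show "op \<zeta>1 (rfl r0 (rd1 * Const k1 - \<gamma>1)) n = Const (\<tau> * sg) * tri (inverse (k1 ^ n)) C1v"
    by (rule trinomial_tri[OF _ nz(5) s', where x = "\<zeta>1 * k1"])
      (use nz in \<open>simp_all add: m q_powers power_mult_distrib, simp_all add: c1v_def C1v_def r0_def field_simps\<close>)
qed

lemma sigma0_ops:
  "op \<zeta>1 (rd0 * Const k0 - \<gamma>0) n = Const \<tau> * tri (inverse (k0 ^ n)) (\<eta> * C0v)"
  "op \<zeta>2 (rfl 1 (rd0 * Const k0 - \<gamma>0)) n = Const \<tau> * tri (k0 ^ n) (\<eta> * C0v)"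
proof -
  have s: "rd0 * Const k0 - \<gamma>0 = Const (r0 * inverse k0) * Xp (- 1) - Const (inverse q * c0v) + Const k0 * Xp 1"
    by (simp add: root_diff_def[OF r0] \<gamma>0_def c0_def Const_add Const_mult algebra_simps)
  have "op \<zeta>1 (rd0 * Const k0 - \<gamma>0) n = Const (\<tau> * 1) * tri (inverse (k0 ^ n)) (\<eta> * C0v)"
    by (rule trinomial_tri[OF _ nz(4) s, where x = "q * k0"])
      (use nz eta_eta in \<open>simp_all add: q_powers power_mult_distrib power_inverse eta_inverse,
        simp_all add: c0v_def C0v_def r0_def power2_eq_square field_simps\<close>)
  then show "op \<zeta>1 (rd0 * Const k0 - \<gamma>0) n = Const \<tau> * tri (inverse (k0 ^ n)) (\<eta> * C0v)" by simp
  have s': "rfl 1 (rd0 * Const k0 - \<gamma>0) = Const k0 * Xp (- 1) - Const (inverse q * c0v) + Const (r0 * inverse k0) * Xp 1"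
    unfolding s by (simp add: rfl_simps rfl_Xp Const_one)
  have "op \<zeta>2 (rfl 1 (rd0 * Const k0 - \<gamma>0)) n = Const (\<tau> * 1) * tri (k0 ^ n) (\<eta> * C0v)"
    by (rule trinomial_tri[OF _ nz(4) s', where x = "inverse q * inverse k0"])
      (use nz eta_eta in \<open>simp_all add: q_powers power_mult_distrib power_inverse eta_inverse,
        simp_all add: c0v_def C0v_def r0_def power2_eq_square field_simps\<close>)
  then show "op \<zeta>2 (rfl 1 (rd0 * Const k0 - \<gamma>0)) n = Const \<tau> * tri (k0 ^ n) (\<eta> * C0v)" by simp
qed

lemma Const_tau: "Const \<tau> * Const (\<tau> * x) = (Const x :: 'a lau)"
  by (simp add: tau_left flip: Const_mult)

text \<open>For an eigenvector of t0v the eigenvalue of S0 is X times a trinomial in which k0 and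
  k0v have exchanged roles. The extra X becomes a factor Z or Z^-1, which cancels against the
  leading coordinates of \<open>aa\<close>.\<close>

lemma sigma0v_ops:
  fixes h defines "h \<equiv> Const c0 - Const (q * k0v) * Xp 1"
  shows "op \<zeta>1 (rd0 * h - \<gamma>0) n = Const (sg * \<eta>) * Zp 1 * tri (inverse (k0v ^ n)) (\<eta> * C0)"
    and "op \<zeta>2 (rfl 1 (rd0 * h - \<gamma>0)) n = Const (sg * \<eta>) * Zp (- 1) * tri (k0v ^ n) (\<eta> * C0)"
proof -
  define u where "u = inverse (q * k0v)"
  define w where "w = Const (- u) * Xp (- 1) - Const (- c0) + Const (- (q * k0v)) * Xp 1"
  define w' where "w' = Const (- (q * k0v)) * Xp (- 1) - Const (- c0) + Const (- u) * Xp 1"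
  have X: "Xp 1 * (Xp (- 1) * x) = x" "Xp (- 1) * (Xp 1 * x) = x" for x :: "'a lau"
    by (simp_all flip: mult.assoc)
  have a: "Const r0 * Const (q * k0v) = (Const (inverse q * k0v) :: 'a lau)"
    using nz by (simp add: r0_def power2_eq_square field_simps flip: Const_mult)
  have b: "inverse q * c0v = inverse q * k0v + u"
    by (simp add: c0v_def u_def distrib_left)
  have s: "rd0 * h - \<gamma>0 = Xp 1 * w"
  proof -
    have "rd0 * h - \<gamma>0 = Xp 1 * Const c0 - Xp 1 * (Const (q * k0v) * Xp 1) + Const r0 * Const (q * k0v) * (Xp (- 1) * Xp 1)
        - Const (inverse q * c0v)"
      by (simp add: root_diff_def[OF r0] h_def \<gamma>0_def Const_mult algebra_simps)
    also have "\<dots> = Xp 1 * w"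
      unfolding a b by (simp add: w_def X Const_add Const_uminus algebra_simps)
    finally show ?thesis .
  qed
  have s': "rfl 1 (rd0 * h - \<gamma>0) = Xp (- 1) * w'"
    unfolding s by (simp add: w_def w'_def rfl_simps rfl_Xp Const_one)
  have m: "u ^ n = \<eta> * inverse (k0v ^ n)"
    using q_powers eta_inverse by (simp add: u_def power_mult_distrib power_inverse)
  then have m': "(- u) ^ n = sg * (\<eta> * inverse (k0v ^ n))" "(- (q * k0v)) ^ n = sg * (\<eta> * k0v ^ n)"
    using q_powers by (simp_all add: sg_def power_minus[of u] power_minus[of "q * k0v"] power_mult_distrib)
  have "op \<zeta>1 w n = Const (\<tau> * (sg * \<eta>)) * tri (inverse (k0v ^ n)) (\<eta> * C0)"
    by (rule trinomial_tri[OF _ nz(2) w_def, where x = "q * k0v"])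
      (use nz eta_eta in \<open>simp_all add: m m' q_powers power_mult_distrib power_inverse,
        simp_all add: c0_def C0_def u_def power2_eq_square field_simps\<close>)
  then show "op \<zeta>1 (rd0 * h - \<gamma>0) n = Const (sg * \<eta>) * Zp 1 * tri (inverse (k0v ^ n)) (\<eta> * C0)"
    unfolding s by (simp add: op_mult nz op_Xp) (simp add: Const_tau)
  have "op \<zeta>2 w' n = Const (\<tau> * (sg * \<eta>)) * tri (k0v ^ n) (\<eta> * C0)"
    by (rule trinomial_tri[OF _ nz(2) w'_def, where x = u])
      (use nz eta_eta in \<open>simp_all add: m m' q_powers power_mult_distrib power_inverse,
        simp_all add: c0_def C0_def u_def power2_eq_square field_simps\<close>)
  then show "op \<zeta>2 (rfl 1 (rd0 * h - \<gamma>0)) n = Const (sg * \<eta>) * Zp (- 1) * tri (k0v ^ n) (\<eta> * C0)"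
    unfolding s' by (simp add: op_mult nz op_Xp) (simp add: Const_tau)
qed

lemma eigenvector_values:
  assumes "app T0 v = app (lmul h) v" "app T1 v = app (sc k1) v"
  shows "app P v = app (lmul (op \<zeta>1 ((rd0 * h - \<gamma>0) * rfl r0 (rd1 * Const k1 - \<gamma>1)) n)) v"
    and "app Q v = app (lmul (op \<zeta>2 ((rd1 * Const k1 - \<gamma>1) * rfl 1 (rd0 * h - \<gamma>0)) n)) v"
  using S0S1_eigen[of v "rd0 * h - \<gamma>0" "rd1 * Const k1 - \<gamma>1"] assms R0.app_S[of v h] R1.app_S[of v "Const k1"]
  by (simp_all add: T0_def T1_def S0_def S1_def sc_def)

end

text \<open>With G = \<open>ga\<close> and A = \<open>al\<close> the two brackets are
  \<open>shift_a\<close> and \<open>shift_c\<close>; their combinations acquire a factor Z - Z', as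
  the elimination requires.\<close>

lemma shift_factor:
  fixes Z :: "'r::comm_ring_1"
  assumes "Z * Z' = 1" "E * E = 1"
  shows "(Z + Z') * (E * G) - 2 * A + E * Z * ((Z + Z') * (E * A) - 2 * G) = (Z - Z') * (A * Z - E * G)"
    and "(Z + Z') * (E * G) - 2 * A + E * Z' * ((Z + Z') * (E * A) - 2 * G) = (Z - Z') * (E * G - A * Z')"
  by (simp_all add: algebra_simps assms cancel_left[OF assms(1)] cancel_left[OF assms(2)])

lemma shift_sums:
  fixes Z :: "'r::comm_ring_1"
  assumes "Z * Z' = 1" "E * E = 1"
  shows "s * (w * (A * Z - E * G)) + s * (w * (E * G - A * Z')) = s * (w * (Z - Z')) * A"
    and "E * Z * (s * (w * (E * G - A * Z'))) + E * Z' * (s * (w * (A * Z - E * G))) = s * (w * (Z - Z')) * G"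
    and "(A * Z - E * G) * (E * G - A * Z') = E * A * G * (Z + Z') - A * A - G * G"
    and "(Z + Z') * (Z + Z') - 4 = (Z - Z') * (Z - Z')"
    and "E * Z * (E * Z') = 1"
  by (simp_all add: algebra_simps assms cancel_left[OF assms(1)] cancel_left[OF assms(2)])

context daha_root
begin

lemma trace_eigen:
  assumes "app x v = app (sc a) v" "app y v = app (sc b) v" "x \<in> Himg" "y \<in> Himg" "a \<noteq> 0" "b \<noteq> 0"
    and "x' * x = 1" "y' * y = 1" "x' \<in> Himg" "y' \<in> Himg"
  shows "app ((x * y) ^ n + (y' * x') ^ n) v = app (sc (a ^ n * b ^ n + inverse (a ^ n * b ^ n))) v"
proof -
  have "app (x * y) v = app (sc (a * b)) v"
    by (rule eigen_mult[OF assms(1,2)]) (simp add: Himg_sc_commute assms)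
  then have 1: "app ((x * y) ^ n) v = app (sc ((a * b) ^ n)) v"
    by (rule eigen_power) (simp add: Himg_sc_commute Himg_mult assms)
  have "app x' v = app (sc (inverse a)) v" "app y' v = app (sc (inverse b)) v"
    using assms by (auto intro: eigen_inverse simp: Himg_sc_commute)
  then have "app (y' * x') v = app (sc (inverse b * inverse a)) v"
    by (intro eigen_mult) (simp_all add: Himg_sc_commute assms)
  then have 2: "app ((y' * x') ^ n) v = app (sc ((inverse b * inverse a) ^ n)) v"
    by (rule eigen_power) (simp add: Himg_sc_commute Himg_mult assms)
  have "app ((x * y) ^ n + (y' * x') ^ n) v = app (sc ((a * b) ^ n) + sc ((inverse b * inverse a) ^ n)) v"
    using 1 2 by simp
  also have "sc ((a * b) ^ n) + sc ((inverse b * inverse a) ^ n) = sc (a ^ n * b ^ n + inverse (a ^ n * b ^ n))"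
    by (simp add: power_mult_distrib power_inverse mult.commute flip: sc_add)
  finally show ?thesis .
qed

definition "shift_c = beta * Const (\<eta> * al) - Const (2 * ga)"
definition "shift_a = beta * Const (\<eta> * ga) - Const (2 * al)"

lemma shift_scalars:
  "C1v * C0 + \<eta> * C0v * C1 = \<eta> * al" "2 * (C0 * C1) + 2 * (\<eta> * C0v * C1v) = 2 * ga"
  "C1v * C0v + \<eta> * C0 * C1 = \<eta> * ga" "2 * (C0v * C1) + 2 * (\<eta> * C0 * C1v) = 2 * al"
proof -
  have "\<eta> * al = \<eta> * C0v * C1 + (\<eta> * \<eta>) * (C1v * C0)" "\<eta> * ga = \<eta> * C0 * C1 + (\<eta> * \<eta>) * (C1v * C0v)"
    by (simp_all add: al_def ga_def algebra_simps)
  then show "C1v * C0 + \<eta> * C0v * C1 = \<eta> * al" "C1v * C0v + \<eta> * C0 * C1 = \<eta> * ga"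
    by (simp_all add: eta_eta)
qed (simp_all add: al_def ga_def algebra_simps)

text \<open>The eigenvector for t0 = k0 and t1 = k1, on which \<open>cc\<close> is scalar;
  \<open>eps'_vector\<close> treats t0v = k0v, t1 = k1 and \<open>aa\<close>.\<close>

lemma eps_vector:
  obtains v where "v 0 = 1" "app cc v = app (sc (k0 ^ n * k1 ^ n + inverse (k0 ^ n * k1 ^ n))) v"
    "app P v = app (lmul (Const sg * (tri (inverse (k0 ^ n)) (\<eta> * C0v) * tri (inverse (k1 ^ n)) C1v))) v"
    "app Q v = app (lmul (Const sg * (tri (k0 ^ n) (\<eta> * C0v) * tri (k1 ^ n) C1v))) v"
proof -
  obtain v where v: "v 0 = 1" "app T0 v = app (lmul (- (- Const k0))) v" "app T1 v = app (lmul (- (- Const k1))) v"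
    by (rule eigenvector[OF T0_factor _ T1_factor]) auto
  then have T: "app T0 v = app (sc k0) v" "app T1 v = app (sc k1) v" "app T0 v = app (lmul (Const k0)) v"
    by (simp_all add: sc_def)
  have cc: "app cc v = app (sc (k0 ^ n * k1 ^ n + inverse (k0 ^ n * k1 ^ n))) v"
    unfolding cc_def
    by (rule trace_eigen[OF T(1,2)]) (simp_all add: Himg_T Himg_T' nz T0_inv T1_inv)
  have c: "Const \<tau> * a * (Const (\<tau> * sg) * b) = Const sg * (a * b)" "Const (\<tau> * sg) * b * (Const \<tau> * a) = Const sg * (a * b)"
    for a b :: "'a lau"
  proof -
    have "Const \<tau> * a * (Const (\<tau> * sg) * b) = (Const \<tau> * Const (\<tau> * sg)) * (a * b)"
      by (simp only: ac_simps)
    then show 1: "Const \<tau> * a * (Const (\<tau> * sg) * b) = Const sg * (a * b)" by (simp only: Const_tau)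
    then show "Const (\<tau> * sg) * b * (Const \<tau> * a) = Const sg * (a * b)" by (simp only: mult.commute)
  qed
  show ?thesis
    by (rule that[OF v(1) cc]) (simp_all only: eigenvector_values[OF T(3,2)] op_mult[OF zeta_nz(1)] op_mult[OF zeta_nz(2)] sigma0_ops sigma1_ops c)
qed

lemma eps'_vector:
  obtains v where "v 0 = 1" "app aa v = app (sc (k0v ^ n * k1 ^ n + inverse (k0v ^ n * k1 ^ n))) v"
    "app P v = app (lmul (Const (- \<eta> * sg) * Zp 1 * (tri (inverse (k0v ^ n)) (\<eta> * C0) * tri (inverse (k1 ^ n)) C1v))) v"
    "app Q v = app (lmul (Const (- \<eta> * sg) * Zp (- 1) * (tri (k0v ^ n) (\<eta> * C0) * tri (k1 ^ n) C1v))) v"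
proof -
  define h where "h = Const c0 - Const (q * k0v) * Xp 1"
  have Xnz: "Xp (- 1) \<noteq> (0 :: 'a lau)"
    by (metis Xp_cancel(1) mult_zero_right zero_neq_one)
  obtain v where v: "v 0 = 1" "app T0 v = app (lmul (- (Const (q * k0v) * Xp 1 - Const c0))) v" "app T1 v = app (lmul (- (- Const k1))) v"
    by (rule eigenvector[OF T0v_factor Xnz T1_factor]) auto
  then have T: "app T0 v = app (lmul h) v" "app T1 v = app (sc k1) v"
    by (simp_all add: sc_def h_def)
  have T0v: "app T0v v = app (sc k0v) v"
  proof
    fix j
    have "app T0' v j = Const (q * k0v) * Xp 1 * v j"
      by (simp add: T0'_def T app_sc app_lmul h_def algebra_simps)
    then have "app T0v v j = Const (inverse q) * (Xp (- 1) * (Const (q * k0v) * Xp 1 * v j))"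
      by (simp add: T0v_def sc_def app_lmul)
    also have "\<dots> = (Const (inverse q) * Const (q * k0v)) * (Xp (- 1) * Xp 1) * v j"
      by (simp only: ac_simps)
    also have "\<dots> = Const k0v * v j"
    proof -
      have "inverse q * (q * k0v) = k0v" using nz by simp
      then show ?thesis by (simp only: Const_mult[symmetric] Xp_cancel mult_1_right)
    qed
    finally show "app T0v v j = app (sc k0v) v j" by (simp add: app_sc)
  qed
  have aa: "app aa v = app (sc (k0v ^ n * k1 ^ n + inverse (k0v ^ n * k1 ^ n))) v"
    unfolding aa_def mult.commute[of "k0v ^ n"]
    by (rule trace_eigen[OF T(2) T0v]) (simp_all add: Himg_T Himg_T' Himg_T0v' nz T0v_inv T1_inv)
  have k: "Const (sg * \<eta>) * Const (\<tau> * sg) = (Const (- \<eta> * sg) :: 'a lau)"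
  proof -
    have "sg * \<eta> * (\<tau> * sg) = sg * sg * (\<eta> * \<tau>)" by (simp only: ac_simps)
    also have "\<dots> = - \<eta> * sg" by (simp only: sg_sg eta_tau mult_1_left)
    finally show ?thesis by (simp only: Const_mult[symmetric])
  qed
  have c: "Const (sg * \<eta>) * z * a * (Const (\<tau> * sg) * b) = Const (- \<eta> * sg) * z * (a * b)"
    "Const (\<tau> * sg) * b * (Const (sg * \<eta>) * z * a) = Const (- \<eta> * sg) * z * (a * b)" for a b z :: "'a lau"
  proof -
    have "Const (sg * \<eta>) * z * a * (Const (\<tau> * sg) * b) = (Const (sg * \<eta>) * Const (\<tau> * sg)) * z * (a * b)"
      by (simp only: ac_simps)
    then show "Const (sg * \<eta>) * z * a * (Const (\<tau> * sg) * b) = Const (- \<eta> * sg) * z * (a * b)" by (simp only: k)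
    then show "Const (\<tau> * sg) * b * (Const (sg * \<eta>) * z * a) = Const (- \<eta> * sg) * z * (a * b)" by (simp only: mult.commute)
  qed
  show ?thesis
    by (rule that[OF v(1) aa])
      (simp_all only: eigenvector_values[OF T] op_mult[OF zeta_nz(1)] op_mult[OF zeta_nz(2)] sigma0v_ops[folded h_def] sigma1_ops c)
qed

lemma cc_formula: "lmul DD * cc = P + Q + lmul (Const sg * shift_c)"
proof -
  obtain u where u: "lmul DD * cc = lmul 1 * P + lmul 1 * Q + lmul u"
    by (rule central_decomp[OF central_cc htop_cc cc_bot])
  obtain v where v: "v 0 = 1" "app cc v = app (sc (k0 ^ n * k1 ^ n + inverse (k0 ^ n * k1 ^ n))) v"
    "app P v = app (lmul (Const sg * (tri (inverse (k0 ^ n)) (\<eta> * C0v) * tri (inverse (k1 ^ n)) C1v))) v"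
    "app Q v = app (lmul (Const sg * (tri (k0 ^ n) (\<eta> * C0v) * tri (k1 ^ n) C1v))) v"
    by (rule eps_vector)
  \<comment> \<open>As v has coordinate 1 at the empty word, the operator identity becomes an
    equation for the polynomial \<open>u\<close>.\<close>
  from arg_cong[OF u, of "\<lambda>z. app z v 0"]
  have "u = Const sg * (ww * ww * Const (k0 ^ n * k1 ^ n + inverse (k0 ^ n * k1 ^ n)) - tri (inverse (k0 ^ n)) (\<eta> * C0v) * tri (inverse (k1 ^ n)) C1v
      - tri (k0 ^ n) (\<eta> * C0v) * tri (k1 ^ n) C1v)"
    by (simp add: v app_lmul app_sc DD_def lmul_one algebra_simps)
  also have "\<dots> = Const sg * shift_c"
    using shift_value[of "k0 ^ n" "k1 ^ n" "\<eta> * C0v" C1v, folded C0_def C1_def] nz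
    by (simp only: shift_c_def shift_scalars power_not_zero not_False_eq_True)
  finally show ?thesis using u by (simp add: lmul_one)
qed

lemma aa_formula:
  "lmul DD * aa = lmul (Const (- \<eta>) * Zp (- 1)) * P + lmul (Const (- \<eta>) * Zp 1) * Q + lmul (Const sg * shift_a)"
proof -
  obtain u where u: "lmul DD * aa = lmul (Const (- \<eta>) * Zp (- 1)) * P + lmul (Const (- \<eta>) * Zp 1) * Q + lmul u"
    by (rule central_decomp[OF central_aa htop_aa aa_bot])
  obtain v where v: "v 0 = 1" "app aa v = app (sc (k0v ^ n * k1 ^ n + inverse (k0v ^ n * k1 ^ n))) v"
    "app P v = app (lmul (Const (- \<eta> * sg) * Zp 1 * (tri (inverse (k0v ^ n)) (\<eta> * C0) * tri (inverse (k1 ^ n)) C1v))) v"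
    "app Q v = app (lmul (Const (- \<eta> * sg) * Zp (- 1) * (tri (k0v ^ n) (\<eta> * C0) * tri (k1 ^ n) C1v))) v"
    by (rule eps'_vector)
  have c: "Const (- \<eta>) * Zp k * (Const (- \<eta> * sg) * Zp (- k) * x) = Const sg * x"
    "Const (- \<eta>) * Zp (- k) * (Const (- \<eta> * sg) * Zp k * x) = Const sg * x" for x k
  proof -
    have "- \<eta> * (- \<eta> * sg) = sg" by (simp add: eta_left)
    then have e: "Const (- \<eta>) * Const (- \<eta> * sg) = (Const sg :: 'a lau)" by (simp only: Const_mult[symmetric])
    have "Const (- \<eta>) * Zp k * (Const (- \<eta> * sg) * Zp (- k) * x) = (Const (- \<eta>) * Const (- \<eta> * sg)) * (Zp k * Zp (- k)) * x"
      "Const (- \<eta>) * Zp (- k) * (Const (- \<eta> * sg) * Zp k * x) = (Const (- \<eta>) * Const (- \<eta> * sg)) * (Zp k * Zp (- k)) * x"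
      by (simp_all only: ac_simps)
    then show "Const (- \<eta>) * Zp k * (Const (- \<eta> * sg) * Zp (- k) * x) = Const sg * x"
      "Const (- \<eta>) * Zp (- k) * (Const (- \<eta> * sg) * Zp k * x) = Const sg * x"
      by (simp_all only: e Zp_inverse mult_1_right)
  qed
  have "DD * Const (k0v ^ n * k1 ^ n + inverse (k0v ^ n * k1 ^ n)) =
      Const sg * (tri (inverse (k0v ^ n)) (\<eta> * C0) * tri (inverse (k1 ^ n)) C1v) + Const sg * (tri (k0v ^ n) (\<eta> * C0) * tri (k1 ^ n) C1v) + u"
    using arg_cong[OF u, of "\<lambda>z. app z v 0"]
    by (simp only: v app_lmul app_sc app_simps plus_fun_apply mult_1_right c)
  then have "u = Const sg * (ww * ww * Const (k0v ^ n * k1 ^ n + inverse (k0v ^ n * k1 ^ n)) - tri (inverse (k0v ^ n)) (\<eta> * C0) * tri (inverse (k1 ^ n)) C1v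
      - tri (k0v ^ n) (\<eta> * C0) * tri (k1 ^ n) C1v)"
    by (simp add: DD_def algebra_simps)
  also have "\<dots> = Const sg * shift_a"
    using shift_value[of "k0v ^ n" "k1 ^ n" "\<eta> * C0" C1v, folded C0v_def C1_def] nz
    by (simp only: shift_a_def shift_scalars power_not_zero not_False_eq_True)
  finally show ?thesis using u by simp
qed

definition "norm_PQ = (beta * beta - 4 + Const C0 * Const C0 + (Const \<eta> * Const C0v) * (Const \<eta> * Const C0v) - Const \<eta> * Const C0v * Const C0 * beta)
  * (beta * beta - 4 + Const C1 * Const C1 + Const C1v * Const C1v - Const C1v * Const C1 * beta)"

text \<open>\<open>PQ_lau\<close> gives a multiplication operator, and \<open>P\<close> commutes
  with the value of \<open>Q\<close>; so the polynomial is the product of the two values on one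
  eigenvector.\<close>

lemma PQ_value: "P * Q = lmul norm_PQ"
proof -
  obtain N where N: "P * Q = lmul N" using PQ_lau by auto
  let ?p = "Const sg * (tri (inverse (k0 ^ n)) (\<eta> * C0v) * tri (inverse (k1 ^ n)) C1v)"
  let ?q = "Const sg * (tri (k0 ^ n) (\<eta> * C0v) * tri (k1 ^ n) C1v)"
  obtain v where v: "v 0 = 1" "app P v = app (lmul ?p) v" "app Q v = app (lmul ?q) v"
    by (rule eps_vector)
  have "app (P * Q) v = app (P * lmul ?q) v" using v(3) by simp
  also have "\<dots> = app (lmul ?q) (app (lmul ?p) v)" by (simp only: PQ_lmul app_simps v(2))
  finally have "app (lmul N) v 0 = app (lmul ?q) (app (lmul ?p) v) 0"
    by (simp only: N)
  then have "N = ?q * ?p"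
    by (simp only: app_lmul v(1) mult_1_right)
  also have "\<dots> = (Const sg * Const sg) * ((tri (inverse (k0 ^ n)) (\<eta> * C0v) * tri (k0 ^ n) (\<eta> * C0v)) * (tri (inverse (k1 ^ n)) C1v * tri (k1 ^ n) C1v))"
    by (simp only: ac_simps)
  also have "\<dots> = norm_PQ"
    using nz by (simp add: norm_value norm_PQ_def C0_def C1_def sg_sg Const_one flip: Const_mult)
  finally show ?thesis using N by simp
qed

lemma lmul_central: "x \<in> {aa, cc} \<Longrightarrow> x * lmul f = lmul f * x"
  using central_commute[OF central_aa Himg_lmul] central_commute[OF central_cc Himg_lmul] by blast

lemma product_expand:
  "(lmul p * aa + lmul r * cc - lmul t) * (lmul p' * aa + lmul r' * cc - lmul t') =
    lmul (p * p') * (aa * aa) + lmul (p * r' + r * p') * (aa * cc) + lmul (r * r') * (cc * cc)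
    - lmul (p * t' + t * p') * aa - lmul (r * t' + t * r') * cc + lmul (t * t')"
proof -
  have m: "(lmul f * x) * (lmul g * y) = lmul (f * g) * (x * y)" if "x \<in> {aa, cc}" for f g x y
  proof -
    have "(lmul f * x) * (lmul g * y) = lmul f * (x * lmul g) * y" by (simp only: mult.assoc)
    then show ?thesis by (simp only: lmul_central[OF that] lmul_mult mult.assoc)
  qed
  have m': "(lmul f * x) * lmul g = lmul (f * g) * x" if "x \<in> {aa, cc}" for f g x
    using m[OF that, of f g 1] by simp
  have ca: "cc * aa = aa * cc" using central_commute[OF central_cc Himg_aa] .
  show ?thesis
    by (simp add: algebra_simps m m' lmul_add lmul_lmul ca flip: mult.assoc lmul_mult)
      (simp only: mult.assoc ca)
qed

lemma torsion_free:
  assumes "f \<noteq> 0" "z \<in> Himg" "lmul f * z = 0"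
  shows "z = 0"
proof (rule Himg_faithful[OF assms(2)], rule ext)
  fix j
  have "f * app z e0 j = app (lmul f * z) e0 j" by (simp add: app_lmul)
  also have "\<dots> = 0" by (simp add: assms(3))
  finally show "app z e0 j = 0 j" using assms(1) by simp
qed

text \<open>The combinations of \<open>D a\<close> and \<open>D c\<close> in which \<open>Q\<close>,
  respectively \<open>P\<close>, drops out.\<close>

lemma lmul_eta_P_Q:
  "lmul DD * aa + lmul (Const \<eta> * Zp 1 * DD) * cc - lmul (Const sg * (shift_a + Const \<eta> * Zp 1 * shift_c)) = lmul (Const \<eta> * ww) * P"
  "lmul DD * aa + lmul (Const \<eta> * Zp (- 1) * DD) * cc - lmul (Const sg * (shift_a + Const \<eta> * Zp (- 1) * shift_c)) = lmul (- (Const \<eta> * ww)) * Q"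
proof -
  have cc: "lmul (Const \<eta> * Zp k * DD) * cc = lmul (Const \<eta> * Zp k) * (P + Q + lmul (Const sg * shift_c))" for k
    by (simp only: lmul_mult[of "Const \<eta> * Zp k" DD] mult.assoc[of _ "lmul DD"] cc_formula)
  show "lmul DD * aa + lmul (Const \<eta> * Zp 1 * DD) * cc - lmul (Const sg * (shift_a + Const \<eta> * Zp 1 * shift_c)) = lmul (Const \<eta> * ww) * P"
    "lmul DD * aa + lmul (Const \<eta> * Zp (- 1) * DD) * cc - lmul (Const sg * (shift_a + Const \<eta> * Zp (- 1) * shift_c)) = lmul (- (Const \<eta> * ww)) * Q"
    unfolding cc aa_formula
    by (simp_all add: ww_def Const_uminus distrib_left distrib_right left_diff_distrib right_diff_distrib
        lmul_add lmul_diff lmul_uminus mult.left_commute[of "Const sg"] flip: lmul_mult)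
qed

text \<open>Multiplying the two equations of \<open>lmul_eta_P_Q\<close> leaves \<open>P Q\<close>
  on the right, a known polynomial. The sums of the free terms supply the coefficients of
  \<open>aa\<close> and \<open>cc\<close>, all divisible by D^2.\<close>

lemma center_relation: "sc al * aa + sc mu * bb + sc ga * cc = sc \<eta> * aa * bb * cc + aa * aa + bb * bb + cc * cc + sc ps"
proof -
  let ?E = "Const \<eta> :: 'a lau" and ?A = "Const al :: 'a lau" and ?G = "Const ga :: 'a lau" and ?s = "Const sg :: 'a lau"
  define u1 where "u1 = ?s * (shift_a + ?E * Zp 1 * shift_c)"
  define u2 where "u2 = ?s * (shift_a + ?E * Zp (- 1) * shift_c)"
  define K where "K = beta * beta - Const mu * beta + Const ps"
  have E: "?E * ?E = 1" and s: "?s * ?s = 1"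
    by (simp_all add: eta_eta sg_sg Const_one flip: Const_mult)
  have Z: "Zp 1 * Zp (- 1) = (1 :: 'a lau)" by simp
  have u: "u1 = ?s * (ww * (?A * Zp 1 - ?E * ?G))" "u2 = ?s * (ww * (?E * ?G - ?A * Zp (- 1)))"
    unfolding u1_def u2_def shift_a_def shift_c_def Const_mult Const_numeral beta_def ww_def
    by (simp_all only: shift_factor[OF Z E])
  note shift_sums = shift_sums[OF Z E]
  have D: "DD = ?s * (ww * (Zp 1 - Zp (- 1)))"
    by (simp add: DD_def ww_def)
  have sum1: "u1 + u2 = DD * ?A" and sum2: "?E * Zp 1 * u2 + ?E * Zp (- 1) * u1 = DD * ?G"
    unfolding u D by (rule shift_sums)+
  have "DD * u2 + u1 * DD = DD * (u1 + u2)"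
    "(?E * Zp 1 * DD) * u2 + u1 * (?E * Zp (- 1) * DD) = DD * (?E * Zp 1 * u2 + ?E * Zp (- 1) * u1)"
    by (simp_all add: algebra_simps)
  then have sums: "DD * u2 + u1 * DD = DD * DD * ?A"
    "(?E * Zp 1 * DD) * u2 + u1 * (?E * Zp (- 1) * DD) = DD * DD * ?G"
    by (simp_all only: sum1 sum2 mult.assoc[of DD DD])
  have sums': "DD * (?E * Zp (- 1) * DD) + (?E * Zp 1 * DD) * DD = DD * DD * (?E * beta)"
    by (simp add: beta_def algebra_simps)
  have "(?E * Zp 1 * DD) * (?E * Zp (- 1) * DD) = (?E * Zp 1 * (?E * Zp (- 1))) * (DD * DD)"
    by (simp only: ac_simps)
  then have sums'': "(?E * Zp 1 * DD) * (?E * Zp (- 1) * DD) = DD * DD"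
    by (simp only: shift_sums(5) mult_1_left)
  have bb: "beta * beta - 4 = ww * ww"
    unfolding beta_def ww_def by (rule shift_sums)
  have "norm_PQ - ?A * ?A - ?G * ?G + ?E * ?A * ?G * beta = (beta * beta - 4) * K"
    unfolding norm_PQ_def K_def
    by (rule relation_identity[OF E])
      (simp_all add: al_def mu_def ga_def ps_def Const_add Const_diff Const_mult Const_numeral)
  then have norm: "norm_PQ = ww * ww * K + ?A * ?A + ?G * ?G - ?E * ?A * ?G * beta"
    unfolding bb by (simp add: algebra_simps)
  \<comment> \<open>The quadratic form in \<open>al\<close> and \<open>ga\<close> from
    \<open>u1 * u2\<close> cancels the one in \<open>norm_PQ\<close>, leaving D^2 times the part
    \<open>K\<close> in \<open>beta\<close> alone.\<close>
  have last: "u1 * u2 + ww * ww * norm_PQ = DD * DD * K"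
  proof -
    have "u1 * u2 = (?s * ?s) * (ww * ww) * ((?A * Zp 1 - ?E * ?G) * (?E * ?G - ?A * Zp (- 1)))"
      unfolding u by (simp only: ac_simps)
    also have "(?A * Zp 1 - ?E * ?G) * (?E * ?G - ?A * Zp (- 1)) = ?E * ?A * ?G * beta - ?A * ?A - ?G * ?G"
      unfolding beta_def by (rule shift_sums)
    finally have "u1 * u2 + ww * ww * norm_PQ = ww * ww * (ww * ww * K)"
      unfolding norm s by (simp add: algebra_simps)
    also have "\<dots> = (?s * ?s) * (ww * ww * (ww * ww * K))" by (simp only: s mult_1_left)
    also have "\<dots> = DD * DD * K" by (simp only: DD_def ac_simps)
    finally show ?thesis .
  qed
  have "(lmul DD * aa + lmul (?E * Zp 1 * DD) * cc - lmul u1) * (lmul DD * aa + lmul (?E * Zp (- 1) * DD) * cc - lmul u2)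
      = lmul (?E * ww) * P * (lmul (- (?E * ww)) * Q)"
    unfolding u1_def u2_def lmul_eta_P_Q ..
  also have "\<dots> = lmul (?E * ww) * (P * lmul (- (?E * ww))) * Q"
    by (simp only: mult.assoc)
  also have "\<dots> = lmul ((?E * ww) * (- (?E * ww)) * norm_PQ)"
    by (simp only: PQ_lmul lmul_mult PQ_value[symmetric] mult.assoc)
  also have "(?E * ww) * (- (?E * ww)) = - (ww * ww)"
  proof -
    have "(?E * ww) * (- (?E * ww)) = - ((?E * ?E) * (ww * ww))"
      by (simp only: mult_minus_right ac_simps)
    then show ?thesis by (simp only: E mult_1_left)
  qed
  finally have "lmul (DD * DD) * (aa * aa) + lmul (DD * DD * (?E * beta)) * (aa * cc) + lmul (DD * DD) * (cc * cc)
    - lmul (DD * DD * ?A) * aa - lmul (DD * DD * ?G) * cc + lmul (u1 * u2) = lmul (- (ww * ww) * norm_PQ)"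
    unfolding product_expand sums sums' sums'' .
  moreover have "lmul (u1 * u2) = lmul (DD * DD * K) - lmul (ww * ww * norm_PQ)"
    unfolding last[symmetric] lmul_add by simp
  moreover have "lmul (- (ww * ww) * norm_PQ) = - lmul (ww * ww * norm_PQ)"
    by (simp only: mult_minus_left lmul_uminus)
  ultimately have "lmul (DD * DD) * (aa * aa) + lmul (DD * DD * (?E * beta)) * (aa * cc) + lmul (DD * DD) * (cc * cc)
    - lmul (DD * DD * ?A) * aa - lmul (DD * DD * ?G) * cc + lmul (DD * DD * K) = 0"
    by simp
  then have "lmul (DD * DD) * (aa * aa + lmul (?E * beta) * (aa * cc) + cc * cc - lmul ?A * aa - lmul ?G * cc + lmul K) = 0"
    by (simp only: distrib_left right_diff_distrib lmul_lmul lmul_mult[of "DD * DD" K])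
  moreover have "DD * DD \<noteq> 0"
    using ww_nonzero s by (auto simp: DD_def)
  moreover have "aa * aa + lmul (?E * beta) * (aa * cc) + cc * cc - lmul ?A * aa - lmul ?G * cc + lmul K \<in> Himg"
    by (intro Himg_add Himg_diff Himg_mult Himg_lmul Himg_aa Himg_cc)
  ultimately have R: "aa * aa + lmul (?E * beta) * (aa * cc) + cc * cc - lmul ?A * aa - lmul ?G * cc + lmul K = 0"
    by (rule torsion_free[rotated 2])
  have "sc \<eta> * aa * bb * cc = sc \<eta> * (aa * lmul beta) * cc"
    by (simp only: bb_eq mult.assoc)
  also have "\<dots> = lmul (?E * beta) * (aa * cc)"
    by (simp add: lmul_central sc_def lmul_mult mult.assoc)
  finally have 1: "sc \<eta> * aa * bb * cc = lmul (?E * beta) * (aa * cc)" .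
  have 2: "lmul K = bb * bb - sc mu * bb + sc ps"
    by (simp add: K_def bb_eq sc_def lmul_add lmul_diff lmul_mult)
  from R show ?thesis
    unfolding 1 2 by (simp add: algebra_simps sc_def[symmetric])
qed

end

section \<open>The presentation\<close>

lemma mult_interchange:
  fixes a b c a' b' c' :: "'r::semigroup_mult"
  assumes "b * a' = a' * b" "c * a' = a' * c" "c * b' = b' * c"
  shows "a * b * c * (a' * b' * c') = (a * a') * (b * b') * (c * c')"
proof -
  have "a * b * c * (a' * b' * c') = a * b * (c * a') * b' * c'"
    by (simp only: mult.assoc)
  also have "\<dots> = a * (b * a') * (c * b') * c'"
    by (simp only: assms(2) mult.assoc)
  also have "\<dots> = (a * a') * (b * b') * (c * c')"
    by (simp only: assms(1,3) mult.assoc)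
  finally show ?thesis .
qed

context daha_root
begin

definition mono_op :: "(var3 \<Rightarrow>\<^sub>0 nat) \<Rightarrow> 'a vec endo" where
  "mono_op m = aa ^ Poly_Mapping.lookup m VA * bb ^ Poly_Mapping.lookup m VB * cc ^ Poly_Mapping.lookup m VC"

lemma central_mono_op: "central (mono_op m)"
  by (simp add: mono_op_def central_mult central_power central_aa central_bb central_cc)

sublocale PHI: monoid_alg_eval sc mono_op
proof
  fix m m' :: "var3 \<Rightarrow>\<^sub>0 nat" and x :: 'a
  have *: "x ^ i * y = y * x ^ i" if "central x" "central y" for x y and i :: nat
    using central_commute[OF central_power[OF that(1)] central_Himg[OF that(2)]] .
  let ?l = "Poly_Mapping.lookup"
  have "mono_op m * mono_op m' = (aa ^ ?l m VA * aa ^ ?l m' VA) * (bb ^ ?l m VB * bb ^ ?l m' VB) * (cc ^ ?l m VC * cc ^ ?l m' VC)"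
    unfolding mono_op_def
    by (rule mult_interchange) (intro * central_power central_aa central_bb central_cc)+
  then show "mono_op (m + m') = mono_op m * mono_op m'"
    by (simp add: mono_op_def lookup_add power_add)
  show "mono_op m * sc x = sc x * mono_op m"
    by (rule Himg_sc_commute[OF central_Himg[OF central_mono_op]])
qed (simp add: mono_op_def)

abbreviation "Phi \<equiv> PHI.ev"

lemma Phi_var: "Phi (poly_var VA) = aa" "Phi (poly_var VB) = bb" "Phi (poly_var VC) = cc"
  by (simp_all add: poly_var_def PHI.ev_single sc_one mono_op_def lookup_single)

lemma central_Phi: "central (Phi p)"
  by (induction p rule: poly_mapping_induct_single)
    (simp_all add: PHI.ev_zero PHI.ev_add PHI.ev_single central_add central_mult central_sc central_mono_op
      central_sc[of 0, unfolded sc_zero])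

lemma range_Phi: "Set.range Phi = {z. central z}"
proof -
  have "z \<in> Set.range Phi" if "central z" for z
  proof (rule center_spanned[OF _ _ _ _ _ _ _ that])
    show "aa \<in> Set.range Phi" "bb \<in> Set.range Phi" "cc \<in> Set.range Phi"
      by (auto simp flip: Phi_var)
    show "sc c \<in> Set.range Phi" for c
      by (auto simp flip: PHI.ev_Const)
  qed (auto simp: central_Phi simp flip: PHI.ev_add PHI.ev_mult)
  then show ?thesis using central_Phi by auto
qed

definition "relator = center_relator q n (k0v + inverse k0v) (k1v + inverse k1v) (k0 + inverse k0)
  (inverse q * k1 + q * inverse k1)"

abbreviation "pA \<equiv> poly_var VA :: (var3, 'a) poly_alg"
abbreviation "pB \<equiv> poly_var VB :: (var3, 'a) poly_alg"
abbreviation "pC \<equiv> poly_var VC :: (var3, 'a) poly_alg"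

text \<open>Since q^n is a sign, T_n of q^-1 k1 + q k1^-1 is eta C1. Multiplying \<open>phi\<close>
  by q^n cancels this eta and moves it to the other product.\<close>

lemma relator_eq:
  "relator = Const al * pA + Const mu * pB + Const ga * pC
    - (Const \<eta> * pA * pB * pC + pA\<^sup>2 + pB\<^sup>2 + pC\<^sup>2 + Const ps)"
proof -
  have C: "cheb n (k0v + inverse k0v) = C0v" "cheb n (k1v + inverse k1v) = C1v" "cheb n (k0 + inverse k0) = C0"
    using nz by (simp_all add: cheb_inverse C0_def C0v_def C1v_def power_inverse)
  have i: "inverse q * k1 * (q * inverse k1) = 1"
    using nz by (simp add: field_simps)
  have X: "cheb n (inverse q * k1 + q * inverse k1) = \<eta> * C1"
    using q_powers by (simp add: cheb_inverse[OF i] C1_def power_mult_distrib power_inverse distrib_left)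
  have X2: "cheb (2 * n) (inverse q * k1 + q * inverse k1) = C1 * C1 - 2"
  proof -
    have "q ^ (2 * n) = 1" "inverse q ^ (2 * n) = 1"
      using eta_eta q_powers by (simp_all add: mult_2 power_add)
    then have "cheb (2 * n) (inverse q * k1 + q * inverse k1) = k1 ^ (2 * n) + inverse k1 ^ (2 * n)"
      by (simp add: cheb_inverse[OF i] power_mult_distrib)
    also have "\<dots> = C1 * C1 - 2"
    proof -
      have "k1 ^ (2 * n) = k1 ^ n * k1 ^ n" "inverse k1 ^ (2 * n) = inverse (k1 ^ n) * inverse (k1 ^ n)"
        by (simp_all add: mult_2 power_add power_inverse)
      then show ?thesis using nz by (simp add: C1_def algebra_simps)
    qed
    finally show ?thesis .
  qed
  have "q ^ n * phi n 0 (k0v + inverse k0v) (k1v + inverse k1v) (k0 + inverse k0) (inverse q * k1 + q * inverse k1) = al"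
    "q ^ n * phi n 1 (k0v + inverse k0v) (k1v + inverse k1v) (k0 + inverse k0) (inverse q * k1 + q * inverse k1) = mu"
    "q ^ n * phi n 2 (k0v + inverse k0v) (k1v + inverse k1v) (k0 + inverse k0) (inverse q * k1 + q * inverse k1) = ga"
    unfolding phi_def Let_def
    by (simp_all add: C X q_powers eta_left al_def mu_def ga_def distrib_left mult.assoc)
  moreover have "psi n (k0v + inverse k0v) (k1v + inverse k1v) (k0 + inverse k0) (inverse q * k1 + q * inverse k1) - 2 = ps"
    unfolding psi_def C X X2 by (simp add: ps_def power2_eq_square algebra_simps eta_left)
  ultimately show ?thesis
    by (simp add: relator_def center_relator_def Let_def flip: \<eta>_def)
qed

lemma Phi_relator: "Phi relator = 0"
proof -
  have "Phi relator = sc al * aa + sc mu * bb + sc ga * cc - (sc \<eta> * aa * bb * cc + aa * aa + bb * bb + cc * cc + sc ps)"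
    unfolding relator_eq by (simp add: PHI.ev_diff PHI.ev_add PHI.ev_mult PHI.ev_Const Phi_var power2_eq_square)
  then show ?thesis using center_relation by simp
qed

section \<open>The kernel of the evaluation map\<close>

definition "RJ = Idl\<^bsub>RT\<^esub> {relator}"

lemma RJ_ideal: "ideal RJ RT"
  unfolding RJ_def by (rule ring.genideal_ideal[OF ring_type]) simp

lemma RJ_add: "x \<in> RJ \<Longrightarrow> y \<in> RJ \<Longrightarrow> x + y \<in> RJ" and RJ_mult: "x \<in> RJ \<Longrightarrow> y * x \<in> RJ" and RJ_0: "0 \<in> RJ"
  using RJ_ideal by (auto simp: ideal_type_iff)

lemma relator_RJ: "relator \<in> RJ"
  using ring.genideal_self[OF ring_type, of "{relator}"] by (simp add: RJ_def)

lemma RJ_Phi: "x \<in> RJ \<Longrightarrow> Phi x = 0"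
proof -
  have "ideal {x. Phi x = 0} RT"
    by (auto simp: ideal_type_iff PHI.ev_zero PHI.ev_add PHI.ev_mult)
  then have "RJ \<subseteq> {x. Phi x = 0}"
    unfolding RJ_def by (rule ring.genideal_minimal[OF ring_type]) (simp add: Phi_relator)
  then show "x \<in> RJ \<Longrightarrow> Phi x = 0" by auto
qed

definition A_free :: "(var3, 'a) poly_alg set" where
  "A_free = {r. \<forall>m\<in>Poly_Mapping.keys r. Poly_Mapping.lookup m VA = 0}"

lemma A_free_add: "x \<in> A_free \<Longrightarrow> y \<in> A_free \<Longrightarrow> x + y \<in> A_free"
  using keys_add[of x y] by (auto simp: A_free_def)

lemma A_free_mult: "x \<in> A_free \<Longrightarrow> y \<in> A_free \<Longrightarrow> x * y \<in> A_free"
  using keys_mult[of x y] by (fastforce simp: A_free_def lookup_add)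

lemma A_free_gens: "Const c \<in> A_free" "pB \<in> A_free" "pC \<in> A_free"
  by (auto simp: A_free_def Const_def poly_var_def lookup_single)

lemma A_free_0: "0 \<in> A_free"
  by (simp add: A_free_def)

text \<open>The relator is quadratic in the first variable with leading coefficient -1, so division
  by it leaves remainders x + a y with x and y free of that variable.\<close>

definition "reduced = {p. \<exists>x\<in>A_free. \<exists>y\<in>A_free. p - (x + pA * y) \<in> RJ}"

lemma reducedI: "x \<in> A_free \<Longrightarrow> y \<in> A_free \<Longrightarrow> p - (x + pA * y) \<in> RJ \<Longrightarrow> p \<in> reduced"
  unfolding reduced_def by blast

lemma reduced_add: "p \<in> reduced \<Longrightarrow> p' \<in> reduced \<Longrightarrow> p + p' \<in> reduced"
proof -
  assume "p \<in> reduced" "p' \<in> reduced"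
  then obtain x y x' y' where *: "x \<in> A_free" "y \<in> A_free" "x' \<in> A_free" "y' \<in> A_free"
    "p - (x + pA * y) \<in> RJ" "p' - (x' + pA * y') \<in> RJ" unfolding reduced_def by blast
  have "p + p' - ((x + x') + pA * (y + y')) = (p - (x + pA * y)) + (p' - (x' + pA * y'))"
    by (simp add: algebra_simps)
  also have "\<dots> \<in> RJ"
    by (intro RJ_add *)
  finally show ?thesis
    by (rule reducedI[rotated 2]) (simp_all add: A_free_add *)
qed

lemma reduced_mult: "z \<in> A_free \<Longrightarrow> p \<in> reduced \<Longrightarrow> z * p \<in> reduced"
proof -
  assume z: "z \<in> A_free" and "p \<in> reduced"
  then obtain x y where *: "x \<in> A_free" "y \<in> A_free" "p - (x + pA * y) \<in> RJ" unfolding reduced_def by blast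
  have "z * p - (z * x + pA * (z * y)) = z * (p - (x + pA * y))"
    by (simp add: algebra_simps)
  also have "\<dots> \<in> RJ"
    by (intro RJ_mult *)
  finally show ?thesis
    by (rule reducedI[rotated 2]) (simp_all add: A_free_mult * z)
qed

lemma reduced_pA: "p \<in> reduced \<Longrightarrow> pA * p \<in> reduced"
proof -
  assume "p \<in> reduced"
  then obtain x y where *: "x \<in> A_free" "y \<in> A_free" "p - (x + pA * y) \<in> RJ" unfolding reduced_def by blast
  define u where "u = Const al + Const (- \<eta>) * (pB * pC)"
  define w where "w = Const mu * pB + Const ga * pC + Const (- 1) * (pB * pB) + Const (- 1) * (pC * pC) + Const (- ps)"
  have uw: "u \<in> A_free" "w \<in> A_free"
    by (simp_all add: u_def w_def A_free_add A_free_mult A_free_gens)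
  \<comment> \<open>The relator is solved for the square of the first variable.\<close>
  have "pA * pA = w + pA * u - relator"
    by (simp add: relator_eq u_def w_def Const_uminus Const_one power2_eq_square algebra_simps)
  then have "pA * pA - w - pA * u = - relator" by simp
  moreover have "pA * p - (w * y + pA * (x + u * y)) = pA * (p - (x + pA * y)) + y * (pA * pA - w - pA * u)"
    by (simp add: algebra_simps)
  ultimately have "pA * p - (w * y + pA * (x + u * y)) = pA * (p - (x + pA * y)) + (- y) * relator"
    by (simp only: mult_minus_left mult_minus_right)
  also have "\<dots> \<in> RJ"
    by (intro RJ_add RJ_mult relator_RJ *)
  finally show ?thesis
    by (rule reducedI[rotated 2]) (simp_all add: A_free_add A_free_mult * uw)
qed

lemma reduced_UNIV: "p \<in> reduced"
proof (induction p rule: poly_mapping_induct_single)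
  case zero
  then show ?case by (rule reducedI[of 0 0]) (simp_all add: A_free_0 RJ_0)
next
  case (add m c p)
  have one: "1 \<in> reduced"
    using A_free_gens(1)[of 1] by (intro reducedI[of 1 0]) (simp_all add: A_free_0 RJ_0 Const_one)
  have pow: "Poly_Mapping.single (Poly_Mapping.single v i) (1::'a) = poly_var v ^ i" for v :: var3 and i
  proof (induction i)
    case (Suc i)
    have "Poly_Mapping.single (Poly_Mapping.single v (Suc i)) (1::'a) = poly_var v * Poly_Mapping.single (Poly_Mapping.single v i) 1"
      by (simp add: poly_var_def mult_single flip: single_add)
    then show ?case by (simp only: Suc power_Suc)
  qed simp
  have m: "m = Poly_Mapping.single VA (Poly_Mapping.lookup m VA) + (Poly_Mapping.single VB (Poly_Mapping.lookup m VB)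
      + Poly_Mapping.single VC (Poly_Mapping.lookup m VC))"
  proof (rule poly_mapping_eqI)
    show "Poly_Mapping.lookup m k = Poly_Mapping.lookup (Poly_Mapping.single VA (Poly_Mapping.lookup m VA)
      + (Poly_Mapping.single VB (Poly_Mapping.lookup m VB) + Poly_Mapping.single VC (Poly_Mapping.lookup m VC))) k" for k
      by (cases k) (simp_all add: lookup_add lookup_single)
  qed
  have "Poly_Mapping.single m c = Const c * (pA ^ Poly_Mapping.lookup m VA * (pB ^ Poly_Mapping.lookup m VB * pC ^ Poly_Mapping.lookup m VC))"
    by (subst m) (simp add: Const_def mult_single flip: pow)
  moreover have pw: "x ^ i \<in> A_free" if "x \<in> A_free" for x i
    using that A_free_gens(1)[of 1] by (induction i) (simp_all add: A_free_mult Const_one)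
  have "pB ^ j * pC ^ k * 1 \<in> reduced" for j k
    by (intro reduced_mult[OF _ one] A_free_mult pw A_free_gens)
  then have "pA ^ i * (pB ^ j * pC ^ k) \<in> reduced" for i j k
    by (induction i) (simp_all add: reduced_pA mult.assoc)
  ultimately show ?case
    using add by (simp add: reduced_add reduced_mult A_free_gens)
qed

lemma beta_independent_inj:
  assumes "finite M" "inj_on f M" "(\<Sum>m\<in>M. Const (c m) * beta ^ f m) = 0"
  shows "\<forall>m\<in>M. c m = 0"
proof -
  have "(\<Sum>j\<in>f ` M. Const (c (inv_into M f j)) * beta ^ j) = (\<Sum>m\<in>M. Const (c m) * beta ^ f m)"
    by (subst sum.reindex[OF assms(2)]) (simp add: assms(2))
  with beta_independent[of "f ` M" "\<lambda>j. c (inv_into M f j)"] assms show ?thesis by simp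
qed

text \<open>\<open>cc\<close> has leading coordinate 1 and \<open>bb\<close> is multiplication by
  \<open>beta\<close>, so only monomials of degree r in the third variable reach index 2nr.\<close>

lemma htop_Phi_A_free:
  assumes x: "x \<in> A_free" and r: "\<And>m. m \<in> Poly_Mapping.keys x \<Longrightarrow> Poly_Mapping.lookup m VC \<le> r"
  shows "htop r (Phi x) (\<Sum>m\<in>{m \<in> Poly_Mapping.keys x. Poly_Mapping.lookup m VC = r}.
    Const (Poly_Mapping.lookup x m) * beta ^ Poly_Mapping.lookup m VB)"
proof -
  let ?f = "\<lambda>m. if Poly_Mapping.lookup m VC = r then Const (Poly_Mapping.lookup x m) * beta ^ Poly_Mapping.lookup m VB else 0"
  have "htop r (sc (Poly_Mapping.lookup x m) * mono_op m) (?f m)" if m: "m \<in> Poly_Mapping.keys x" for m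
  proof -
    let ?k = "Poly_Mapping.lookup m VC" and ?j = "Poly_Mapping.lookup m VB"
    have "htop (0 + (0 + 1 * ?k)) (lmul (Const (Poly_Mapping.lookup x m)) * (lmul (beta ^ ?j) * cc ^ ?k))
        (Const (Poly_Mapping.lookup x m) * (beta ^ ?j * 1 ^ ?k))"
      by (intro htop_mult htop_lmul htop_power htop_cc)
    moreover have "sc (Poly_Mapping.lookup x m) * mono_op m = lmul (Const (Poly_Mapping.lookup x m)) * (lmul (beta ^ ?j) * cc ^ ?k)"
      using x m by (simp add: A_free_def mono_op_def sc_def bb_eq lmul_power mult.assoc)
    ultimately have "htop ?k (sc (Poly_Mapping.lookup x m) * mono_op m) (Const (Poly_Mapping.lookup x m) * beta ^ ?j)"
      by simp
    then show ?thesis using r[OF m] htop_lift[of ?k _ _ r] by (cases "?k = r") auto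
  qed
  then have "htop r (\<Sum>m\<in>Poly_Mapping.keys x. sc (Poly_Mapping.lookup x m) * mono_op m) (\<Sum>m\<in>Poly_Mapping.keys x. ?f m)"
    by (intro htop_sum) auto
  moreover have "(\<Sum>m\<in>Poly_Mapping.keys x. sc (Poly_Mapping.lookup x m) * mono_op m) = Phi x"
    by (simp add: PHI.ev_def RHO.lin_def)
  moreover have "(\<Sum>m\<in>Poly_Mapping.keys x. ?f m) = (\<Sum>m\<in>{m \<in> Poly_Mapping.keys x. Poly_Mapping.lookup m VC = r}.
    Const (Poly_Mapping.lookup x m) * beta ^ Poly_Mapping.lookup m VB)"
    by (simp add: sum.inter_filter)
  ultimately show ?thesis by simp
qed

lemma top_terms_vanish:
  assumes x: "x \<in> A_free"
    and z: "(\<Sum>m\<in>{m \<in> Poly_Mapping.keys x. Poly_Mapping.lookup m VC = r}.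
      Const (Poly_Mapping.lookup x m) * beta ^ Poly_Mapping.lookup m VB) = 0"
    and m: "m \<in> Poly_Mapping.keys x"
  shows "Poly_Mapping.lookup m VC \<noteq> r"
proof
  assume r: "Poly_Mapping.lookup m VC = r"
  have "inj_on (\<lambda>m. Poly_Mapping.lookup m VB) {m \<in> Poly_Mapping.keys x. Poly_Mapping.lookup m VC = r}"
  proof (rule inj_onI)
    fix m m' assume *: "m \<in> {m \<in> Poly_Mapping.keys x. Poly_Mapping.lookup m VC = r}"
      "m' \<in> {m \<in> Poly_Mapping.keys x. Poly_Mapping.lookup m VC = r}" "Poly_Mapping.lookup m VB = Poly_Mapping.lookup m' VB"
    show "m = m'"
    proof (rule poly_mapping_eqI)
      show "Poly_Mapping.lookup m k = Poly_Mapping.lookup m' k" for k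
        using * x by (cases k) (auto simp: A_free_def)
    qed
  qed
  from beta_independent_inj[OF _ this z] have "Poly_Mapping.lookup x m = 0"
    using m r by simp
  with m show False by (simp add: in_keys_iff)
qed

text \<open>The leading coordinate is g - eta Z^-1 h, with g from the top degree of \<open>x\<close>
  in the third variable and h from that of \<open>y\<close>. \<open>Zp_independent\<close> separates
  the two, independence of the powers of \<open>beta\<close> kills their coefficients, and the
  degree descends.\<close>

lemma Phi_normal_form_zero:
  assumes x: "x \<in> A_free" and y: "y \<in> A_free" and z: "Phi (x + pA * y) = 0"
  shows "x = 0" "y = 0"
proof -
  let ?D = "\<lambda>x. (\<lambda>m. Poly_Mapping.lookup m VC) ` Poly_Mapping.keys (x :: (var3, 'a) poly_alg)"
  let ?g = "\<lambda>x r. \<Sum>m\<in>{m \<in> Poly_Mapping.keys x. Poly_Mapping.lookup m VC = r}.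
    Const (Poly_Mapping.lookup x m) * beta ^ Poly_Mapping.lookup m VB"
  have inv: "rfl 1 (?g x r) = ?g x r" for x r
  proof -
    have "rfl 1 (\<Sum>m\<in>M. Const (Poly_Mapping.lookup x m) * beta ^ Poly_Mapping.lookup m VB) =
        (\<Sum>m\<in>M. Const (Poly_Mapping.lookup x m) * beta ^ Poly_Mapping.lookup m VB)" if "finite M" for M :: "(var3 \<Rightarrow>\<^sub>0 nat) set"
      using that by (induction M rule: finite_induct) (simp_all add: rfl_simps rfl_beta)
    then show ?thesis by simp
  qed
  \<comment> \<open>The bound for \<open>y\<close> is one below that for \<open>x\<close>, because
    \<open>aa\<close> has the length of one factor \<open>cc\<close>.\<close>
  have main: "\<forall>j\<in>?D x. j < r + 1 \<Longrightarrow> \<forall>j\<in>?D y. j < r \<Longrightarrow> (\<forall>j\<in>?D x. j < r) \<and> (\<forall>j\<in>?D y. j < r - 1)" for r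
  proof -
    assume dx: "\<forall>j\<in>?D x. j < r + 1" and dy: "\<forall>j\<in>?D y. j < r"
    have hx: "htop r (Phi x) (?g x r)"
      using dx by (intro htop_Phi_A_free x) auto
    show ?thesis
    proof (cases r)
      case 0
      then have "y = 0" using dy by (metis bot_nat_0.not_eq_extremum empty_iff ex_in_conv image_is_empty keys_eq_empty not_less0)
      then have "htop r 0 (?g x r)" using z hx by simp
      then have g0: "?g x r = 0" by (simp add: htop_def)
      show ?thesis using top_terms_vanish[OF x g0] dx \<open>y = 0\<close> by (auto simp: less_Suc_eq)
    next
      case (Suc r')
      have hy: "htop r' (Phi y) (?g y r')"
        using dy Suc by (intro htop_Phi_A_free y) (auto simp: less_Suc_eq_le)
      have "htop (1 + r') (aa * Phi y) (Const (- \<eta>) * Zp (- 1) * ?g y r')"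
        by (rule htop_mult[OF htop_aa hy])
      with hx have "htop r (Phi x + aa * Phi y) (?g x r + Const (- \<eta>) * Zp (- 1) * ?g y r')"
        by (intro htop_add) (simp_all add: Suc)
      moreover have "Phi x + aa * Phi y = 0"
        using z by (simp add: PHI.ev_add PHI.ev_mult Phi_var)
      ultimately have "htop r 0 (?g x r + Const (- \<eta>) * Zp (- 1) * ?g y r')"
        by (simp only:)
      then have "?g x r + Const (- \<eta>) * Zp (- 1) * ?g y r' = 0"
        by (simp add: htop_def)
      then have e: "?g x r + Zp (- 1) * (Const (- \<eta>) * ?g y r') = 0"
        by (simp add: ac_simps)
      have i: "rfl 1 (Const (- \<eta>) * ?g y r') = Const (- \<eta>) * ?g y r'"
        unfolding rfl_simps(4)[OF r1] rfl_simps(7)[OF r1] inv ..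
      have gx: "?g x r = 0" by (rule Zp_independent(1)[OF inv i e])
      have "Const (- \<eta>) * ?g y r' = 0" by (rule Zp_independent(2)[OF inv i e])
      moreover have "Const (- \<eta>) \<noteq> (0 :: 'a lau)"
      proof
        assume "Const (- \<eta>) = (0 :: 'a lau)"
        then have "Poly_Mapping.lookup (Const (- \<eta>) :: 'a lau) 0 = 0" by simp
        with eta_nz show False by (simp add: Const_def)
      qed
      ultimately have gy: "?g y r' = 0" by simp
      show ?thesis
        using top_terms_vanish[OF x gx] top_terms_vanish[OF y gy] dx dy Suc by (auto simp: less_Suc_eq)
    qed
  qed
  have all: "(\<forall>j\<in>?D x. j < r + 1) \<Longrightarrow> (\<forall>j\<in>?D y. j < r) \<Longrightarrow> x = 0 \<and> y = 0" for r
  proof (induction r)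
    case 0
    then have "\<forall>j\<in>?D x. j < 0" "\<forall>j\<in>?D y. j < 0" using main[of 0] by auto
    then have "?D x = {}" "?D y = {}" by auto
    then show ?case by (simp add: keys_eq_empty)
  next
    case (Suc r)
    from main[OF Suc.prems] have "(\<forall>j\<in>?D x. j < r + 1)" "(\<forall>j\<in>?D y. j < r)" by auto
    then show ?case by (rule Suc.IH)
  qed
  have "finite (?D x \<union> ?D y)" by simp
  then obtain r where r: "\<forall>j\<in>?D x \<union> ?D y. j < r" by (metis finite_nat_set_iff_bounded)
  have "\<forall>j\<in>?D x. j < r + 1" "\<forall>j\<in>?D y. j < r"
    using r less_SucI unfolding ball_Un by auto
  from all[OF this] show "x = 0" "y = 0" by simp_all
qed

lemma Phi_kernel: "Phi p = 0 \<longleftrightarrow> p \<in> RJ"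
proof
  assume p: "Phi p = 0"
  from reduced_UNIV[of p] obtain x y where *: "x \<in> A_free" "y \<in> A_free" "p - (x + pA * y) \<in> RJ"
    unfolding reduced_def by blast
  from RJ_Phi[OF *(3)] p have "Phi (x + pA * y) = 0" by (simp add: PHI.ev_diff)
  from Phi_normal_form_zero[OF *(1,2) this] *(3) show "p \<in> RJ" by simp
qed (rule RJ_Phi)

section \<open>Transfer to the quotient ring\<close>

abbreviation "HH \<equiv> daha q k0 k1 k0v k1v"
abbreviation "cls \<equiv> daha_class q k0 k1 k0v k1v"

text \<open>By \<open>cls_eq\<close> these fibres are the cosets of the defining ideal; indexing
  them by operators turns computations in the quotient into computations in
  \<open>Himg\<close>.\<close>

definition "fib e = {x. rho x = e}"

lemma HH_eq: "HH = RT Quot DI"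
  by (simp add: daha_def DI_def)

lemma cls_coset: "cls x = DI +>\<^bsub>RT\<^esub> x"
  by (simp add: daha_class_def DI_def)

lemma cls_eq: "cls x = fib (rho x)"
proof -
  have "y \<in> cls x \<longleftrightarrow> y - x \<in> DI" for y
    unfolding cls_coset a_r_coset_def' by (auto intro!: bexI[of _ "y - x"])
  then show ?thesis
    by (auto simp: fib_def RHO.ev_diff simp flip: rho_kernel)
qed

lemma ring_HH: "ring HH"
  unfolding HH_eq by (rule ideal.quotient_is_ring[OF DI_ideal])

lemma carrier_HH: "carrier HH = fib ` Himg"
proof -
  have "carrier HH = Set.range cls"
    unfolding HH_eq FactRing_def A_RCOSETS_def' cls_coset by auto
  then show ?thesis by (auto simp: cls_eq Himg_def)
qed

lemma fib_hom:
  assumes "x \<in> Himg" "y \<in> Himg"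
  shows "fib x \<otimes>\<^bsub>HH\<^esub> fib y = fib (x * y)" "fib x \<oplus>\<^bsub>HH\<^esub> fib y = fib (x + y)"
proof -
  obtain u w where uw: "x = rho u" "y = rho w" using assms by (auto simp: Himg_def)
  note hom = ideal.rcos_ring_hom[OF DI_ideal, folded HH_eq]
  have "cls u \<otimes>\<^bsub>HH\<^esub> cls w = cls (u * w)" "cls u \<oplus>\<^bsub>HH\<^esub> cls w = cls (u + w)"
    using ring_hom_mult[OF hom, of u w] ring_hom_add[OF hom, of u w] by (simp_all add: cls_coset)
  then show "fib x \<otimes>\<^bsub>HH\<^esub> fib y = fib (x * y)" "fib x \<oplus>\<^bsub>HH\<^esub> fib y = fib (x + y)"
    by (simp_all add: cls_eq uw RHO.ev_mult RHO.ev_add)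
qed

lemma fib_one: "\<one>\<^bsub>HH\<^esub> = fib 1"
proof -
  have "\<one>\<^bsub>HH\<^esub> = cls 1"
    using ring_hom_one[OF ideal.rcos_ring_hom[OF DI_ideal, folded HH_eq]] by (simp add: cls_coset)
  then show ?thesis by (simp add: cls_eq RHO.ev_one)
qed

lemma fib_inj: "x \<in> Himg \<Longrightarrow> fib x = fib y \<Longrightarrow> x = y"
  unfolding Himg_def fib_def by blast

lemma fib_carrier: "x \<in> Himg \<Longrightarrow> fib x \<in> carrier HH"
  by (simp add: carrier_HH)

lemma fib_zero: "\<zero>\<^bsub>HH\<^esub> = fib 0"
proof -
  interpret ring HH by (rule ring_HH)
  have z: "0 \<in> Himg" using Himg_sc[of 0] by (simp add: sc_zero)
  have "fib 0 \<oplus>\<^bsub>HH\<^esub> fib 0 = fib 0" using fib_hom(2)[OF z z] by simp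
  then show ?thesis using fib_carrier[OF z] by (metis r_zero add.l_cancel zero_closed)
qed

lemma fib_uminus: "x \<in> Himg \<Longrightarrow> \<ominus>\<^bsub>HH\<^esub> fib x = fib (- x)"
proof -
  assume x: "x \<in> Himg"
  interpret ring HH by (rule ring_HH)
  have x': "- x \<in> Himg" using Himg_diff[OF _ x, of 0] Himg_sc[of 0] by (simp add: sc_zero)
  show ?thesis
    by (rule minus_equality) (simp_all add: fib_hom x x' fib_carrier fib_zero)
qed

lemma fib_minus: "x \<in> Himg \<Longrightarrow> y \<in> Himg \<Longrightarrow> fib x \<ominus>\<^bsub>HH\<^esub> fib y = fib (x - y)"
  using Himg_diff[of 0 y] Himg_sc[of 0] by (simp add: a_minus_def fib_uminus fib_hom sc_zero)

lemma fib_inverse: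
  assumes "x \<in> Himg" "y \<in> Himg" "x * y = 1" "y * x = 1"
  shows "inv\<^bsub>HH\<^esub> fib x = fib y"
proof -
  interpret ring HH by (rule ring_HH)
  show ?thesis
    by (rule inv_unique'[symmetric]) (simp_all add: assms fib_carrier fib_hom fib_one)
qed

lemma Himg_ncheb: "x \<in> Himg \<Longrightarrow> ncheb m x \<in> Himg"
proof (induction m rule: induct_nat_012)
  case 0
  then show ?case using Himg_add[OF Himg_one Himg_one] by simp
qed (simp_all add: Himg_diff Himg_mult)

lemma cheb_in_fib: "x \<in> Himg \<Longrightarrow> cheb_in HH m (fib x) = fib (ncheb m x)"
proof (induction m rule: induct_nat_012)
  case 0
  then show ?case using fib_hom(2)[OF Himg_one Himg_one] by (simp add: fib_one)
next
  case (ge2 m)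
  then show ?case by (simp add: fib_hom fib_minus Himg_ncheb Himg_mult del: ncheb.simps(3) add: ncheb.simps(3)[of m x])
qed simp

lemma cheb_in_trace:
  assumes "x \<in> Himg" "y \<in> Himg" "x * y = 1" "y * x = 1"
  shows "cheb_in HH m (fib x \<oplus>\<^bsub>HH\<^esub> inv\<^bsub>HH\<^esub> fib x) = fib (x ^ m + y ^ m)"
  by (simp add: fib_inverse[OF assms] fib_hom assms cheb_in_fib Himg_add ncheb_inverse)

lemma ring_center_HH: "ring_center HH = fib ` {z. central z}"
proof -
  have "fib x \<otimes>\<^bsub>HH\<^esub> fib y = fib y \<otimes>\<^bsub>HH\<^esub> fib x \<longleftrightarrow> x * y = y * x" if "x \<in> Himg" "y \<in> Himg" for x y
    using that fib_inj[of "x * y" "y * x"] by (auto simp: fib_hom Himg_mult)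
  then show ?thesis
    unfolding ring_center_def carrier_HH central_def by auto
qed

text \<open>The first isomorphism theorem for \<open>Phi\<close> followed by \<open>fib\<close>:
  \<open>Phi_kernel\<close> identifies the kernel and \<open>range_Phi\<close> the image.\<close>

lemma presentation:
  "presented_by HH (\<lambda>c. cls (Const c)) (ring_center HH) (\<lambda>v. fib (Phi (poly_var v))) {relator}"
proof -
  define h where "h p = fib (Phi p)" for p
  have H: "Phi p \<in> Himg" for p by (rule central_Himg[OF central_Phi])
  interpret h: ring_hom_ring RT HH h
    by (rule ring_hom_ringI[OF ring_type ring_HH])
      (simp_all add: h_def fib_carrier H fib_hom PHI.ev_mult PHI.ev_add PHI.ev_one fib_one)
  have ker: "a_kernel RT HH h = RJ"
    unfolding a_kernel_def' h_def fib_zero using fib_inj[OF H] by (auto simp flip: Phi_kernel)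
  have im: "h ` carrier RT = ring_center HH"
    unfolding ring_center_HH range_Phi[symmetric] by (auto simp: h_def)
  have "subring (ring_center HH) HH"
    using h.img_is_subring[OF ring.carrier_is_subring[OF ring_type]] by (simp only: im)
  moreover have "(\<lambda>Y. the_elem (h ` Y)) \<in> ring_iso (RT Quot RJ) (HH\<lparr>carrier := ring_center HH\<rparr>)"
    using h.FactRing_iso_set_aux by (simp only: ker im)
  moreover have "the_elem (h ` (RJ +>\<^bsub>RT\<^esub> p)) = fib (Phi p)" for p
    using h.the_elem_simp[of p] by (simp add: ker h_def)
  ultimately show ?thesis
    unfolding presented_by_def Let_def RJ_def[symmetric]
    by (intro conjI bexI[of _ "\<lambda>Y. the_elem (h ` Y)"]) (simp_all add: cls_eq RHO.ev_Const PHI.ev_Const)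
qed

lemma presentation_generators:
  "fib (Phi (poly_var v)) = (case v of
      VA \<Rightarrow> cheb_in HH n ((cls g1 \<otimes>\<^bsub>HH\<^esub> cls g0v) \<oplus>\<^bsub>HH\<^esub> inv\<^bsub>HH\<^esub> (cls g1 \<otimes>\<^bsub>HH\<^esub> cls g0v))
    | VB \<Rightarrow> cheb_in HH n ((cls g1v \<otimes>\<^bsub>HH\<^esub> cls g1) \<oplus>\<^bsub>HH\<^esub> inv\<^bsub>HH\<^esub> (cls g1v \<otimes>\<^bsub>HH\<^esub> cls g1))
    | VC \<Rightarrow> cheb_in HH n ((cls g0 \<otimes>\<^bsub>HH\<^esub> cls g1) \<oplus>\<^bsub>HH\<^esub> inv\<^bsub>HH\<^esub> (cls g0 \<otimes>\<^bsub>HH\<^esub> cls g1)))"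
proof -
  note H = Himg_mult Himg_T Himg_T' Himg_T0v' Himg_T1v'
  show ?thesis
    by (cases v) (simp_all add: cls_eq rho_gen fib_hom H Phi_var aa_def bb_def cc_def
      cheb_in_trace[OF _ _ mult_inverses[OF T0v_inv(1) T1_inv(1)] mult_inverses[OF T1_inv(2) T0v_inv(2)]]
      cheb_in_trace[OF _ _ mult_inverses[OF T1_inv(1) T1v_inv(1)] mult_inverses[OF T1v_inv(2) T1_inv(2)]]
      cheb_in_trace[OF _ _ mult_inverses[OF T1_inv(1) T0_inv(1)] mult_inverses[OF T0_inv(2) T1_inv(2)]])
qed

end

text \<open>For odd d, 2 is invertible modulo d, so q^2 has the same order. For even d, q^(d/2) is a
  square root of 1 other than 1, hence -1.\<close>

lemma daha_root_dbar:
  fixes q k0 k1 k0v k1v :: "'a::field" and d :: nat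
  assumes "d \<ge> 1" "primitive_root_of_unity d q" "k0 \<noteq> 0" "k1 \<noteq> 0" "k0v \<noteq> 0" "k1v \<noteq> 0"
  shows "daha_root q k0 k1 k0v k1v (dbar d)"
proof -
  have d: "q ^ d = 1" "\<And>m. 0 < m \<Longrightarrow> m < d \<Longrightarrow> q ^ m \<noteq> 1"
    using assms(2) by (auto simp: primitive_root_of_unity_def)
  have q: "q \<noteq> 0" using d(1) assms(1) by (auto simp: power_0_left)
  have ord: "q ^ m = 1 \<longleftrightarrow> d dvd m" for m
  proof -
    have "q ^ m = (q ^ d) ^ (m div d) * q ^ (m mod d)"
      by (simp flip: power_mult power_add)
    then have "q ^ m = q ^ (m mod d)" by (simp add: d(1))
    moreover have "q ^ (m mod d) = 1 \<longleftrightarrow> m mod d = 0"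
      using d(2)[of "m mod d"] assms(1) by (cases "m mod d = 0") auto
    ultimately show ?thesis by (simp add: dvd_eq_mod_eq_0)
  qed
  have ordi: "q powi m = 1 \<longleftrightarrow> int d dvd m" for m
  proof (cases "m \<ge> 0")
    case True
    then show ?thesis using ord[of "nat m"] by (simp add: power_int_def int_dvd_int_iff[symmetric])
  next
    case False
    then show ?thesis
      using ord[of "nat (- m)"] by (simp add: power_int_def power_inverse int_dvd_int_iff[symmetric])
  qed
  show ?thesis
  proof
    show "q \<noteq> 0" "k0 \<noteq> 0" "k1 \<noteq> 0" "k0v \<noteq> 0" "k1v \<noteq> 0" using q assms by simp_all
    show "dbar d > 0" using assms(1) by (auto simp: dbar_def elim!: evenE)
    show "q powi (2 * m) = 1 \<longleftrightarrow> int (dbar d) dvd m" for m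
    proof (cases "odd d")
      case True
      then have "coprime (int d) 2" by simp
      then show ?thesis using True by (simp add: ordi dbar_def coprime_dvd_mult_right_iff)
    next
      case False
      then obtain e where "d = 2 * e" by (auto elim: evenE)
      then show ?thesis by (simp add: ordi dbar_def)
    qed
    show "odd (dbar d) \<and> q ^ dbar d = 1 \<or> q ^ dbar d = - 1"
    proof (cases "odd d")
      case True
      then show ?thesis by (simp add: dbar_def d(1))
    next
      case False
      then obtain e where e: "d = 2 * e" by (auto elim: evenE)
      have "(q ^ e) ^ 2 = 1" using d(1) e by (simp add: mult.commute flip: power_mult)
      moreover have "q ^ e \<noteq> 1" using d(2)[of e] e assms(1) by simp
      ultimately have "q ^ e = - 1" by (simp add: power2_eq_1_iff)
      then show ?thesis using e by (simp add: dbar_def)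
    qed
  qed
qed

theorem theorem5p11:
  fixes q k0 k1 k0v k1v :: "'a::field" and d :: nat
  assumes "d \<ge> 1"
    and "primitive_root_of_unity d q"
    and "k0 \<noteq> 0" and "k1 \<noteq> 0" and "k0v \<noteq> 0" and "k1v \<noteq> 0"
  shows
    "let H = daha q k0 k1 k0v k1v;
         cls = daha_class q k0 k1 k0v k1v;
         t0 = cls (free_gen G0); t1 = cls (free_gen G1);
         t0v = cls (free_gen G0v); t1v = cls (free_gen G1v);
         A = (t1 \<otimes>\<^bsub>H\<^esub> t0v) \<oplus>\<^bsub>H\<^esub> inv\<^bsub>H\<^esub> (t1 \<otimes>\<^bsub>H\<^esub> t0v);
         B = (t1v \<otimes>\<^bsub>H\<^esub> t1) \<oplus>\<^bsub>H\<^esub> inv\<^bsub>H\<^esub> (t1v \<otimes>\<^bsub>H\<^esub> t1);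
         C = (t0 \<otimes>\<^bsub>H\<^esub> t1) \<oplus>\<^bsub>H\<^esub> inv\<^bsub>H\<^esub> (t0 \<otimes>\<^bsub>H\<^esub> t1);
         c0 = k0 + inverse k0;
         c1' = inverse q * k1 + q * inverse k1;
         c0v = k0v + inverse k0v;
         c1v = k1v + inverse k1v;
         n = dbar d
     in presented_by H (\<lambda>c. cls (Const c)) (ring_center H)
          (\<lambda>v. case v of VA \<Rightarrow> cheb_in H n A | VB \<Rightarrow> cheb_in H n B | VC \<Rightarrow> cheb_in H n C)
          {center_relator q n c0v c1v c0 c1'}"
proof -
  interpret daha_root q k0 k1 k0v k1v "dbar d"
    by (rule daha_root_dbar[OF assms])
  show ?thesis
    using presentation unfolding Let_def presentation_generators relator_def .
qed

end
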